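(* Let $0<q<1$ and let $l$ be a positive integer. Then $\mathcal{O}(\Sigma_q^3(l;-))$ is a non-cleft principal $\mathcal{O}(U(1))$-comodule algebra over $\mathcal{O}(\mathbb{RP}_q^2(l;-))$ via the coaction $\varphi$.
   Context: All algebras are unital associative $*$-algebras over $\mathbb{C}$. $\mathcal{O}(U(1))=\mathbb{C}[u,u^*]$ is the Hopf $*$-algebra of Laurent polynomials in a unitary variable $u$ ($u^{-1}=u^*$) with $\Delta(u)=u\otimes u$, $\varepsilon(u)=1$, $S(u)=u^*$. $\mathcal{O}(\Sigma_q^3)$ is the $*$-algebra generated by $\zeta_0,\zeta_1$ and a central unitary $\xi$ subject to $\zeta_0\zeta_1=q\zeta_1\zeta_0$, $\zeta_0\zeta_1^*=q\zeta_1^*\zeta_0$, $\zeta_0\zeta_0^*=\zeta_0^*\zeta_0+(q^{-2}-1)\zeta_1^2\xi$, $\zeta_0\zeta_0^*+\zeta_1^2\xi=1$, $\zeta_1^*=\zeta_1\xi$. $\mathcal{O}(\mathbb{RP}_q^2(l;-))$ is the $*$-subalgebra of coinvariant elements of $\mathcal{O}(\Sigma_q^3)$ under the $*$-algebra coaction $\varrho_{1,l}$ of $\mathcal{O}(U(1))$: $\zeta_0\mapsto\zeta_0\otimes u$, $\zeta_1\mapsto\zeta_1\otimes u^l$, $\xi\mapsto\xi\otimes u^{-2l}$. It is generated as a $*$-algebra by $a=\zeta_1^2\xi$, $b=\zeta_0^l\zeta_1\xi$, $c_-=\zeta_0^{2l}\xi$. $\mathcal{O}(\Sigma_q^3(l;-))$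 is the $*$-algebra generated by $x,y$ and a central unitary $z$ subject to $y^*=yz$, $xy=q^lyx$, $xx^*=\prod_{p=0}^{l-1}(1-q^{2p}y^2z)$, $x^*x=\prod_{p=1}^{l}(1-q^{-2p}y^2z)$; it embeds into $\mathcal{O}(\Sigma_q^3)$ by $x\mapsto\zeta_0^l$, $y\mapsto\zeta_1$, $z\mapsto\xi$. It is a right $\mathcal{O}(U(1))$-comodule algebra via the $*$-algebra map $\varphi$: $x\mapsto x\otimes u$, $y\mapsto y\otimes u$, $z\mapsto z\otimes u^{-2}$. Let $H$ be a Hopf algebra with bijective antipode and $A$ a right $H$-comodule algebra with coaction $\varrho^A:A\to A\otimes H$ and coinvariant subalgebra $B=\{b\in A:\varrho^A(b)=b\otimes 1\}$. $A$ is a principal $H$-comodule algebra if (a) the canonical map $A\otimes_B A\to A\otimes H$, $a\otimes_B a'\mapsto a\varrho^A(a')$, is bijective; and (b) the multiplication map $B\otimes A\to A$ splits as a left $B$-module and right $H$-comodule map. It is called a principal comodule algebra over an algebra $C$ if its coinvariant subalgebra $B$ is isomorphic to $C$ (here via the embedding $\mathcal{O}(\Sigma_q^3(l;-))\hookrightarrow\mathcal{O}(\Sigma_q^3)$ given by $x\mapsto\zeta_0^l$, $y\mapsto\zeta_1$, $z\mapsto\xi$). $A$ is cleft if there is a right $H$-colinear map $j:H\to A$ with $j(1)=1$ that is invertible in the convolution algebra $\mathrm{Hom}(H,A)$ (product $f\otimes g\mapsto\mu\circ(f\otimes g)\circ\Delta$, with $\mu$ the multiplication of $A$, and unit $h\mapsto\varepsilon(h)1$);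 non-cleft means not cleft. *)

theory Defs
  imports Complex_Main "HOL-Library.Poly_Mapping" "HOL-Algebra.Module" "HOL-Algebra.QuotRing"
begin

section \<open>Complex *-algebras\<close>

record 'a star_alg = "(complex, 'a) module" +
  star :: "'a \<Rightarrow> 'a"

definition complex_alg :: "complex star_alg" where
  "complex_alg =
    \<lparr>carrier = UNIV, monoid.mult = (*), monoid.one = 1, ring.zero = 0, ring.add = (+),
     smult = (*), star = cnj\<rparr>"

locale complex_algebra = Module.module complex_alg A + ring A
  for A :: "('a, 'm) star_alg_scheme" (structure) +
  assumes smult_mult_left:
      "\<lbrakk>x \<in> carrier A; y \<in> carrier A\<rbrakk> \<Longrightarrow> (c \<odot> x) \<otimes> y = c \<odot> (x \<otimes> y)"
    and smult_mult_right:
      "\<lbrakk>x \<in> carrier A; y \<in> carrier A\<rbrakk> \<Longrightarrow> x \<otimes> (c \<odot> y) = c \<odot> (x \<otimes> y)"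

locale star_algebra = complex_algebra +
  assumes star_closed: "x \<in> carrier A \<Longrightarrow> star A x \<in> carrier A"
    and star_star: "x \<in> carrier A \<Longrightarrow> star A (star A x) = x"
    and star_add:
      "\<lbrakk>x \<in> carrier A; y \<in> carrier A\<rbrakk> \<Longrightarrow> star A (x \<oplus> y) = star A x \<oplus> star A y"
    and star_smult: "x \<in> carrier A \<Longrightarrow> star A (c \<odot> x) = cnj c \<odot> star A x"
    and star_mult:
      "\<lbrakk>x \<in> carrier A; y \<in> carrier A\<rbrakk> \<Longrightarrow> star A (x \<otimes> y) = star A y \<otimes> star A x"

definition linear_maps ::
    "('a, 'm) star_alg_scheme \<Rightarrow> ('b, 'n) star_alg_scheme \<Rightarrow> ('a \<Rightarrow> 'b) set" where
  "linear_maps A B = {f \<in> carrier A \<rightarrow> carrier B.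
     (\<forall>x\<in>carrier A. \<forall>y\<in>carrier A. f (x \<oplus>\<^bsub>A\<^esub> y) = f x \<oplus>\<^bsub>B\<^esub> f y) \<and>
     (\<forall>c. \<forall>x\<in>carrier A. f (c \<odot>\<^bsub>A\<^esub> x) = c \<odot>\<^bsub>B\<^esub> f x)}"

definition alg_hom ::
    "('a, 'm) star_alg_scheme \<Rightarrow> ('b, 'n) star_alg_scheme \<Rightarrow> ('a \<Rightarrow> 'b) set" where
  "alg_hom A B = ring_hom A B \<inter> linear_maps A B"

definition star_alg_hom ::
    "('a, 'm) star_alg_scheme \<Rightarrow> ('b, 'n) star_alg_scheme \<Rightarrow> ('a \<Rightarrow> 'b) set" where
  "star_alg_hom A B = {f \<in> alg_hom A B. \<forall>x\<in>carrier A. f (star A x) = star B (f x)}"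

definition star_alg_iso ::
    "('a, 'm) star_alg_scheme \<Rightarrow> ('b, 'n) star_alg_scheme \<Rightarrow> ('a \<Rightarrow> 'b) set" where
  "star_alg_iso A B = {f \<in> star_alg_hom A B. bij_betw f (carrier A) (carrier B)}"

definition quot_alg :: "('a, 'm) star_alg_scheme \<Rightarrow> 'a set \<Rightarrow> 'a set star_alg" where
  "quot_alg F I =
    \<lparr>carrier = carrier (F Quot I), monoid.mult = monoid.mult (F Quot I),
     monoid.one = monoid.one (F Quot I),
     ring.zero = ring.zero (F Quot I), ring.add = ring.add (F Quot I),
     smult = (\<lambda>c X. \<Union>x\<in>X. I +>\<^bsub>F\<^esub> (c \<odot>\<^bsub>F\<^esub> x)),
     star = (\<lambda>X. \<Union>x\<in>X. I +>\<^bsub>F\<^esub> star F x)\<rparr>"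

definition pm_scale :: "complex \<Rightarrow> ('k \<Rightarrow>\<^sub>0 complex) \<Rightarrow> ('k \<Rightarrow>\<^sub>0 complex)" where
  "pm_scale c p = Poly_Mapping.map ((*) c) p"


section \<open>Presentations by generators and relations\<close>

datatype 'g letter = Gen 'g | Gen_star 'g

datatype 'g star_word = Word (letters: "'g letter list")

text \<open>The monoid of words is written additively, so that the convolution product on
  \<^typ>\<open>'g star_word \<Rightarrow>\<^sub>0 complex\<close> is the product of the free algebra.\<close>

instantiation star_word :: (type) monoid_add
begin

definition "0 = Word []"
definition "v + w = Word (letters v @ letters w)"

instance
  by standard (auto simp: zero_star_word_def plus_star_word_def)

end

type_synonym 'g free_elem = "'g star_word \<Rightarrow>\<^sub>0 complex"

fun letter_star :: "'g letter \<Rightarrow> 'g letter" where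
  "letter_star (Gen g) = Gen_star g"
| "letter_star (Gen_star g) = Gen g"

definition word_star :: "'g star_word \<Rightarrow> 'g star_word" where
  "word_star w = Word (rev (map letter_star (letters w)))"

definition free_star :: "'g free_elem \<Rightarrow> 'g free_elem" where
  "free_star p =
    (\<Sum>w\<in>Poly_Mapping.keys p. Poly_Mapping.single (word_star w) (cnj (Poly_Mapping.lookup p w)))"

definition free_alg :: "'g free_elem star_alg" where
  "free_alg =
    \<lparr>carrier = UNIV, monoid.mult = (*), monoid.one = 1, ring.zero = 0, ring.add = (+),
     smult = pm_scale, star = free_star\<rparr>"

definition letter_elem :: "'g letter \<Rightarrow> 'g free_elem" where
  "letter_elem a = Poly_Mapping.single (Word [a]) 1"

definition gen :: "'g \<Rightarrow> 'g free_elem" where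
  "gen g = letter_elem (Gen g)"

definition gen_star :: "'g \<Rightarrow> 'g free_elem" where
  "gen_star g = letter_elem (Gen_star g)"

definition star_ideal :: "'g free_elem set \<Rightarrow> 'g free_elem set" where
  "star_ideal R = Idl\<^bsub>free_alg\<^esub> (R \<union> free_star ` R)"

definition presented_alg :: "'g free_elem set \<Rightarrow> 'g free_elem set star_alg" where
  "presented_alg R = quot_alg free_alg (star_ideal R)"

definition presented_gen :: "'g free_elem set \<Rightarrow> 'g \<Rightarrow> 'g free_elem set" where
  "presented_gen R g = star_ideal R +>\<^bsub>free_alg\<^esub> gen g"

fun letter_eval :: "('b, 'n) star_alg_scheme \<Rightarrow> ('g \<Rightarrow> 'b) \<Rightarrow> 'g letter \<Rightarrow> 'b" where
  "letter_eval T f (Gen g) = f g"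
| "letter_eval T f (Gen_star g) = star T (f g)"

definition free_eval :: "('b, 'n) star_alg_scheme \<Rightarrow> ('g \<Rightarrow> 'b) \<Rightarrow> 'g free_elem \<Rightarrow> 'b" where
  "free_eval T f p = (\<Oplus>\<^bsub>T\<^esub>w\<in>Poly_Mapping.keys p.
     Poly_Mapping.lookup p w \<odot>\<^bsub>T\<^esub> foldr (\<lambda>a t. letter_eval T f a \<otimes>\<^bsub>T\<^esub> t) (letters w) \<one>\<^bsub>T\<^esub>)"

text \<open>The *-algebra map with values \<open>f g\<close> on the generators. When \<open>f\<close> respects the relations,
  \<^const>\<open>free_eval\<close> is constant on each residue class, and \<^const>\<open>the_elem\<close> picks that value.\<close>

definition presented_map ::
    "('b, 'n) star_alg_scheme \<Rightarrow> ('g \<Rightarrow> 'b) \<Rightarrow> 'g free_elem set \<Rightarrow> 'b" where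
  "presented_map T f X = the_elem (free_eval T f ` X)"


section \<open>Tensor products over the complex numbers\<close>

text \<open>\<open>pair_alg A B\<close> is the complex vector space freely spanned by the pairs in
  \<open>carrier A \<times> carrier B\<close>, with the products and stars of basis vectors taken componentwise.
  The relations of bilinearity span a two-sided *-ideal in it, and \<open>A \<otimes> B\<close> is the quotient.\<close>

definition pair_alg ::
    "('a, 'm) star_alg_scheme \<Rightarrow> ('b, 'n) star_alg_scheme \<Rightarrow> ('a \<times> 'b \<Rightarrow>\<^sub>0 complex) star_alg" where
  "pair_alg A B =
    \<lparr>carrier = {p. Poly_Mapping.keys p \<subseteq> carrier A \<times> carrier B},
     monoid.mult = (\<lambda>p r. \<Sum>(a, b)\<in>Poly_Mapping.keys p. \<Sum>(a', b')\<in>Poly_Mapping.keys r.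
       Poly_Mapping.single (a \<otimes>\<^bsub>A\<^esub> a', b \<otimes>\<^bsub>B\<^esub> b')
         (Poly_Mapping.lookup p (a, b) * Poly_Mapping.lookup r (a', b'))),
     monoid.one = Poly_Mapping.single (\<one>\<^bsub>A\<^esub>, \<one>\<^bsub>B\<^esub>) 1,
     ring.zero = 0,
     ring.add = (+),
     smult = pm_scale,
     star = (\<lambda>p. \<Sum>(a, b)\<in>Poly_Mapping.keys p.
       Poly_Mapping.single (star A a, star B b) (cnj (Poly_Mapping.lookup p (a, b))))\<rparr>"

definition bilinear_rels ::
    "('a, 'm) star_alg_scheme \<Rightarrow> ('b, 'n) star_alg_scheme \<Rightarrow> ('a \<times> 'b \<Rightarrow>\<^sub>0 complex) set" where
  "bilinear_rels A B =
    {Poly_Mapping.single (a \<oplus>\<^bsub>A\<^esub> a', b) 1 - Poly_Mapping.single (a, b) 1 - Poly_Mapping.single (a', b) 1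
      | a a' b. a \<in> carrier A \<and> a' \<in> carrier A \<and> b \<in> carrier B} \<union>
    {Poly_Mapping.single (a, b \<oplus>\<^bsub>B\<^esub> b') 1 - Poly_Mapping.single (a, b) 1 - Poly_Mapping.single (a, b') 1
      | a b b'. a \<in> carrier A \<and> b \<in> carrier B \<and> b' \<in> carrier B} \<union>
    {Poly_Mapping.single (c \<odot>\<^bsub>A\<^esub> a, b) 1 - Poly_Mapping.single (a, b) c
      | c a b. a \<in> carrier A \<and> b \<in> carrier B} \<union>
    {Poly_Mapping.single (a, c \<odot>\<^bsub>B\<^esub> b) 1 - Poly_Mapping.single (a, b) c
      | c a b. a \<in> carrier A \<and> b \<in> carrier B}"

abbreviation pm_span :: "('k \<Rightarrow>\<^sub>0 complex) set \<Rightarrow> ('k \<Rightarrow>\<^sub>0 complex) set" where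
  "pm_span \<equiv> Modules.module.span pm_scale"

type_synonym ('a, 'b) tens = "('a \<times> 'b \<Rightarrow>\<^sub>0 complex) set"

definition tensor ::
    "('a, 'm) star_alg_scheme \<Rightarrow> ('b, 'n) star_alg_scheme \<Rightarrow> ('a, 'b) tens star_alg" where
  "tensor A B = quot_alg (pair_alg A B) (pm_span (bilinear_rels A B))"

definition pure ::
    "('a, 'm) star_alg_scheme \<Rightarrow> ('b, 'n) star_alg_scheme \<Rightarrow> 'a \<Rightarrow> 'b \<Rightarrow> ('a, 'b) tens" where
  "pure A B a b =
    pm_span (bilinear_rels A B) +>\<^bsub>pair_alg A B\<^esub> Poly_Mapping.single (a, b) 1"

text \<open>The linear map \<open>a \<otimes> b \<mapsto> f a b\<close> into \<open>T\<close>, for \<open>f\<close> bilinear (and balanced, if the tensor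
  product is taken over a subalgebra).\<close>

definition tensor_lift ::
    "('c, 'n) star_alg_scheme \<Rightarrow> ('a \<Rightarrow> 'b \<Rightarrow> 'c) \<Rightarrow> ('a, 'b) tens \<Rightarrow> 'c" where
  "tensor_lift T f X = the_elem
    ((\<lambda>p. \<Oplus>\<^bsub>T\<^esub>k\<in>Poly_Mapping.keys p. Poly_Mapping.lookup p k \<odot>\<^bsub>T\<^esub> f (fst k) (snd k)) ` X)"

text \<open>\<open>tensor_map C D f g\<close> is \<open>f \<otimes> g\<close> with values in \<open>C \<otimes> D\<close>.\<close>

definition tensor_map ::
    "('c, 'm) star_alg_scheme \<Rightarrow> ('d, 'n) star_alg_scheme \<Rightarrow> ('a \<Rightarrow> 'c) \<Rightarrow> ('b \<Rightarrow> 'd)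
      \<Rightarrow> ('a, 'b) tens \<Rightarrow> ('c, 'd) tens" where
  "tensor_map C D f g = tensor_lift (tensor C D) (\<lambda>a b. pure C D (f a) (g b))"

definition tensor_assoc ::
    "('a, 'm) star_alg_scheme \<Rightarrow> ('b, 'n) star_alg_scheme \<Rightarrow> ('c, 'k) star_alg_scheme
      \<Rightarrow> (('a, 'b) tens, 'c) tens \<Rightarrow> ('a, ('b, 'c) tens) tens" where
  "tensor_assoc A B C =
    tensor_lift (tensor A (tensor B C))
      (\<lambda>t c. tensor_lift (tensor A (tensor B C)) (\<lambda>a b. pure A (tensor B C) a (pure B C b c)) t)"


section \<open>Hopf algebras and comodule algebras\<close>

record 'h hopf_alg = "'h star_alg" +
  comult :: "'h \<Rightarrow> ('h, 'h) tens"
  counit :: "'h \<Rightarrow> complex"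
  antipode :: "'h \<Rightarrow> 'h"

locale hopf_algebra = star_algebra H for H :: "('h, 'm) hopf_alg_scheme" (structure) +
  assumes comult_hom: "comult H \<in> alg_hom H (tensor H H)"
    and counit_hom: "counit H \<in> alg_hom H complex_alg"
    and antipode_linear: "antipode H \<in> linear_maps H H"
    and coassociative: "h \<in> carrier H \<Longrightarrow>
      tensor_assoc H H H (tensor_map (tensor H H) H (comult H) id (comult H h)) =
      tensor_map H (tensor H H) id (comult H) (comult H h)"
    and counit_left: "h \<in> carrier H \<Longrightarrow>
      tensor_lift H (\<lambda>h' h''. counit H h' \<odot> h'') (comult H h) = h"
    and counit_right: "h \<in> carrier H \<Longrightarrow>
      tensor_lift H (\<lambda>h' h''. counit H h'' \<odot> h') (comult H h) = h"
    and antipode_left: "h \<in> carrier H \<Longrightarrow>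
      tensor_lift H (\<lambda>h' h''. antipode H h' \<otimes> h'') (comult H h) = counit H h \<odot> \<one>"
    and antipode_right: "h \<in> carrier H \<Longrightarrow>
      tensor_lift H (\<lambda>h' h''. h' \<otimes> antipode H h'') (comult H h) = counit H h \<odot> \<one>"

locale comodule_algebra = H: hopf_algebra H + A: star_algebra A
  for H :: "('h, 'm) hopf_alg_scheme" and A :: "('a, 'n) star_alg_scheme" +
  fixes \<rho> :: "'a \<Rightarrow> ('a, 'h) tens"
  assumes coaction_hom: "\<rho> \<in> alg_hom A (tensor A H)"
    and coaction_coassociative: "a \<in> carrier A \<Longrightarrow>
      tensor_assoc A H H (tensor_map (tensor A H) H \<rho> id (\<rho> a)) =
      tensor_map A (tensor H H) id (comult H) (\<rho> a)"
    and coaction_counital: "a \<in> carrier A \<Longrightarrow>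
      tensor_lift A (\<lambda>a' h. counit H h \<odot>\<^bsub>A\<^esub> a') (\<rho> a) = a"

definition coinv_alg ::
    "('h, 'm) star_alg_scheme \<Rightarrow> ('a, 'n) star_alg_scheme \<Rightarrow> ('a \<Rightarrow> ('a, 'h) tens)
      \<Rightarrow> ('a, 'n) star_alg_scheme" where
  "coinv_alg H A \<rho> = A\<lparr>carrier := {b \<in> carrier A. \<rho> b = pure A H b \<one>\<^bsub>H\<^esub>}\<rparr>"

definition balanced_rels ::
    "('a, 'm) star_alg_scheme \<Rightarrow> ('a, 'n) star_alg_scheme \<Rightarrow> ('a \<times> 'a \<Rightarrow>\<^sub>0 complex) set" where
  "balanced_rels B A =
    {Poly_Mapping.single (a \<otimes>\<^bsub>A\<^esub> b, a') 1 - Poly_Mapping.single (a, b \<otimes>\<^bsub>A\<^esub> a') 1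
      | a b a'. a \<in> carrier A \<and> b \<in> carrier B \<and> a' \<in> carrier A}"

text \<open>The set underlying \<open>A \<otimes>\<^bsub>B\<^esub> A\<close>, for \<open>B\<close> a subalgebra of \<open>A\<close>.\<close>

definition balanced_tensors ::
    "('a, 'm) star_alg_scheme \<Rightarrow> ('a, 'n) star_alg_scheme \<Rightarrow> ('a, 'a) tens set" where
  "balanced_tensors B A =
    a_rcosets\<^bsub>pair_alg A A\<^esub> (pm_span (bilinear_rels A A \<union> balanced_rels B A))"

definition canonical_map ::
    "('h, 'm) star_alg_scheme \<Rightarrow> ('a, 'n) star_alg_scheme \<Rightarrow> ('a \<Rightarrow> ('a, 'h) tens)
      \<Rightarrow> ('a, 'a) tens \<Rightarrow> ('a, 'h) tens" where
  "canonical_map H A \<rho> =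
    tensor_lift (tensor A H) (\<lambda>a a'. pure A H a \<one>\<^bsub>H\<^esub> \<otimes>\<^bsub>tensor A H\<^esub> \<rho> a')"

text \<open>\<open>B \<otimes> A\<close> is a left \<open>B\<close>-module through its first factor and a right \<open>H\<close>-comodule through
  \<open>id \<otimes> \<rho>\<close>.\<close>

definition mult_splitting ::
    "('h, 'm) star_alg_scheme \<Rightarrow> ('a, 'n) star_alg_scheme \<Rightarrow> ('a \<Rightarrow> ('a, 'h) tens)
      \<Rightarrow> ('a \<Rightarrow> ('a, 'a) tens) \<Rightarrow> bool" where
  "mult_splitting H A \<rho> s \<longleftrightarrow> (let B = coinv_alg H A \<rho> in
     s \<in> linear_maps A (tensor B A) \<and>
     (\<forall>a\<in>carrier A. tensor_lift A (\<lambda>b a'. b \<otimes>\<^bsub>A\<^esub> a') (s a) = a) \<and>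
     (\<forall>b\<in>carrier B. \<forall>a\<in>carrier A.
        s (b \<otimes>\<^bsub>A\<^esub> a) = pure B A b \<one>\<^bsub>A\<^esub> \<otimes>\<^bsub>tensor B A\<^esub> s a) \<and>
     (\<forall>a\<in>carrier A.
        tensor_map B (tensor A H) id \<rho> (s a) =
        tensor_assoc B A H (tensor_map (tensor B A) H s id (\<rho> a))))"

locale principal_comodule_algebra = comodule_algebra +
  assumes antipode_bij: "bij_betw (antipode H) (carrier H) (carrier H)"
    and canonical_bij:
      "bij_betw (canonical_map H A \<rho>)
        (balanced_tensors (coinv_alg H A \<rho>) A) (carrier (tensor A H))"
    and splits: "\<exists>s. mult_splitting H A \<rho> s"

definition convolution ::
    "('h, 'm) hopf_alg_scheme \<Rightarrow> ('a, 'n) star_alg_scheme \<Rightarrow> ('h \<Rightarrow> 'a) \<Rightarrow> ('h \<Rightarrow> 'a) \<Rightarrow> 'h \<Rightarrow> 'a" where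
  "convolution H A f g h = tensor_lift A (\<lambda>h' h''. f h' \<otimes>\<^bsub>A\<^esub> g h'') (comult H h)"

definition convolution_invertible ::
    "('h, 'm) hopf_alg_scheme \<Rightarrow> ('a, 'n) star_alg_scheme \<Rightarrow> ('h \<Rightarrow> 'a) \<Rightarrow> bool" where
  "convolution_invertible H A f \<longleftrightarrow> (\<exists>g\<in>linear_maps H A. \<forall>h\<in>carrier H.
     convolution H A f g h = counit H h \<odot>\<^bsub>A\<^esub> \<one>\<^bsub>A\<^esub> \<and>
     convolution H A g f h = counit H h \<odot>\<^bsub>A\<^esub> \<one>\<^bsub>A\<^esub>)"

definition cleft ::
    "('h, 'm) hopf_alg_scheme \<Rightarrow> ('a, 'n) star_alg_scheme \<Rightarrow> ('a \<Rightarrow> ('a, 'h) tens) \<Rightarrow> bool" where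
  "cleft H A \<rho> \<longleftrightarrow> (\<exists>j\<in>linear_maps H A.
     (\<forall>h\<in>carrier H. \<rho> (j h) = tensor_map A H j id (comult H h)) \<and>
     j \<one>\<^bsub>H\<^esub> = \<one>\<^bsub>A\<^esub> \<and>
     convolution_invertible H A j)"


section \<open>The Hopf *-algebra of the circle group\<close>

type_synonym laurent = "int \<Rightarrow>\<^sub>0 complex"

definition u_pow :: "int \<Rightarrow> laurent" where
  "u_pow n = Poly_Mapping.single n 1"

definition laurent_alg :: "laurent star_alg" where
  "laurent_alg =
    \<lparr>carrier = UNIV, monoid.mult = (*), monoid.one = 1, ring.zero = 0, ring.add = (+),
     smult = pm_scale,
     star = (\<lambda>p. \<Sum>n\<in>Poly_Mapping.keys p. Poly_Mapping.single (- n) (cnj (Poly_Mapping.lookup p n)))\<rparr>"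

definition O_U1 :: "laurent hopf_alg" where
  "O_U1 = star_alg.extend laurent_alg (hopf_alg.fields
     (\<lambda>p. \<Oplus>\<^bsub>tensor laurent_alg laurent_alg\<^esub>n\<in>Poly_Mapping.keys p.
        Poly_Mapping.lookup p n \<odot>\<^bsub>tensor laurent_alg laurent_alg\<^esub>
          pure laurent_alg laurent_alg (u_pow n) (u_pow n))
     (\<lambda>p. \<Sum>n\<in>Poly_Mapping.keys p. Poly_Mapping.lookup p n)
     (\<lambda>p. \<Sum>n\<in>Poly_Mapping.keys p. Poly_Mapping.single (- n) (Poly_Mapping.lookup p n)))"


section \<open>The quantum Seifert and projective spaces\<close>

definition central_unitary_rels :: "'g \<Rightarrow> 'g free_elem set" where
  "central_unitary_rels g =
    {gen g * gen_star g - 1, gen_star g * gen g - 1} \<union>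
    range (\<lambda>a. gen g * letter_elem a - letter_elem a * gen g)"

datatype sigma_gen = Zeta0 | Zeta1 | Xi

definition Sigma_rels :: "real \<Rightarrow> sigma_gen free_elem set" where
  "Sigma_rels q =
    {gen Zeta0 * gen Zeta1 - pm_scale (of_real q) (gen Zeta1 * gen Zeta0),
     gen Zeta0 * gen_star Zeta1 - pm_scale (of_real q) (gen_star Zeta1 * gen Zeta0),
     gen Zeta0 * gen_star Zeta0
       - (gen_star Zeta0 * gen Zeta0
          + pm_scale (of_real (1 / q ^ 2 - 1)) (gen Zeta1 ^ 2 * gen Xi)),
     gen Zeta0 * gen_star Zeta0 + gen Zeta1 ^ 2 * gen Xi - 1,
     gen_star Zeta1 - gen Zeta1 * gen Xi}
    \<union> central_unitary_rels Xi"

definition O_Sigma :: "real \<Rightarrow> sigma_gen free_elem set star_alg" where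
  "O_Sigma q = presented_alg (Sigma_rels q)"

definition rho_Sigma ::
    "real \<Rightarrow> nat \<Rightarrow> sigma_gen free_elem set \<Rightarrow> (sigma_gen free_elem set, laurent) tens" where
  "rho_Sigma q l = presented_map (tensor (O_Sigma q) O_U1)
    (\<lambda>g. pure (O_Sigma q) O_U1 (presented_gen (Sigma_rels q) g)
       (case g of Zeta0 \<Rightarrow> u_pow 1 | Zeta1 \<Rightarrow> u_pow (int l) | Xi \<Rightarrow> u_pow (- 2 * int l)))"

definition O_RP :: "real \<Rightarrow> nat \<Rightarrow> sigma_gen free_elem set star_alg" where
  "O_RP q l = coinv_alg O_U1 (O_Sigma q) (rho_Sigma q l)"

datatype sigma_l_gen = X | Y | Z

definition Sigma_l_rels :: "real \<Rightarrow> nat \<Rightarrow> sigma_l_gen free_elem set" where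
  "Sigma_l_rels q l =
    {gen_star Y - gen Y * gen Z,
     gen X * gen Y - pm_scale (of_real (q ^ l)) (gen Y * gen X),
     gen X * gen_star X
       - (\<Prod>p\<leftarrow>[0..<l]. 1 - pm_scale (of_real (q ^ (2 * p))) (gen Y ^ 2 * gen Z)),
     gen_star X * gen X
       - (\<Prod>p\<leftarrow>[1..<l + 1]. 1 - pm_scale (of_real (1 / q ^ (2 * p))) (gen Y ^ 2 * gen Z))}
    \<union> central_unitary_rels Z"

definition O_Sigma_l :: "real \<Rightarrow> nat \<Rightarrow> sigma_l_gen free_elem set star_alg" where
  "O_Sigma_l q l = presented_alg (Sigma_l_rels q l)"

definition phi_l ::
    "real \<Rightarrow> nat \<Rightarrow> sigma_l_gen free_elem set \<Rightarrow> (sigma_l_gen free_elem set, laurent) tens" where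
  "phi_l q l = presented_map (tensor (O_Sigma_l q l) O_U1)
    (\<lambda>g. pure (O_Sigma_l q l) O_U1 (presented_gen (Sigma_l_rels q l) g)
       (case g of X \<Rightarrow> u_pow 1 | Y \<Rightarrow> u_pow 1 | Z \<Rightarrow> u_pow (- 2)))"

definition embed_l :: "real \<Rightarrow> nat \<Rightarrow> sigma_l_gen free_elem set \<Rightarrow> sigma_gen free_elem set" where
  "embed_l q l = presented_map (O_Sigma q)
    (\<lambda>g. case g of
       X \<Rightarrow> presented_gen (Sigma_rels q) Zeta0 [^]\<^bsub>O_Sigma q\<^esub> l
     | Y \<Rightarrow> presented_gen (Sigma_rels q) Zeta1
     | Z \<Rightarrow> presented_gen (Sigma_rels q) Xi)"

end

theory Submission
  imports Defs "HOL-Computational_Algebra.Polynomial"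
begin

text \<open>Give \<open>x\<close>, \<open>y\<close>, \<open>z\<close> the degrees \<open>1\<close>, \<open>1\<close>, \<open>-2\<close>. All relations are homogeneous, so the
  algebra \<open>A\<close> of the quantum Seifert space is graded by the integers, and \<open>\<phi>\<close> is the coaction
  \<open>v \<mapsto> v \<otimes> u\<^sup>n\<close> for \<open>v\<close> of degree \<open>n\<close>. The coinvariants are the elements of degree zero.

  Principality. Put \<open>a = y\<^sup>2 z\<close>, an element of degree zero that is both \<open>y (y z)\<close> and \<open>(y z) y\<close>,
  where \<open>y z\<close> has degree \<open>-1\<close>. As \<open>x x\<^sup>*\<close> and \<open>x\<^sup>* x\<close> are products of factors \<open>1 - c a\<close>,
  they differ from \<open>1\<close> by multiples of \<open>a\<close>; hence \<open>1\<close> is in \<open>A\<^sub>1 A\<^sub>-\<^sub>1\<close> and in \<open>A\<^sub>-\<^sub>1 A\<^sub>1\<close>, that is,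
  the grading is strong. Then for each \<open>n\<close> there is a finite sum \<open>\<Sum> \<nu>\<^sub>i \<omega>\<^sub>i = 1\<close> with \<open>\<nu>\<^sub>i\<close> of degree
  \<open>-n\<close> and \<open>\<omega>\<^sub>i\<close> of degree \<open>n\<close>. The assignment \<open>v \<otimes> u\<^sup>n \<mapsto> \<Sum> v \<nu>\<^sub>i \<otimes> \<omega>\<^sub>i\<close> inverts the canonical map,
  and the same formula, applied to \<open>\<phi> v\<close>, splits the multiplication
  (\<open>strongly_graded_algebra.principal_comodule_algebra\<close>).

  Coinvariants. The monomials \<open>x\<^sup>k y\<^sup>m z\<^sup>n\<close>, with \<open>x\<^sup>*\<close> in place of the inverse of \<open>x\<close>, span \<open>A\<close>, and
  likewise \<open>\<zeta>\<^sub>0\<^sup>k \<zeta>\<^sub>1\<^sup>m \<xi>\<^sup>n\<close> span the algebra of \<open>\<Sigma>\<^sub>q\<^sup>3\<close>, which has relations of the same form for \<open>l = 1\<close>.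
  A monomial of the latter kind has degree \<open>k + l m - 2 l n\<close>; if this vanishes, then \<open>l\<close> divides
  \<open>k\<close> and the monomial is the image of one of degree zero, which gives surjectivity. For
  injectivity, the algebra of \<open>\<Sigma>\<^sub>q\<^sup>3\<close> acts on functions from the integers to \<open>\<complex>[Y]\<close>: \<open>\<zeta>\<^sub>0\<close> is the
  shift, \<open>\<zeta>\<^sub>1\<close> multiplies the value at \<open>i\<close> by \<open>q\<^sup>i Y\<close>, and \<open>\<xi>\<close> is the identity. In degree zero the
  exponents of \<open>x\<close> and \<open>y\<close> determine that of \<open>z\<close>, so nothing is lost by sending \<open>\<xi>\<close> to \<open>1\<close> and
  all coefficients of an element can be read off from its operator.

  Non-cleftness. A cleaving map sends \<open>u\<close> to an invertible element of degree one. In the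
  representation this element and its inverse are finite sums of shifts with coefficients in
  \<open>\<complex>[Y]\<close>. Since \<open>\<complex>[Y]\<close> has no zero divisors, the highest shifts of the two must cancel, and so must
  the lowest ones; hence only one shift \<open>k\<close> occurs in the unit, and its coefficient is a unit of
  \<open>\<complex>[Y]\<close>. A coefficient of a negative shift is divisible by some \<open>1 - w\<^sup>2 Y\<^sup>2\<close>, which comes from the
  action of \<open>x\<^sup>*\<close>; applied to the unit and to its inverse this leaves \<open>k = 0\<close>. Then only monomials
  \<open>y\<^sup>m z\<^sup>n\<close> with \<open>m - 2 n = 1\<close> occur, the coefficient is an odd polynomial in \<open>Y\<close>, and it is not a unit
  (\<open>no_unit_of_degree_one\<close>).\<close>


abbreviation "keys \<equiv> Poly_Mapping.keys"
abbreviation "lookup \<equiv> Poly_Mapping.lookup"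
abbreviation "single \<equiv> Poly_Mapping.single"


section \<open>Complex vector spaces and linear extension\<close>

lemma complex_alg_simps [simp]:
  "carrier complex_alg = UNIV" "monoid.mult complex_alg = (*)" "monoid.one complex_alg = 1"
  "ring.zero complex_alg = 0" "ring.add complex_alg = (+)" "module.smult complex_alg = (*)"
  "star complex_alg = cnj"
  by (simp_all add: complex_alg_def)

lemma cring_complex_alg: "cring complex_alg"
  by (intro cringI abelian_groupI comm_monoidI)
     (auto simp: algebra_simps intro: exI[of _ "- x" for x])

text \<open>Complex vector spaces. The facts of \<^locale>\<open>Module.module\<close> speak of the operations of
  \<^const>\<open>complex_alg\<close>; they are restated for those of the type \<^typ>\<open>complex\<close>. Much of the linear algebra
  below concerns spaces without a product, such as the tensor product over a subalgebra.\<close>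

locale cvs = Module.module complex_alg V for V :: "('a, 'm) star_alg_scheme" (structure)
begin

lemma sm_closed: "x \<in> carrier V \<Longrightarrow> c \<odot> x \<in> carrier V"
  by simp
lemma sm_add_l: "x \<in> carrier V \<Longrightarrow> (a + b) \<odot> x = a \<odot> x \<oplus> b \<odot> x"
  using smult_l_distr[of a b x] by simp
lemma sm_add_r: "x \<in> carrier V \<Longrightarrow> y \<in> carrier V \<Longrightarrow> c \<odot> (x \<oplus> y) = c \<odot> x \<oplus> c \<odot> y"
  using smult_r_distr[of c x y] by simp
lemma sm_sm: "x \<in> carrier V \<Longrightarrow> a \<odot> (b \<odot> x) = (a * b) \<odot> x"
  using smult_assoc1[of a b x] by simp
lemma sm_1 [simp]: "x \<in> carrier V \<Longrightarrow> 1 \<odot> x = x"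
  using smult_one[of x] by simp
lemma sm_0 [simp]: "x \<in> carrier V \<Longrightarrow> 0 \<odot> x = \<zero>"
  using smult_l_null[of x] by simp
lemma sm_zero [simp]: "c \<odot> \<zero> = \<zero>"
  using smult_r_null[of c] by simp
lemma sm_m1: "x \<in> carrier V \<Longrightarrow> (-1) \<odot> x = \<ominus> x"
  using sm_add_l[of x "-1" 1] by (intro M.minus_equality[symmetric]) auto

end

lemma cvsI:
  fixes V :: "('a, 'm) star_alg_scheme" (structure)
  assumes "\<zero> \<in> carrier V"
    and "\<And>x y. x \<in> carrier V \<Longrightarrow> y \<in> carrier V \<Longrightarrow> x \<oplus> y \<in> carrier V"
    and "\<And>c x. x \<in> carrier V \<Longrightarrow> c \<odot> x \<in> carrier V"
    and "\<And>x y z. x \<in> carrier V \<Longrightarrow> y \<in> carrier V \<Longrightarrow> z \<in> carrier V \<Longrightarrow> (x \<oplus> y) \<oplus> z = x \<oplus> (y \<oplus> z)"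
    and "\<And>x y. x \<in> carrier V \<Longrightarrow> y \<in> carrier V \<Longrightarrow> x \<oplus> y = y \<oplus> x"
    and "\<And>x. x \<in> carrier V \<Longrightarrow> \<zero> \<oplus> x = x"
    and "\<And>x. x \<in> carrier V \<Longrightarrow> (-1) \<odot> x \<oplus> x = \<zero>"
    and "\<And>a b x. x \<in> carrier V \<Longrightarrow> (a + b) \<odot> x = a \<odot> x \<oplus> b \<odot> x"
    and "\<And>c x y. x \<in> carrier V \<Longrightarrow> y \<in> carrier V \<Longrightarrow> c \<odot> (x \<oplus> y) = c \<odot> x \<oplus> c \<odot> y"
    and "\<And>a b x. x \<in> carrier V \<Longrightarrow> (a * b) \<odot> x = a \<odot> (b \<odot> x)"
    and "\<And>x. x \<in> carrier V \<Longrightarrow> 1 \<odot> x = x"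
  shows "cvs V"
  unfolding cvs_def
proof (intro Module.moduleI cring_complex_alg abelian_groupI)
  show "\<exists>y\<in>carrier V. y \<oplus> x = \<zero>" if "x \<in> carrier V" for x
    using assms(3)[of x "-1"] assms(7)[of x] that by blast
qed (unfold complex_alg_simps, (rule assms; assumption)+)

lemma complex_algebra_cvs: "complex_algebra A \<Longrightarrow> cvs A"
  by (simp add: complex_algebra_def cvs_def)

sublocale complex_algebra \<subseteq> cvs A
  by (rule complex_algebra_cvs) (rule complex_algebra_axioms)

lemma complex_algebraI:
  fixes A :: "('a, 'm) star_alg_scheme" (structure)
  assumes "cvs A"
    and "\<one> \<in> carrier A"
    and "\<And>x y. x \<in> carrier A \<Longrightarrow> y \<in> carrier A \<Longrightarrow> x \<otimes> y \<in> carrier A"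
    and "\<And>x y z. x \<in> carrier A \<Longrightarrow> y \<in> carrier A \<Longrightarrow> z \<in> carrier A \<Longrightarrow> (x \<otimes> y) \<otimes> z = x \<otimes> (y \<otimes> z)"
    and "\<And>x. x \<in> carrier A \<Longrightarrow> \<one> \<otimes> x = x"
    and "\<And>x. x \<in> carrier A \<Longrightarrow> x \<otimes> \<one> = x"
    and "\<And>x y z. x \<in> carrier A \<Longrightarrow> y \<in> carrier A \<Longrightarrow> z \<in> carrier A \<Longrightarrow> (x \<oplus> y) \<otimes> z = x \<otimes> z \<oplus> y \<otimes> z"
    and "\<And>x y z. x \<in> carrier A \<Longrightarrow> y \<in> carrier A \<Longrightarrow> z \<in> carrier A \<Longrightarrow> z \<otimes> (x \<oplus> y) = z \<otimes> x \<oplus> z \<otimes> y"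
    and "\<And>c x y. x \<in> carrier A \<Longrightarrow> y \<in> carrier A \<Longrightarrow> (c \<odot> x) \<otimes> y = c \<odot> (x \<otimes> y)"
    and "\<And>c x y. x \<in> carrier A \<Longrightarrow> y \<in> carrier A \<Longrightarrow> x \<otimes> (c \<odot> y) = c \<odot> (x \<otimes> y)"
  shows "complex_algebra A"
proof -
  interpret cvs A by fact
  show ?thesis
    by (intro complex_algebra.intro complex_algebra_axioms.intro ringI monoidI)
       (use assms in \<open>auto intro: module_axioms M.abelian_group_axioms\<close>)
qed

lemma linear_mapsI:
  assumes "\<And>x. x \<in> carrier A \<Longrightarrow> f x \<in> carrier B"
    and "\<And>x y. x \<in> carrier A \<Longrightarrow> y \<in> carrier A \<Longrightarrow> f (x \<oplus>\<^bsub>A\<^esub> y) = f x \<oplus>\<^bsub>B\<^esub> f y"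
    and "\<And>c x. x \<in> carrier A \<Longrightarrow> f (c \<odot>\<^bsub>A\<^esub> x) = c \<odot>\<^bsub>B\<^esub> f x"
  shows "f \<in> linear_maps A B"
  using assms by (auto simp: linear_maps_def)

lemma linear_maps_closed: "f \<in> linear_maps A B \<Longrightarrow> x \<in> carrier A \<Longrightarrow> f x \<in> carrier B"
  by (auto simp: linear_maps_def)
lemma linear_maps_add:
  "f \<in> linear_maps A B \<Longrightarrow> x \<in> carrier A \<Longrightarrow> y \<in> carrier A \<Longrightarrow> f (x \<oplus>\<^bsub>A\<^esub> y) = f x \<oplus>\<^bsub>B\<^esub> f y"
  by (auto simp: linear_maps_def)
lemma linear_maps_smult: "f \<in> linear_maps A B \<Longrightarrow> x \<in> carrier A \<Longrightarrow> f (c \<odot>\<^bsub>A\<^esub> x) = c \<odot>\<^bsub>B\<^esub> f x"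
  by (auto simp: linear_maps_def)

lemma linear_maps_zero:
  assumes "f \<in> linear_maps A B" "cvs A" "cvs B"
  shows "f \<zero>\<^bsub>A\<^esub> = \<zero>\<^bsub>B\<^esub>"
proof -
  interpret A: cvs A by fact
  interpret B: cvs B by fact
  have "f (0 \<odot>\<^bsub>A\<^esub> \<zero>\<^bsub>A\<^esub>) = 0 \<odot>\<^bsub>B\<^esub> f \<zero>\<^bsub>A\<^esub>"
    by (rule linear_maps_smult[OF assms(1)]) simp
  then show ?thesis using linear_maps_closed[OF assms(1), of "\<zero>\<^bsub>A\<^esub>"] by simp
qed

lemma linear_maps_comp:
  "f \<in> linear_maps A B \<Longrightarrow> g \<in> linear_maps B C \<Longrightarrow> (\<lambda>x. g (f x)) \<in> linear_maps A C"
  by (intro linear_mapsI) (simp_all add: linear_maps_closed linear_maps_add linear_maps_smult)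

lemma linear_maps_id: "(\<lambda>x. x) \<in> linear_maps A A"
  by (auto simp: linear_maps_def)

lemma linear_maps_finsum:
  assumes f: "f \<in> linear_maps A B" and A: "cvs A" and B: "cvs B" and g: "g \<in> K \<rightarrow> carrier A"
  shows "f (\<Oplus>\<^bsub>A\<^esub>k\<in>K. g k) = (\<Oplus>\<^bsub>B\<^esub>k\<in>K. f (g k))"
proof -
  interpret A: cvs A by fact
  interpret B: cvs B by fact
  note [simp] = linear_maps_zero[OF f A B]
  show ?thesis
    using g
  proof (induction K rule: infinite_finite_induct)
    case (insert k K)
    then show ?case
      using linear_maps_closed[OF f] by (simp add: linear_maps_add[OF f] Pi_def)
  qed simp_all
qed


text \<open>The linear map on formal linear combinations with values \<open>g k\<close> on the basis vectors. Both
  \<^const>\<open>free_eval\<close> and \<^const>\<open>tensor_lift\<close> are built from it.\<close>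

definition lin_ext :: "('b, 'n) star_alg_scheme \<Rightarrow> ('k \<Rightarrow> 'b) \<Rightarrow> ('k \<Rightarrow>\<^sub>0 complex) \<Rightarrow> 'b" where
  "lin_ext T g p = (\<Oplus>\<^bsub>T\<^esub>k\<in>keys p. lookup p k \<odot>\<^bsub>T\<^esub> g k)"

lemma lookup_pm_scale [simp]: "lookup (pm_scale c p) k = c * lookup p k"
  by (simp add: pm_scale_def map.rep_eq when_def)

lemma pm_scale_single [simp]: "pm_scale c (single k d) = single k (c * d)"
  by (rule poly_mapping_eqI) (simp add: lookup_single when_def)

lemma pm_scale_simps [simp]: "pm_scale 0 p = 0" "pm_scale 1 p = p" "pm_scale c 0 = 0"
    "pm_scale (- 1) p = - p" "pm_scale a (pm_scale b p) = pm_scale (a * b) p"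
  by (rule poly_mapping_eqI; simp)+

lemma pm_scale_add: "pm_scale c (p + r) = pm_scale c p + pm_scale c r"
    "pm_scale c (p - r) = pm_scale c p - pm_scale c r"
    "pm_scale (a + b) p = pm_scale a p + pm_scale b p"
  by (rule poly_mapping_eqI; simp add: lookup_add lookup_minus algebra_simps)+

lemma pm_scale_mult: "pm_scale c p * r = pm_scale c (p * r)"
  by (simp add: pm_scale_def mult_map_scale_conv_mult mult.assoc)

lemma keys_pm_scale: "keys (pm_scale c p) \<subseteq> keys p"
  by (auto simp: in_keys_iff)

lemma keys_diff_subset: "keys (p - r) \<subseteq> keys p \<union> keys (r :: 'k \<Rightarrow>\<^sub>0 complex)"
  by (auto simp: in_keys_iff lookup_minus)

lemma pm_sum_singles:
  "p = (\<Sum>k\<in>keys p. single k (lookup p k))"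
  by (rule poly_mapping_eqI) (simp add: lookup_sum lookup_single when_def in_keys_iff)

text \<open>Formal linear combinations are finite sums of multiples of basis vectors; every identity
  between linear or multilinear maps below is reduced in this way to basis vectors.\<close>

lemma pm_induct_on [consumes 1, case_names zero single add]:
  fixes p :: "'k \<Rightarrow>\<^sub>0 complex"
  assumes "keys p \<subseteq> S" and "P 0"
    and "\<And>k c. k \<in> S \<Longrightarrow> P (single k c)"
    and "\<And>p r. keys p \<subseteq> S \<Longrightarrow> keys r \<subseteq> S \<Longrightarrow> P p \<Longrightarrow> P r \<Longrightarrow> P (p + r)"
  shows "P p"
proof -
  have "K \<subseteq> S \<Longrightarrow> P (\<Sum>k\<in>K. single k (lookup p k)) \<and>
      keys (\<Sum>k\<in>K. single k (lookup p k)) \<subseteq> S" if "finite K" for K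
    using that
  proof (induction K rule: finite_induct)
    case (insert k K)
    let ?a = "single k (lookup p k)"
    let ?r = "\<Sum>k\<in>K. single k (lookup p k)"
    have a: "keys ?a \<subseteq> S" "P ?a"
      using insert.prems assms(3)[of k] by (auto split: if_splits)
    have r: "keys ?r \<subseteq> S" "P ?r"
      using insert by auto
    have "keys (?a + ?r) \<subseteq> S"
      using a r keys_add[of ?a ?r] by blast
    with assms(4)[OF a(1) r(1) a(2) r(2)] insert.hyps show ?case by simp
  qed (use assms in auto)
  from this[OF finite_keys assms(1)] show ?thesis by (simp flip: pm_sum_singles)
qed

context cvs
begin

lemma lin_ext_superset:
  assumes "finite K" "keys p \<subseteq> K" "g \<in> K \<rightarrow> carrier V"
  shows "lin_ext V g p = (\<Oplus>k\<in>K. lookup p k \<odot> g k)"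
  unfolding lin_ext_def
proof (rule M.add.finprod_mono_neutral_cong_left[OF assms(1,2)])
  show "\<And>i. i \<in> K - keys p \<Longrightarrow> lookup p i \<odot> g i = \<zero>"
    using assms(3) by (auto simp: in_keys_iff Pi_def)
qed (use assms(3) in auto)

lemma lin_ext_closed: "g \<in> keys p \<rightarrow> carrier V \<Longrightarrow> lin_ext V g p \<in> carrier V"
  unfolding lin_ext_def by (rule M.finsum_closed) auto

lemma lin_ext_zero [simp]: "lin_ext V g 0 = \<zero>"
  by (simp add: lin_ext_def)

lemma lin_ext_single: "g k \<in> carrier V \<Longrightarrow> lin_ext V g (single k c) = c \<odot> g k"
  by (subst lin_ext_superset[of "{k}"]) auto

lemma lin_ext_add:
  assumes "g \<in> S \<rightarrow> carrier V" "keys p \<subseteq> S" "keys r \<subseteq> S"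
  shows "lin_ext V g (p + r) = lin_ext V g p \<oplus> lin_ext V g r"
proof -
  define K where "K = keys p \<union> keys r"
  have K: "finite K" "keys p \<subseteq> K" "keys r \<subseteq> K" "keys (p + r) \<subseteq> K"
    and g: "g \<in> K \<rightarrow> carrier V"
    using assms keys_add[of p r] by (auto simp: K_def)
  show ?thesis
    unfolding lin_ext_superset[OF K(1,2) g] lin_ext_superset[OF K(1,3) g] lin_ext_superset[OF K(1,4) g]
    using g by (intro trans[OF M.finsum_cong' M.finsum_addf]) (auto simp: lookup_add sm_add_l Pi_def)
qed

lemma lin_ext_scale:
  assumes "g \<in> keys p \<rightarrow> carrier V"
  shows "lin_ext V g (pm_scale c p) = c \<odot> lin_ext V g p"
proof -
  have "(\<lambda>x. c \<odot> x) \<in> linear_maps V V"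
    by (rule linear_mapsI) (auto simp: sm_add_r sm_sm mult.commute)
  note L = linear_maps_finsum[OF this cvs_axioms cvs_axioms]
  show ?thesis
    unfolding lin_ext_superset[OF finite_keys keys_pm_scale assms]
    unfolding lin_ext_def using assms
    by (subst L) (auto intro!: M.finsum_cong' simp: sm_sm Pi_def)
qed

lemma lin_ext_cong:
  assumes "\<And>k. k \<in> keys p \<Longrightarrow> g k = h k" "h \<in> keys p \<rightarrow> carrier V"
  shows "lin_ext V g p = lin_ext V h p"
  unfolding lin_ext_def using assms by (intro M.finsum_cong') auto

lemma lin_ext_fun_add:
  assumes "g \<in> keys p \<rightarrow> carrier V" "h \<in> keys p \<rightarrow> carrier V"
  shows "lin_ext V (\<lambda>k. g k \<oplus> h k) p = lin_ext V g p \<oplus> lin_ext V h p"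
  unfolding lin_ext_def using assms
  by (intro trans[OF M.finsum_cong' M.finsum_addf]) (auto simp: sm_add_r Pi_def)

lemma lin_ext_fun_smult:
  assumes "g \<in> keys p \<rightarrow> carrier V"
  shows "lin_ext V (\<lambda>k. c \<odot> g k) p = c \<odot> lin_ext V g p"
proof -
  have "(\<lambda>x. c \<odot> x) \<in> linear_maps V V"
    by (rule linear_mapsI) (auto simp: sm_add_r sm_sm mult.commute)
  note L = linear_maps_finsum[OF this cvs_axioms cvs_axioms]
  show ?thesis
    unfolding lin_ext_def using assms
    by (subst L) (auto intro!: M.finsum_cong' simp: sm_sm Pi_def mult.commute)
qed

end

lemma linear_maps_lin_ext:
  assumes f: "f \<in> linear_maps A B" and A: "cvs A" and B: "cvs B"
    and g: "g \<in> keys p \<rightarrow> carrier A"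
  shows "f (lin_ext A g p) = lin_ext B (\<lambda>k. f (g k)) p"
proof -
  interpret A: cvs A by fact
  interpret B: cvs B by fact
  show ?thesis
    unfolding lin_ext_def using g linear_maps_closed[OF f]
    by (subst linear_maps_finsum[OF f A B])
       (auto intro!: B.M.finsum_cong' simp: Pi_def linear_maps_smult[OF f])
qed


section \<open>Quotients of spaces of formal linear combinations\<close>

text \<open>The free algebra and the algebra of pairs are both spaces of formal linear combinations of
  the elements of a set. Their operations are those of the ambient type, so cosets can be computed
  there.\<close>

locale pm_space =
  fixes F :: "('k \<Rightarrow>\<^sub>0 complex, 'm) star_alg_scheme" and S :: "'k set"
  assumes carrier_F: "carrier F = {p. keys p \<subseteq> S}"
    and add_F: "ring.add F = (+)" and zero_F: "ring.zero F = 0" and smult_F: "module.smult F = pm_scale"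
begin

lemma F_closed:
  "0 \<in> carrier F" "p \<in> carrier F \<Longrightarrow> r \<in> carrier F \<Longrightarrow> p + r \<in> carrier F"
  "p \<in> carrier F \<Longrightarrow> r \<in> carrier F \<Longrightarrow> p - r \<in> carrier F"
  "p \<in> carrier F \<Longrightarrow> pm_scale c p \<in> carrier F"
  "k \<in> S \<Longrightarrow> single k c \<in> carrier F"
  using keys_add[of p r] keys_diff_subset[of p r] keys_pm_scale[of c p]
  by (auto simp: carrier_F subset_iff split: if_splits)

lemma cvs_F: "cvs F"
  by (rule cvsI) (auto simp: add_F zero_F smult_F F_closed pm_scale_add algebra_simps)

lemma lin_ext_linear:
  assumes "cvs T" "\<And>k. k \<in> S \<Longrightarrow> g k \<in> carrier T"
  shows "lin_ext T g \<in> linear_maps F T"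
proof -
  interpret T: cvs T by fact
  have g: "g \<in> keys p \<rightarrow> carrier T" if "p \<in> carrier F" for p
    using that assms(2) by (auto simp: carrier_F)
  show ?thesis
    using assms(2) T.lin_ext_add[of g S] g
    by (intro linear_mapsI) (auto simp: T.lin_ext_closed T.lin_ext_scale add_F smult_F carrier_F)
qed

end

locale pm_subspace = pm_space F S
  for F :: "('k \<Rightarrow>\<^sub>0 complex, 'm) star_alg_scheme" and S +
  fixes J :: "('k \<Rightarrow>\<^sub>0 complex) set"
  assumes J_sub: "J \<subseteq> carrier F" and J_zero: "0 \<in> J"
    and J_add: "p \<in> J \<Longrightarrow> r \<in> J \<Longrightarrow> p + r \<in> J"
    and J_scale: "p \<in> J \<Longrightarrow> pm_scale c p \<in> J"
begin

abbreviation coset :: "('k \<Rightarrow>\<^sub>0 complex) \<Rightarrow> ('k \<Rightarrow>\<^sub>0 complex) set" where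
  "coset x \<equiv> J +>\<^bsub>F\<^esub> x"

lemma J_diff: "p \<in> J \<Longrightarrow> r \<in> J \<Longrightarrow> p - r \<in> J"
  using J_add[of p "- r"] J_scale[of r "- 1"] by simp

lemma coset_def': "coset x = {j + x | j. j \<in> J}"
  by (auto simp: a_r_coset_def r_coset_def add_F)

lemma coset_0: "coset 0 = J"
  by (auto simp: coset_def')

lemma coset_self: "x \<in> coset x"
  using J_zero by (auto simp: coset_def' intro!: exI[of _ 0])

lemma coset_mem: "y \<in> coset x \<longleftrightarrow> y - x \<in> J"
  by (auto simp: coset_def' intro!: exI[of _ "y - x"])

lemma coset_eq: "coset x = coset y \<longleftrightarrow> x - y \<in> J"
proof
  assume "coset x = coset y"
  then show "x - y \<in> J" using coset_self[of x] by (simp add: coset_mem)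
next
  assume xy: "x - y \<in> J"
  have "z - x \<in> J \<longleftrightarrow> z - y \<in> J" for z
    using J_add[of "z - x" "x - y"] J_diff[of "z - y" "x - y"] xy by auto
  then show "coset x = coset y" by (auto simp: coset_mem)
qed

lemma carrier_quot: "carrier (quot_alg F J) = coset ` carrier F"
  by (auto simp: quot_alg_def FactRing_def A_RCOSETS_def RCOSETS_def a_r_coset_def)

lemma coset_in [simp]: "x \<in> carrier F \<Longrightarrow> coset x \<in> carrier (quot_alg F J)"
  by (auto simp: carrier_quot)

lemma coset_cases:
  assumes "W \<in> carrier (quot_alg F J)"
  obtains x where "x \<in> carrier F" "W = coset x"
  using assms by (auto simp: carrier_quot)

lemma quot_zero: "\<zero>\<^bsub>quot_alg F J\<^esub> = J"
  by (simp add: quot_alg_def FactRing_def)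

lemma quot_add: "coset x \<oplus>\<^bsub>quot_alg F J\<^esub> coset y = coset (x + y)"
proof -
  have "coset x \<oplus>\<^bsub>quot_alg F J\<^esub> coset y = {a + b | a b. a \<in> coset x \<and> b \<in> coset y}"
    by (auto simp: quot_alg_def FactRing_def set_add_def set_mult_def add_F)
  also have "\<dots> = coset (x + y)"
  proof (intro equalityI subsetI)
    fix z assume "z \<in> coset (x + y)"
    then have "z - y \<in> coset x" by (simp add: coset_mem algebra_simps)
    then show "z \<in> {a + b | a b. a \<in> coset x \<and> b \<in> coset y}"
      using coset_self[of y] by force
  next
    fix z assume "z \<in> {a + b | a b. a \<in> coset x \<and> b \<in> coset y}"
    then obtain a b where "z = a + b" "a - x \<in> J" "b - y \<in> J" by (auto simp: coset_mem)
    with J_add[of "a - x" "b - y"] show "z \<in> coset (x + y)" by (simp add: coset_mem algebra_simps)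
  qed
  finally show ?thesis .
qed

lemma quot_smult: "c \<odot>\<^bsub>quot_alg F J\<^esub> coset x = coset (pm_scale c x)"
proof -
  have "coset (pm_scale c y) = coset (pm_scale c x)" if "y \<in> coset x" for y
    using that J_scale[of "y - x" c] by (simp add: coset_eq coset_mem pm_scale_add)
  then have "(\<Union>y\<in>coset x. coset (pm_scale c y)) = coset (pm_scale c x)"
    using coset_self[of x] by blast
  then show ?thesis by (simp add: quot_alg_def smult_F)
qed

lemma cvs_quot: "cvs (quot_alg F J)"
proof (rule cvsI)
  show "\<zero>\<^bsub>quot_alg F J\<^esub> \<in> carrier (quot_alg F J)"
    using coset_in[OF F_closed(1)] by (simp add: quot_zero coset_0)
  have z: "\<zero>\<^bsub>quot_alg F J\<^esub> = coset 0" by (simp add: quot_zero coset_0)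
  show "\<zero>\<^bsub>quot_alg F J\<^esub> \<oplus>\<^bsub>quot_alg F J\<^esub> W = W" if "W \<in> carrier (quot_alg F J)" for W
    using that by (auto simp: z quot_add elim!: coset_cases)
  show "(- 1) \<odot>\<^bsub>quot_alg F J\<^esub> W \<oplus>\<^bsub>quot_alg F J\<^esub> W = \<zero>\<^bsub>quot_alg F J\<^esub>"
    if "W \<in> carrier (quot_alg F J)" for W
    using that by (auto simp: z quot_add quot_smult elim!: coset_cases)
qed (auto elim!: coset_cases simp: quot_add quot_smult F_closed pm_scale_add add_ac)

text \<open>A linear map that vanishes on the subspace is constant on each coset. This is what makes
  \<^const>\<open>presented_map\<close> and \<^const>\<open>tensor_lift\<close>, which are defined by \<^const>\<open>the_elem\<close>, meaningful.\<close>

lemma the_elem_coset: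
  assumes "h \<in> linear_maps F T" "cvs T" "\<And>j. j \<in> J \<Longrightarrow> h j = \<zero>\<^bsub>T\<^esub>" "x \<in> carrier F"
  shows "the_elem (h ` coset x) = h x"
proof -
  interpret T: cvs T by fact
  have "h (j + x) = h x" if "j \<in> J" for j
    using linear_maps_add[OF assms(1), of j x] that assms J_sub linear_maps_closed[OF assms(1), of x]
    by (auto simp: add_F subset_iff)
  then have "h ` coset x = {h x}"
    using coset_self[of x] by (auto simp: coset_def')
  then show ?thesis by simp
qed

lemma quot_lift_linear:
  assumes "h \<in> linear_maps F T" "cvs T" "\<And>j. j \<in> J \<Longrightarrow> h j = \<zero>\<^bsub>T\<^esub>"
  shows "(\<lambda>W. the_elem (h ` W)) \<in> linear_maps (quot_alg F J) T"
  by (intro linear_mapsI)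
     (auto elim!: coset_cases simp: the_elem_coset[OF assms] quot_add quot_smult F_closed
       linear_maps_closed[OF assms(1)] linear_maps_add[OF assms(1), unfolded add_F]
       linear_maps_smult[OF assms(1), unfolded smult_F])

end

locale pm_ideal = pm_subspace F S J
  for F :: "('k \<Rightarrow>\<^sub>0 complex, 'm) star_alg_scheme" and S J +
  assumes F_alg: "complex_algebra F"
    and J_left: "p \<in> carrier F \<Longrightarrow> j \<in> J \<Longrightarrow> p \<otimes>\<^bsub>F\<^esub> j \<in> J"
    and J_right: "p \<in> carrier F \<Longrightarrow> j \<in> J \<Longrightarrow> j \<otimes>\<^bsub>F\<^esub> p \<in> J"
begin

interpretation F: complex_algebra F by (rule F_alg)

lemma quot_mult:
  assumes "x \<in> carrier F" "y \<in> carrier F"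
  shows "coset x \<otimes>\<^bsub>quot_alg F J\<^esub> coset y = coset (x \<otimes>\<^bsub>F\<^esub> y)"
proof -
  have "coset (a \<otimes>\<^bsub>F\<^esub> b) = coset (x \<otimes>\<^bsub>F\<^esub> y)" if "a \<in> coset x" "b \<in> coset y" for a b
  proof -
    obtain i j where ij: "i \<in> J" "j \<in> J" "a = i + x" "b = j + y"
      using \<open>a \<in> coset x\<close> \<open>b \<in> coset y\<close> by (auto simp: coset_def')
    then have c: "i \<in> carrier F" "j \<in> carrier F" using J_sub by auto
    have "a \<otimes>\<^bsub>F\<^esub> b = i \<otimes>\<^bsub>F\<^esub> (j + y) + x \<otimes>\<^bsub>F\<^esub> j + x \<otimes>\<^bsub>F\<^esub> y"
      using assms c F_closed(2)[of j y] F.l_distr[of i x "j + y"] F.r_distr[of j y x]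
      by (simp add: ij add_F add_ac)
    then have "a \<otimes>\<^bsub>F\<^esub> b - x \<otimes>\<^bsub>F\<^esub> y = i \<otimes>\<^bsub>F\<^esub> (j + y) + x \<otimes>\<^bsub>F\<^esub> j" by simp
    also have "\<dots> \<in> J"
      using assms ij c by (intro J_add J_left J_right F_closed)
    finally show ?thesis by (simp add: coset_eq)
  qed
  then have "(\<Union>a\<in>coset x. \<Union>b\<in>coset y. coset (a \<otimes>\<^bsub>F\<^esub> b)) = coset (x \<otimes>\<^bsub>F\<^esub> y)"
    using coset_self[of x] coset_self[of y] by blast
  then show ?thesis by (simp add: quot_alg_def FactRing_def rcoset_mult_def)
qed

lemma quot_one: "\<one>\<^bsub>quot_alg F J\<^esub> = coset \<one>\<^bsub>F\<^esub>"
  by (simp add: quot_alg_def FactRing_def)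

lemma complex_algebra_quot: "complex_algebra (quot_alg F J)"
  by (rule complex_algebraI[OF cvs_quot])
     (auto elim!: coset_cases simp: quot_mult quot_one quot_add quot_smult F_closed
       F.m_assoc F.l_distr[unfolded add_F] F.r_distr[unfolded add_F]
       F.smult_mult_left[unfolded smult_F] F.smult_mult_right[unfolded smult_F])

end

locale pm_star_ideal = pm_ideal F S J
  for F :: "('k \<Rightarrow>\<^sub>0 complex, 'm) star_alg_scheme" and S J +
  assumes F_star: "star_algebra F"
    and J_star: "j \<in> J \<Longrightarrow> star F j \<in> J"
begin

interpretation F: star_algebra F by (rule F_star)

lemma quot_star:
  assumes "x \<in> carrier F"
  shows "star (quot_alg F J) (coset x) = coset (star F x)"
proof -
  have "coset (star F y) = coset (star F x)" if "y \<in> coset x" for y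
  proof -
    obtain j where j: "j \<in> J" "y = j + x" using \<open>y \<in> coset x\<close> by (auto simp: coset_def')
    then have "star F y = star F j + star F x"
      using F.star_add[of j x] assms J_sub by (auto simp: add_F)
    with J_star[OF j(1)] show ?thesis by (simp add: coset_eq)
  qed
  then have "(\<Union>y\<in>coset x. coset (star F y)) = coset (star F x)"
    using coset_self[of x] by blast
  then show ?thesis by (simp add: quot_alg_def)
qed

lemma star_algebra_quot: "star_algebra (quot_alg F J)"
  by (intro star_algebra.intro complex_algebra_quot star_algebra_axioms.intro)
     (auto elim!: coset_cases simp: quot_star quot_mult quot_add quot_smult F_closed
       F.star_closed F.star_star F.star_mult F.star_add[unfolded add_F] F.star_smult[unfolded smult_F])

end


section \<open>Tensor products\<close>

lemma module_pm: "Modules.module (pm_scale :: complex \<Rightarrow> ('k \<Rightarrow>\<^sub>0 complex) \<Rightarrow> _)"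
  by unfold_locales (simp_all add: pm_scale_add)

interpretation pm: Modules.module "pm_scale :: complex \<Rightarrow> ('k \<Rightarrow>\<^sub>0 complex) \<Rightarrow> _"
  by (rule module_pm)

lemma (in pm_space) pm_subspace_span:
  assumes "R \<subseteq> carrier F"
  shows "pm_subspace F S (pm_span R)"
proof
  have "pm.subspace (carrier F)"
    by (rule pm.subspaceI) (auto simp: F_closed)
  then show "pm_span R \<subseteq> carrier F" by (rule pm.span_minimal[OF assms])
qed (auto intro: pm.span_zero pm.span_add pm.span_scale)

lemma (in pm_space) linear_vanish_span:
  assumes "h \<in> linear_maps F T" "cvs T" "R \<subseteq> carrier F" "\<And>r. r \<in> R \<Longrightarrow> h r = \<zero>\<^bsub>T\<^esub>"
  shows "j \<in> pm_span R \<Longrightarrow> h j = \<zero>\<^bsub>T\<^esub>"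
proof -
  interpret T: cvs T by fact
  have "pm.subspace {p \<in> carrier F. h p = \<zero>\<^bsub>T\<^esub>}"
    using linear_maps_zero[OF assms(1) cvs_F assms(2)]
    by (intro pm.subspaceI)
       (auto simp: F_closed zero_F linear_maps_add[OF assms(1), unfolded add_F]
         linear_maps_smult[OF assms(1), unfolded smult_F])
  from pm.span_minimal[OF _ this, of R] assms(3,4) show "j \<in> pm_span R \<Longrightarrow> h j = \<zero>\<^bsub>T\<^esub>" by auto
qed

text \<open>The stars of the free algebra, of \<^const>\<open>pair_alg\<close> and of the Laurent polynomials are all of this form.\<close>

definition pm_conj :: "('k \<Rightarrow> 'l) \<Rightarrow> ('k \<Rightarrow>\<^sub>0 complex) \<Rightarrow> ('l \<Rightarrow>\<^sub>0 complex)" where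
  "pm_conj \<theta> p = (\<Sum>k\<in>keys p. single (\<theta> k) (cnj (lookup p k)))"

lemma keys_pm_scale_eq: "c \<noteq> 0 \<Longrightarrow> keys (pm_scale c p) = keys p"
  by (auto simp: in_keys_iff)

lemma pm_scale_sum: "pm_scale c (\<Sum>k\<in>K. f k) = (\<Sum>k\<in>K. pm_scale c (f k))"
  by (induction K rule: infinite_finite_induct) (simp_all add: pm_scale_add)

lemma pm_conj_simps [simp]:
  "pm_conj \<theta> 0 = 0"
  "pm_conj \<theta> (single k c) = single (\<theta> k) (cnj c)"
  by (simp_all add: pm_conj_def)

lemma pm_conj_add: "pm_conj \<theta> (p + r) = pm_conj \<theta> p + pm_conj \<theta> r"
  unfolding pm_conj_def by (rule setsum_keys_plus_distrib) (simp_all add: single_add)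

lemma pm_conj_scale: "pm_conj \<theta> (pm_scale c p) = pm_scale (cnj c) (pm_conj \<theta> p)"
  by (cases "c = 0") (simp_all add: pm_conj_def keys_pm_scale_eq pm_scale_sum)

lemma pm_conj_diff: "pm_conj \<theta> (p - r) = pm_conj \<theta> p - pm_conj \<theta> r"
  using pm_conj_add[of \<theta> p "- r"] pm_conj_scale[of \<theta> "- 1" r] by simp

lemma pm_conj_keys: "keys (pm_conj \<theta> p) \<subseteq> \<theta> ` keys p"
  unfolding pm_conj_def by (rule order_trans[OF keys_sum]) (auto split: if_splits)

lemma pm_conj_conj:
  assumes "keys p \<subseteq> S" "\<And>k. k \<in> S \<Longrightarrow> \<theta> (\<theta> k) = k"
  shows "pm_conj \<theta> (pm_conj \<theta> p) = p"
  using assms(1) by (induction rule: pm_induct_on) (simp_all add: pm_conj_add assms(2))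


subsection \<open>The algebra spanned by pairs\<close>

definition bilinear ::
    "('a, 'm) star_alg_scheme \<Rightarrow> ('b, 'n) star_alg_scheme \<Rightarrow> ('c, 'k) star_alg_scheme
      \<Rightarrow> ('a \<Rightarrow> 'b \<Rightarrow> 'c) \<Rightarrow> bool" where
  "bilinear A B T f \<longleftrightarrow> (\<forall>b\<in>carrier B. (\<lambda>a. f a b) \<in> linear_maps A T) \<and>
     (\<forall>a\<in>carrier A. f a \<in> linear_maps B T)"

lemma bilinearI:
  assumes "\<And>b. b \<in> carrier B \<Longrightarrow> (\<lambda>a. f a b) \<in> linear_maps A T"
    and "\<And>a. a \<in> carrier A \<Longrightarrow> (\<lambda>b. f a b) \<in> linear_maps B T"
  shows "bilinear A B T f"
  using assms by (auto simp: bilinear_def)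

locale alg_pair = A: complex_algebra A + B: complex_algebra B
  for A :: "('a, 'm) star_alg_scheme" and B :: "('b, 'n) star_alg_scheme"
begin

abbreviation "P \<equiv> pair_alg A B"
abbreviation "S \<equiv> carrier A \<times> carrier B"

text \<open>The product of \<^const>\<open>pair_alg\<close>, in a form that shows its bilinearity.\<close>

definition pmul :: "('a \<times> 'b \<Rightarrow>\<^sub>0 complex) \<Rightarrow> ('a \<times> 'b \<Rightarrow>\<^sub>0 complex) \<Rightarrow> ('a \<times> 'b \<Rightarrow>\<^sub>0 complex)" where
  "pmul p r = (\<Sum>k\<in>keys p. \<Sum>k'\<in>keys r.
       single (fst k \<otimes>\<^bsub>A\<^esub> fst k', snd k \<otimes>\<^bsub>B\<^esub> snd k')
         (lookup p k * lookup r k'))"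

lemma P_simps [simp]:
  "carrier P = {p. keys p \<subseteq> S}" "monoid.mult P = pmul"
  "\<one>\<^bsub>P\<^esub> = single (\<one>\<^bsub>A\<^esub>, \<one>\<^bsub>B\<^esub>) 1" "\<zero>\<^bsub>P\<^esub> = 0" "ring.add P = (+)" "module.smult P = pm_scale"
  "star P = pm_conj (map_prod (star A) (star B))"
  by (simp_all add: pair_alg_def fun_eq_iff pmul_def pm_conj_def case_prod_unfold map_prod_def)

lemma pmul_simps [simp]:
  "pmul 0 r = 0" "pmul p 0 = 0"
  "pmul (single k c) (single k' d) =
    single (fst k \<otimes>\<^bsub>A\<^esub> fst k', snd k \<otimes>\<^bsub>B\<^esub> snd k') (c * d)"
  by (simp_all add: pmul_def)

lemma pmul_add_left: "pmul (p + p') r = pmul p r + pmul p' r"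
  unfolding pmul_def
  by (rule setsum_keys_plus_distrib) (simp_all add: distrib_right single_add sum.distrib)

lemma pmul_swap: "pmul p r = (\<Sum>k'\<in>keys r. \<Sum>k\<in>keys p.
       single (fst k \<otimes>\<^bsub>A\<^esub> fst k', snd k \<otimes>\<^bsub>B\<^esub> snd k')
         (lookup p k * lookup r k'))"
  unfolding pmul_def by (rule sum.swap)

lemma pmul_add_right: "pmul p (r + r') = pmul p r + pmul p r'"
  unfolding pmul_swap
  by (rule setsum_keys_plus_distrib) (simp_all add: distrib_left single_add sum.distrib)

lemma pmul_scale_left: "pmul (pm_scale c p) r = pm_scale c (pmul p r)"
  by (cases "c = 0") (simp_all add: pmul_def keys_pm_scale_eq pm_scale_sum mult.assoc)

lemma pmul_scale_right: "pmul p (pm_scale c r) = pm_scale c (pmul p r)"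
  by (cases "c = 0") (simp_all add: pmul_def keys_pm_scale_eq pm_scale_sum mult.left_commute)

lemma pmul_diff: "pmul (p - p') r = pmul p r - pmul p' r" "pmul p (r - r') = pmul p r - pmul p r'"
  using pmul_add_left[of p "- p'" r] pmul_add_right[of p r "- r'"]
    pmul_scale_left[of "- 1" p' r] pmul_scale_right[of p "- 1" r']
  by simp_all

lemma pmul_closed:
  assumes "p \<in> carrier P" "r \<in> carrier P"
  shows "pmul p r \<in> carrier P"
proof -
  have "keys (pmul p r) \<subseteq> S"
    unfolding pmul_def using assms
    by (intro order_trans[OF keys_sum] UN_least) (fastforce split: if_splits)
  then show ?thesis by simp
qed

lemma pmul_assoc:
  assumes "p \<in> carrier P" "r \<in> carrier P" "s \<in> carrier P"
  shows "pmul (pmul p r) s = pmul p (pmul r s)"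
proof -
  have "keys p \<subseteq> S" "keys r \<subseteq> S" "keys s \<subseteq> S"
    using assms by auto
  then show ?thesis
  proof (induction p rule: pm_induct_on)
    case (single k c)
    show ?case using single(2)
    proof (induction r rule: pm_induct_on)
      case (single k' d)
      show ?case using \<open>keys s \<subseteq> S\<close> \<open>k \<in> S\<close> \<open>k' \<in> S\<close>
      proof (induction s rule: pm_induct_on)
        case (single k'' e)
        then show ?case by (auto simp: A.m_assoc B.m_assoc mult.assoc)
      qed (simp_all add: pmul_add_right)
    qed (simp_all add: pmul_add_left pmul_add_right)
  qed (simp_all add: pmul_add_left)
qed

lemma pmul_one:
  assumes "p \<in> carrier P"
  shows "pmul (single (\<one>\<^bsub>A\<^esub>, \<one>\<^bsub>B\<^esub>) 1) p = p" "pmul p (single (\<one>\<^bsub>A\<^esub>, \<one>\<^bsub>B\<^esub>) 1) = p"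
proof -
  have "keys p \<subseteq> S" using assms by simp
  then show "pmul (single (\<one>\<^bsub>A\<^esub>, \<one>\<^bsub>B\<^esub>) 1) p = p"
    by (induction rule: pm_induct_on) (auto simp: pmul_add_right)
  show "pmul p (single (\<one>\<^bsub>A\<^esub>, \<one>\<^bsub>B\<^esub>) 1) = p"
    using \<open>keys p \<subseteq> S\<close>
    by (induction rule: pm_induct_on) (auto simp: pmul_add_left)
qed

sublocale P: pm_space P S
  by standard simp_all

lemma complex_algebra_P: "complex_algebra P"
proof (rule complex_algebraI[OF P.cvs_F])
  show "\<And>x y z. x \<in> carrier P \<Longrightarrow> y \<in> carrier P \<Longrightarrow> z \<in> carrier P \<Longrightarrow>
      x \<otimes>\<^bsub>P\<^esub> y \<otimes>\<^bsub>P\<^esub> z = x \<otimes>\<^bsub>P\<^esub> (y \<otimes>\<^bsub>P\<^esub> z)"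
    unfolding P_simps(2) by (rule pmul_assoc)
  show "\<And>x y. x \<in> carrier P \<Longrightarrow> y \<in> carrier P \<Longrightarrow> x \<otimes>\<^bsub>P\<^esub> y \<in> carrier P"
    unfolding P_simps(2) by (rule pmul_closed)
qed (auto simp: pmul_one pmul_add_left pmul_add_right pmul_scale_left pmul_scale_right)

lemma bilinear_rels_sub: "bilinear_rels A B \<subseteq> carrier P"
proof -
  have s: "k \<in> S \<Longrightarrow> single k c \<in> carrier P" for k c
    by (rule P.F_closed)
  show ?thesis
    by (auto simp: bilinear_rels_def simp del: P_simps(1) mem_Sigma_iff
        intro!: P.F_closed(3) s SigmaI)
qed

abbreviation "J \<equiv> pm_span (bilinear_rels A B)"

sublocale T: pm_subspace P S J
  by (rule P.pm_subspace_span[OF bilinear_rels_sub])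

lemma rel_add_l:
  "a \<in> carrier A \<Longrightarrow> a' \<in> carrier A \<Longrightarrow> b \<in> carrier B \<Longrightarrow>
    single (a \<oplus>\<^bsub>A\<^esub> a', b) 1 - single (a, b) 1 - single (a', b) 1 \<in> bilinear_rels A B"
  unfolding bilinear_rels_def
  by (rule UnI1, rule UnI1, rule UnI1, rule CollectI, intro exI conjI, rule refl)

lemma rel_add_r:
  "a \<in> carrier A \<Longrightarrow> b \<in> carrier B \<Longrightarrow> b' \<in> carrier B \<Longrightarrow>
    single (a, b \<oplus>\<^bsub>B\<^esub> b') 1 - single (a, b) 1 - single (a, b') 1 \<in> bilinear_rels A B"
  unfolding bilinear_rels_def
  by (rule UnI1, rule UnI1, rule UnI2, rule CollectI, intro exI conjI, rule refl)

lemma rel_sm_l: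
  "a \<in> carrier A \<Longrightarrow> b \<in> carrier B \<Longrightarrow>
    single (c \<odot>\<^bsub>A\<^esub> a, b) 1 - single (a, b) c \<in> bilinear_rels A B"
  unfolding bilinear_rels_def
  by (rule UnI1, rule UnI2, rule CollectI, intro exI conjI, rule refl)

lemma rel_sm_r:
  "a \<in> carrier A \<Longrightarrow> b \<in> carrier B \<Longrightarrow>
    single (a, c \<odot>\<^bsub>B\<^esub> b) 1 - single (a, b) c \<in> bilinear_rels A B"
  unfolding bilinear_rels_def
  by (rule UnI2, rule CollectI, intro exI conjI, rule refl)

lemma rels_cases [consumes 1, case_names add_l add_r sm_l sm_r]:
  assumes "r \<in> bilinear_rels A B"
  obtains a a' b where
      "r = single (a \<oplus>\<^bsub>A\<^esub> a', b) 1 - single (a, b) 1 - single (a', b) 1"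
      "a \<in> carrier A" "a' \<in> carrier A" "b \<in> carrier B"
    | a b b' where
      "r = single (a, b \<oplus>\<^bsub>B\<^esub> b') 1 - single (a, b) 1 - single (a, b') 1"
      "a \<in> carrier A" "b \<in> carrier B" "b' \<in> carrier B"
    | c a b where "r = single (c \<odot>\<^bsub>A\<^esub> a, b) 1 - single (a, b) c"
      "a \<in> carrier A" "b \<in> carrier B"
    | c a b where "r = single (a, c \<odot>\<^bsub>B\<^esub> b) 1 - single (a, b) c"
      "a \<in> carrier A" "b \<in> carrier B"
proof -
  from assms show thesis
    unfolding bilinear_rels_def
    by (elim UnE CollectE exE conjE) (erule that(1) that(2) that(3) that(4); assumption)+
qed

lemma scale_unit: "single k c = pm_scale c (single k 1)"
  by simp

text \<open>The product of a pair with a bilinearity relation is again such a relation, by the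
  distributive laws in the two factors. Hence the relations span a two-sided ideal.\<close>

lemma rel_mult:
  assumes "r \<in> bilinear_rels A B" "a0 \<in> carrier A" "b0 \<in> carrier B"
  shows "pmul (single (a0, b0) 1) r \<in> bilinear_rels A B"
    "pmul r (single (a0, b0) 1) \<in> bilinear_rels A B"
proof -
  have "pmul (single (a0, b0) 1) r \<in> bilinear_rels A B \<and>
    pmul r (single (a0, b0) 1) \<in> bilinear_rels A B"
    using assms(1)
  proof (cases rule: rels_cases)
    case (add_l a a' b)
    then show ?thesis using assms rel_add_l
      by (auto simp: pmul_diff A.r_distr A.l_distr)
  next
    case (add_r a b b')
    then show ?thesis using assms rel_add_r
      by (auto simp: pmul_diff B.r_distr B.l_distr)
  next
    case (sm_l c a b)
    then show ?thesis using assms rel_sm_l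
      by (auto simp: pmul_diff A.smult_mult_left A.smult_mult_right)
  next
    case (sm_r c a b)
    then show ?thesis using assms rel_sm_r
      by (auto simp: pmul_diff B.smult_mult_left B.smult_mult_right)
  qed
  then show "pmul (single (a0, b0) 1) r \<in> bilinear_rels A B"
    "pmul r (single (a0, b0) 1) \<in> bilinear_rels A B" by auto
qed

lemma J_ideal:
  assumes "p \<in> carrier P" "j \<in> J"
  shows "pmul p j \<in> J" "pmul j p \<in> J"
proof -
  have keys: "keys p \<subseteq> S" using assms by simp
  have "pmul p j \<in> J \<and> pmul j p \<in> J"
    using keys assms(2)
  proof (induction p rule: pm_induct_on)
    case (single k c)
    have "pm.subspace {j. pmul (single k 1) j \<in> J \<and> pmul j (single k 1) \<in> J}"
      by (intro pm.subspaceI)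
         (auto simp: pmul_add_left pmul_add_right pmul_scale_left pmul_scale_right pm.span_zero
           intro: pm.span_add pm.span_scale)
    moreover have "bilinear_rels A B \<subseteq> {j. pmul (single k 1) j \<in> J \<and> pmul j (single k 1) \<in> J}"
      using single(1) rel_mult by (cases k) (auto intro: pm.span_base)
    ultimately have "J \<subseteq> {j. pmul (single k 1) j \<in> J \<and> pmul j (single k 1) \<in> J}"
      by (intro pm.span_minimal)
    then show ?case
      using single(2) unfolding scale_unit[of k c] pmul_scale_left pmul_scale_right
      by (auto intro: pm.span_scale)
  qed (auto simp: pmul_add_left pmul_add_right pm.span_zero intro: pm.span_add)
  then show "pmul p j \<in> J" "pmul j p \<in> J" by auto
qed

sublocale T: pm_ideal P S J
proof (intro pm_ideal.intro pm_ideal_axioms.intro T.pm_subspace_axioms complex_algebra_P)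
  show "p \<otimes>\<^bsub>P\<^esub> j \<in> J" "j \<otimes>\<^bsub>P\<^esub> p \<in> J" if "p \<in> carrier P" "j \<in> J" for p j
    using J_ideal[OF that] by simp_all
qed

lemma complex_algebra_tensor: "complex_algebra (tensor A B)"
  using T.complex_algebra_quot by (simp add: tensor_def)

sublocale tensor: complex_algebra "tensor A B"
  by (rule complex_algebra_tensor)

lemma pure_coset: "pure A B a b = T.coset (single (a, b) 1)"
  by (simp add: pure_def)

lemma pure_closed [simp, intro]:
  assumes "a \<in> carrier A" "b \<in> carrier B"
  shows "pure A B a b \<in> carrier (tensor A B)"
  unfolding pure_coset tensor_def using assms by (intro T.coset_in P.F_closed(5)) simp

lemma pure_add_l:
  assumes "a \<in> carrier A" "a' \<in> carrier A" "b \<in> carrier B"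
  shows "pure A B (a \<oplus>\<^bsub>A\<^esub> a') b = pure A B a b \<oplus>\<^bsub>tensor A B\<^esub> pure A B a' b"
  using pm.span_base[OF rel_add_l[OF assms]]
  unfolding pure_coset tensor_def T.quot_add T.coset_eq diff_diff_eq .

lemma pure_add_r:
  assumes "a \<in> carrier A" "b \<in> carrier B" "b' \<in> carrier B"
  shows "pure A B a (b \<oplus>\<^bsub>B\<^esub> b') = pure A B a b \<oplus>\<^bsub>tensor A B\<^esub> pure A B a b'"
  using pm.span_base[OF rel_add_r[OF assms]]
  unfolding pure_coset tensor_def T.quot_add T.coset_eq diff_diff_eq .

lemma pure_sm_l:
  assumes "a \<in> carrier A" "b \<in> carrier B"
  shows "pure A B (c \<odot>\<^bsub>A\<^esub> a) b = c \<odot>\<^bsub>tensor A B\<^esub> pure A B a b"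
  using pm.span_base[OF rel_sm_l[OF assms]]
  unfolding pure_coset tensor_def T.quot_smult T.coset_eq pm_scale_single mult_1_right .

lemma pure_sm_r:
  assumes "a \<in> carrier A" "b \<in> carrier B"
  shows "pure A B a (c \<odot>\<^bsub>B\<^esub> b) = c \<odot>\<^bsub>tensor A B\<^esub> pure A B a b"
  using pm.span_base[OF rel_sm_r[OF assms]]
  unfolding pure_coset tensor_def T.quot_smult T.coset_eq pm_scale_single mult_1_right .

lemma pure_bilinear: "bilinear A B (tensor A B) (pure A B)"
  by (intro bilinearI linear_mapsI) (simp_all add: pure_add_l pure_add_r pure_sm_l pure_sm_r)

lemma pure_mult:
  assumes "a \<in> carrier A" "b \<in> carrier B" "a' \<in> carrier A" "b' \<in> carrier B"
  shows "pure A B a b \<otimes>\<^bsub>tensor A B\<^esub> pure A B a' b' = pure A B (a \<otimes>\<^bsub>A\<^esub> a') (b \<otimes>\<^bsub>B\<^esub> b')"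
  using T.quot_mult[of "single (a, b) 1" "single (a', b') 1"] assms
  by (simp add: pure_coset tensor_def)

lemma one_tensor: "\<one>\<^bsub>tensor A B\<^esub> = pure A B \<one>\<^bsub>A\<^esub> \<one>\<^bsub>B\<^esub>"
  by (simp add: pure_coset tensor_def T.quot_one)

text \<open>Scalars can be moved into the first factor, so sums of pure tensors suffice.\<close>

lemma tensor_induct [consumes 1, case_names zero pure add]:
  assumes "t \<in> carrier (tensor A B)"
    and "Q \<zero>\<^bsub>tensor A B\<^esub>"
    and "\<And>a b. a \<in> carrier A \<Longrightarrow> b \<in> carrier B \<Longrightarrow> Q (pure A B a b)"
    and "\<And>t t'. t \<in> carrier (tensor A B) \<Longrightarrow> t' \<in> carrier (tensor A B) \<Longrightarrow> Q t \<Longrightarrow> Q t'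
      \<Longrightarrow> Q (t \<oplus>\<^bsub>tensor A B\<^esub> t')"
  shows "Q t"
proof -
  obtain p where p: "p \<in> carrier P" "t = T.coset p"
    using assms(1) unfolding tensor_def by (rule T.coset_cases)
  from p(1) have "keys p \<subseteq> S" by simp
  then have "Q (T.coset p)"
  proof (induction p rule: pm_induct_on)
    case zero
    then show ?case using assms(2) by (simp add: tensor_def T.quot_zero T.coset_0)
  next
    case (single k c)
    obtain a b where k: "k = (a, b)" "a \<in> carrier A" "b \<in> carrier B" using single by auto
    have "T.coset (single k c) = c \<odot>\<^bsub>tensor A B\<^esub> pure A B a b"
      by (simp add: k pure_coset tensor_def T.quot_smult)
    also have "\<dots> = pure A B (c \<odot>\<^bsub>A\<^esub> a) b"
      by (simp add: k pure_sm_l)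
    finally have "T.coset (single k c) = pure A B (c \<odot>\<^bsub>A\<^esub> a) b" .
    then show ?case using assms(3) k by simp
  next
    case (add p r)
    then show ?case
      using assms(4)[of "T.coset p" "T.coset r"] T.coset_in by (simp add: tensor_def T.quot_add)
  qed
  with p show ?thesis by simp
qed

text \<open>Uniqueness in the universal property of the tensor product; existence is
  \<open>tensor_lift_linear\<close> and \<open>tensor_lift_pure\<close> below.\<close>

lemma linear_eq_on_pure:
  assumes "f \<in> linear_maps (tensor A B) T" "g \<in> linear_maps (tensor A B) T" "cvs T"
    and "\<And>a b. a \<in> carrier A \<Longrightarrow> b \<in> carrier B \<Longrightarrow> f (pure A B a b) = g (pure A B a b)"
    and "t \<in> carrier (tensor A B)"
  shows "f t = g t"
  using assms(5)
  by (induction rule: tensor_induct)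
     (simp_all add: assms(4) linear_maps_zero[OF assms(1) complex_algebra_cvs[OF complex_algebra_tensor] assms(3)]
        linear_maps_zero[OF assms(2) complex_algebra_cvs[OF complex_algebra_tensor] assms(3)]
        linear_maps_add[OF assms(1)] linear_maps_add[OF assms(2)])

text \<open>The bilinearity of \<open>f\<close> is exactly the statement that its linear extension kills the relations.\<close>

lemma lin_ext_bilinear_rels:
  assumes f: "bilinear A B T f" and T: "cvs T" and r: "r \<in> bilinear_rels A B"
  shows "lin_ext T (\<lambda>k. f (fst k) (snd k)) r = \<zero>\<^bsub>T\<^esub>"
proof -
  interpret T: cvs T by fact
  let ?g = "\<lambda>k. f (fst k) (snd k)"
  have fT: "f a b \<in> carrier T" if "a \<in> carrier A" "b \<in> carrier B" for a b
    using f that by (auto simp: bilinear_def linear_maps_def)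
  have L: "lin_ext T ?g \<in> linear_maps P T"
    by (rule P.lin_ext_linear[OF T]) (auto intro: fT)
  have diff: "lin_ext T ?g (p - s) = lin_ext T ?g p \<oplus>\<^bsub>T\<^esub> (-1) \<odot>\<^bsub>T\<^esub> lin_ext T ?g s"
    if "p \<in> carrier P" "s \<in> carrier P" for p s
    using linear_maps_add[OF L, of p "pm_scale (-1) s"] linear_maps_smult[OF L, of s "-1"] that
      P.F_closed(4)[of s "-1"] by simp
  have sg: "lin_ext T ?g (single (a, b) c) = c \<odot>\<^bsub>T\<^esub> f a b"
    if "a \<in> carrier A" "b \<in> carrier B" for a b c
    using T.lin_ext_single[of ?g "(a, b)" c] fT that by simp
  have sP: "single (a, b) c \<in> carrier P" if "a \<in> carrier A" "b \<in> carrier B" for a b c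
    using P.F_closed(5) that by simp
  note [simp del] = P_simps(1)
  have e2: "w \<oplus>\<^bsub>T\<^esub> (-1) \<odot>\<^bsub>T\<^esub> w = \<zero>\<^bsub>T\<^esub>" if "w \<in> carrier T" for w
    using that by (simp add: T.sm_m1 T.M.r_neg)
  have e1: "(u \<oplus>\<^bsub>T\<^esub> v) \<oplus>\<^bsub>T\<^esub> (-1) \<odot>\<^bsub>T\<^esub> u \<oplus>\<^bsub>T\<^esub> (-1) \<odot>\<^bsub>T\<^esub> v = \<zero>\<^bsub>T\<^esub>"
    if "u \<in> carrier T" "v \<in> carrier T" for u v
    using e2[of "u \<oplus>\<^bsub>T\<^esub> v"] that by (simp add: T.sm_add_r T.M.a_assoc)
  note e = e1 e2
  have fl: "f (a \<oplus>\<^bsub>A\<^esub> a') b = f a b \<oplus>\<^bsub>T\<^esub> f a' b" "f (c \<odot>\<^bsub>A\<^esub> a) b = c \<odot>\<^bsub>T\<^esub> f a b"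
    if "a \<in> carrier A" "a' \<in> carrier A" "b \<in> carrier B" for a a' b c
    using f that by (auto simp: bilinear_def linear_maps_def)
  have fr: "f a (b \<oplus>\<^bsub>B\<^esub> b') = f a b \<oplus>\<^bsub>T\<^esub> f a b'" "f a (c \<odot>\<^bsub>B\<^esub> b) = c \<odot>\<^bsub>T\<^esub> f a b"
    if "a \<in> carrier A" "b \<in> carrier B" "b' \<in> carrier B" for a b b' c
    using f that by (auto simp: bilinear_def linear_maps_def)
  from r show ?thesis
  proof (cases rule: rels_cases)
    case (add_l a a' b)
    then show ?thesis by (simp add: diff sP P.F_closed(3) sg fl fT e)
  next
    case (add_r a b b')
    then show ?thesis by (simp add: diff sP P.F_closed(3) sg fr fT e)
  next
    case (sm_l c a b)
    then show ?thesis by (simp add: diff sP sg fl fT e)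
  next
    case (sm_r c a b)
    then show ?thesis by (simp add: diff sP sg fr fT e)
  qed
qed

lemma
  assumes f: "bilinear A B T f" and T: "cvs T"
  shows tensor_lift_linear: "tensor_lift T f \<in> linear_maps (tensor A B) T"
    and tensor_lift_pure: "a \<in> carrier A \<Longrightarrow> b \<in> carrier B \<Longrightarrow> tensor_lift T f (pure A B a b) = f a b"
proof -
  interpret T: cvs T by fact
  let ?g = "\<lambda>k. f (fst k) (snd k)"
  have fT: "f a b \<in> carrier T" if "a \<in> carrier A" "b \<in> carrier B" for a b
    using f that by (auto simp: bilinear_def linear_maps_def)
  have L: "lin_ext T ?g \<in> linear_maps P T"
    by (rule P.lin_ext_linear[OF T]) (auto intro: fT)
  have v: "lin_ext T ?g j = \<zero>\<^bsub>T\<^esub>" if "j \<in> J" for j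
    by (rule P.linear_vanish_span[OF L T bilinear_rels_sub lin_ext_bilinear_rels[OF f T] that])
  have tl: "tensor_lift T f = (\<lambda>x. the_elem (lin_ext T ?g ` x))"
    by (simp add: tensor_lift_def lin_ext_def fun_eq_iff)
  show "tensor_lift T f \<in> linear_maps (tensor A B) T"
    unfolding tl tensor_def by (rule T.quot_lift_linear[OF L T v])
  show "tensor_lift T f (pure A B a b) = f a b" if "a \<in> carrier A" "b \<in> carrier B"
    unfolding tl pure_coset using that fT P.F_closed(5)
    by (subst T.the_elem_coset[OF L T v]) (auto simp: T.lin_ext_single)
qed

end


subsection \<open>Linear and bilinear maps\<close>

lemma linear_maps_plus:
  assumes "f \<in> linear_maps A T" "g \<in> linear_maps A T" "cvs T"
  shows "(\<lambda>x. f x \<oplus>\<^bsub>T\<^esub> g x) \<in> linear_maps A T"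
proof -
  interpret T: cvs T by fact
  show ?thesis
    using assms(1,2) by (intro linear_mapsI) (auto simp: linear_maps_def T.sm_add_r T.M.a_ac Pi_def)
qed

lemma linear_maps_scaled:
  assumes "f \<in> linear_maps A T" "cvs T"
  shows "(\<lambda>x. c \<odot>\<^bsub>T\<^esub> f x) \<in> linear_maps A T"
proof -
  interpret T: cvs T by fact
  show ?thesis
    using assms(1) by (intro linear_mapsI) (auto simp: linear_maps_def T.sm_add_r T.sm_sm mult.commute Pi_def)
qed

lemma bilinear_left: "bilinear A B T f \<Longrightarrow> b \<in> carrier B \<Longrightarrow> (\<lambda>a. f a b) \<in> linear_maps A T"
  by (simp add: bilinear_def)

lemma bilinear_right: "bilinear A B T f \<Longrightarrow> a \<in> carrier A \<Longrightarrow> f a \<in> linear_maps B T"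
  by (simp add: bilinear_def)

lemma bilinear_closed: "bilinear A B T f \<Longrightarrow> a \<in> carrier A \<Longrightarrow> b \<in> carrier B \<Longrightarrow> f a b \<in> carrier T"
  by (auto simp: bilinear_def linear_maps_def)

lemma bilinear_post:
  assumes "bilinear A B T f" "g \<in> linear_maps T U"
  shows "bilinear A B U (\<lambda>a b. g (f a b))"
  by (intro bilinearI linear_maps_comp[OF bilinear_left[OF assms(1)] assms(2)]
      linear_maps_comp[OF bilinear_right[OF assms(1)] assms(2)])

lemma bilinear_pre:
  assumes "bilinear C D T h" "f \<in> linear_maps A C" "g \<in> linear_maps B D"
  shows "bilinear A B T (\<lambda>a b. h (f a) (g b))"
proof (rule bilinearI)
  show "(\<lambda>a. h (f a) (g b)) \<in> linear_maps A T" if "b \<in> carrier B" for b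
    using linear_maps_comp[OF assms(2) bilinear_left[OF assms(1)]] linear_maps_closed[OF assms(3) that] by auto
  show "(\<lambda>b. h (f a) (g b)) \<in> linear_maps B T" if "a \<in> carrier A" for a
    using linear_maps_comp[OF assms(3) bilinear_right[OF assms(1)]] linear_maps_closed[OF assms(2) that] by auto
qed

lemma (in complex_algebra) mult_bilinear: "bilinear A A A (\<otimes>)"
  by (intro bilinearI linear_mapsI) (simp_all add: l_distr r_distr smult_mult_left smult_mult_right)

lemma (in complex_algebra) mult_left_linear: "a \<in> carrier A \<Longrightarrow> (\<lambda>x. a \<otimes> x) \<in> linear_maps A A"
  by (intro linear_mapsI) (simp_all add: r_distr smult_mult_right)

lemma (in complex_algebra) mult_right_linear: "a \<in> carrier A \<Longrightarrow> (\<lambda>x. x \<otimes> a) \<in> linear_maps A A"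
  by (intro linear_mapsI) (simp_all add: l_distr smult_mult_left)

lemma bilinear_smult:
  assumes "cvs A" "f \<in> linear_maps B complex_alg"
  shows "bilinear A B A (\<lambda>a b. f b \<odot>\<^bsub>A\<^esub> a)"
proof -
  interpret A: cvs A by fact
  show ?thesis
    using assms(2) by (intro bilinearI linear_mapsI)
      (auto simp: linear_maps_def A.sm_add_r A.sm_add_l A.sm_sm mult.commute)
qed

lemma bilinear_smult':
  assumes "cvs A" "f \<in> linear_maps B complex_alg"
  shows "bilinear B A A (\<lambda>b a. f b \<odot>\<^bsub>A\<^esub> a)"
  using bilinear_smult[OF assms] by (auto simp: bilinear_def)

context alg_pair
begin

text \<open>If a bilinear map depends linearly on a parameter, so does the linear map that it induces.
  This is needed for iterated tensor products, in particular for \<^const>\<open>tensor_assoc\<close>.\<close>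

lemma tensor_lift_param:
  assumes T: "cvs T" and C: "cvs C"
    and f: "\<And>c. c \<in> carrier C \<Longrightarrow> bilinear A B T (f c)"
    and lin: "\<And>a b. a \<in> carrier A \<Longrightarrow> b \<in> carrier B \<Longrightarrow> (\<lambda>c. f c a b) \<in> linear_maps C T"
  shows "bilinear (tensor A B) C T (\<lambda>t c. tensor_lift T (f c) t)"
proof (rule bilinearI)
  interpret T: cvs T by fact
  interpret C: cvs C by fact
  show "(\<lambda>t. tensor_lift T (f c) t) \<in> linear_maps (tensor A B) T" if "c \<in> carrier C" for c
    by (rule tensor_lift_linear[OF f[OF that] T])
  show "(\<lambda>c. tensor_lift T (f c) t) \<in> linear_maps C T" if t: "t \<in> carrier (tensor A B)" for t
  proof (rule linear_mapsI)
    show "tensor_lift T (f c) t \<in> carrier T" if "c \<in> carrier C" for c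
      by (rule linear_maps_closed[OF tensor_lift_linear[OF f[OF that] T] t])
    show "tensor_lift T (f (c \<oplus>\<^bsub>C\<^esub> c')) t = tensor_lift T (f c) t \<oplus>\<^bsub>T\<^esub> tensor_lift T (f c') t"
      if c: "c \<in> carrier C" "c' \<in> carrier C" for c c'
    proof (rule linear_eq_on_pure[where f = "tensor_lift T (f (c \<oplus>\<^bsub>C\<^esub> c'))"
          and g = "\<lambda>t. tensor_lift T (f c) t \<oplus>\<^bsub>T\<^esub> tensor_lift T (f c') t", OF _ _ T _ t])
      have cc: "c \<oplus>\<^bsub>C\<^esub> c' \<in> carrier C" using c by simp
      show "tensor_lift T (f (c \<oplus>\<^bsub>C\<^esub> c')) \<in> linear_maps (tensor A B) T"
        by (rule tensor_lift_linear[OF f[OF cc] T])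
      show "(\<lambda>t. tensor_lift T (f c) t \<oplus>\<^bsub>T\<^esub> tensor_lift T (f c') t) \<in> linear_maps (tensor A B) T"
        by (intro linear_maps_plus tensor_lift_linear T f c)
      show "tensor_lift T (f (c \<oplus>\<^bsub>C\<^esub> c')) (pure A B a b) =
          tensor_lift T (f c) (pure A B a b) \<oplus>\<^bsub>T\<^esub> tensor_lift T (f c') (pure A B a b)"
        if "a \<in> carrier A" "b \<in> carrier B" for a b
        using linear_maps_add[OF lin[OF that] c]
        by (simp add: tensor_lift_pure[OF f T] that cc c)
    qed
    show "tensor_lift T (f (z \<odot>\<^bsub>C\<^esub> c)) t = z \<odot>\<^bsub>T\<^esub> tensor_lift T (f c) t"
      if c: "c \<in> carrier C" for c z
    proof (rule linear_eq_on_pure[where f = "tensor_lift T (f (z \<odot>\<^bsub>C\<^esub> c))"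
          and g = "\<lambda>t. z \<odot>\<^bsub>T\<^esub> tensor_lift T (f c) t", OF _ _ T _ t])
      have zc: "z \<odot>\<^bsub>C\<^esub> c \<in> carrier C" using c by simp
      show "tensor_lift T (f (z \<odot>\<^bsub>C\<^esub> c)) \<in> linear_maps (tensor A B) T"
        by (rule tensor_lift_linear[OF f[OF zc] T])
      show "(\<lambda>t. z \<odot>\<^bsub>T\<^esub> tensor_lift T (f c) t) \<in> linear_maps (tensor A B) T"
        by (intro linear_maps_scaled tensor_lift_linear T f c)
      show "tensor_lift T (f (z \<odot>\<^bsub>C\<^esub> c)) (pure A B a b) = z \<odot>\<^bsub>T\<^esub> tensor_lift T (f c) (pure A B a b)"
        if "a \<in> carrier A" "b \<in> carrier B" for a b
        using linear_maps_smult[OF lin[OF that] c]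
        by (simp add: tensor_lift_pure[OF f T] that zc c)
    qed
  qed
qed

lemma cvs_tensor: "cvs (tensor A B)"
  by (rule complex_algebra_cvs[OF complex_algebra_tensor])

end

lemma
  assumes "complex_algebra A" "complex_algebra B" "complex_algebra C" "complex_algebra D"
    and f: "f \<in> linear_maps A C" and g: "g \<in> linear_maps B D"
  shows tensor_map_linear: "tensor_map C D f g \<in> linear_maps (tensor A B) (tensor C D)"
    and tensor_map_pure: "a \<in> carrier A \<Longrightarrow> b \<in> carrier B \<Longrightarrow>
      tensor_map C D f g (pure A B a b) = pure C D (f a) (g b)"
proof -
  interpret AB: alg_pair A B using assms(1,2) by (simp add: alg_pair_def)
  interpret CD: alg_pair C D using assms(3,4) by (simp add: alg_pair_def)
  note b = bilinear_pre[OF CD.pure_bilinear f g]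
  show "tensor_map C D f g \<in> linear_maps (tensor A B) (tensor C D)"
    unfolding tensor_map_def by (rule AB.tensor_lift_linear[OF b CD.cvs_tensor])
  show "tensor_map C D f g (pure A B a b) = pure C D (f a) (g b)" if "a \<in> carrier A" "b \<in> carrier B"
    unfolding tensor_map_def by (rule AB.tensor_lift_pure[OF b CD.cvs_tensor that])
qed

lemma
  assumes A: "complex_algebra A" and B: "complex_algebra B" and C: "complex_algebra C"
  shows tensor_assoc_linear:
      "tensor_assoc A B C \<in> linear_maps (tensor (tensor A B) C) (tensor A (tensor B C))"
    and tensor_assoc_pure: "a \<in> carrier A \<Longrightarrow> b \<in> carrier B \<Longrightarrow> c \<in> carrier C \<Longrightarrow>
      tensor_assoc A B C (pure (tensor A B) C (pure A B a b) c) = pure A (tensor B C) a (pure B C b c)"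
    and tensor_assoc_pure_bilinear: "t \<in> carrier (tensor A B) \<Longrightarrow> c \<in> carrier C \<Longrightarrow>
      tensor_assoc A B C (pure (tensor A B) C t c) =
        tensor_lift (tensor A (tensor B C)) (\<lambda>a b. pure A (tensor B C) a (pure B C b c)) t"
proof -
  interpret AB: alg_pair A B using A B by (simp add: alg_pair_def)
  interpret BC: alg_pair B C using B C by (simp add: alg_pair_def)
  interpret AB_C: alg_pair "tensor A B" C using AB.complex_algebra_tensor C by (simp add: alg_pair_def)
  interpret A_BC: alg_pair A "tensor B C" using BC.complex_algebra_tensor A by (simp add: alg_pair_def)
  let ?T = "tensor A (tensor B C)"
  note T = A_BC.cvs_tensor
  have f: "bilinear A B ?T (\<lambda>a b. pure A (tensor B C) a (pure B C b c))" if "c \<in> carrier C" for c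
    by (rule bilinear_pre[OF A_BC.pure_bilinear linear_maps_id bilinear_left[OF BC.pure_bilinear that]])
  have lin: "(\<lambda>c. pure A (tensor B C) a (pure B C b c)) \<in> linear_maps C ?T"
    if "a \<in> carrier A" "b \<in> carrier B" for a b
    by (rule linear_maps_comp[OF bilinear_right[OF BC.pure_bilinear that(2)] bilinear_right[OF A_BC.pure_bilinear that(1)]])
  note b = AB.tensor_lift_param[OF T complex_algebra_cvs[OF C] f lin]
  show "tensor_assoc A B C \<in> linear_maps (tensor (tensor A B) C) ?T"
    unfolding tensor_assoc_def by (rule AB_C.tensor_lift_linear[OF b T])
  show l: "tensor_assoc A B C (pure (tensor A B) C t c) =
        tensor_lift ?T (\<lambda>a b. pure A (tensor B C) a (pure B C b c)) t"
    if "t \<in> carrier (tensor A B)" "c \<in> carrier C" for t c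
    unfolding tensor_assoc_def by (rule AB_C.tensor_lift_pure[OF b T that])
  show "tensor_assoc A B C (pure (tensor A B) C (pure A B a b) c) = pure A (tensor B C) a (pure B C b c)"
    if "a \<in> carrier A" "b \<in> carrier B" "c \<in> carrier C"
    using that by (subst l) (auto simp: AB.tensor_lift_pure[OF f T])
qed


subsection \<open>The tensor product of *-algebras\<close>

locale star_pair = A: star_algebra A + B: star_algebra B
  for A :: "('a, 'm) star_alg_scheme" and B :: "('b, 'n) star_alg_scheme"

sublocale star_pair \<subseteq> alg_pair A B
  by (intro alg_pair.intro A.complex_algebra_axioms B.complex_algebra_axioms)

context star_pair
begin

lemma star_algebra_P: "star_algebra P"
proof (intro star_algebra.intro complex_algebra_P star_algebra_axioms.intro)
  let ?s = "map_prod (star A) (star B)"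
  have s: "?s k \<in> S" if "k \<in> S" for k
    using that by (auto simp: A.star_closed B.star_closed)
  show "star P p \<in> carrier P" if "p \<in> carrier P" for p
  proof -
    have "keys (pm_conj ?s p) \<subseteq> ?s ` keys p" by (rule pm_conj_keys)
    also have "\<dots> \<subseteq> S"
    proof (rule image_subsetI, rule s)
      show "k \<in> S" if "k \<in> keys p" for k
        using \<open>p \<in> carrier P\<close> that by (simp only: P_simps(1) mem_Collect_eq subset_eq)
    qed
    finally show ?thesis by simp
  qed
  show "star P (star P p) = p" if "p \<in> carrier P" for p
    using pm_conj_conj[of p S ?s] that by (auto simp: A.star_star B.star_star)
  show "star P (p \<otimes>\<^bsub>P\<^esub> r) = star P r \<otimes>\<^bsub>P\<^esub> star P p" if "p \<in> carrier P" "r \<in> carrier P" for p r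
  proof -
    have "keys p \<subseteq> S" "keys r \<subseteq> S" using that by auto
    then have "pm_conj ?s (pmul p r) = pmul (pm_conj ?s r) (pm_conj ?s p)"
    proof (induction p rule: pm_induct_on)
      case (single k c)
      show ?case using single(2,1)
      proof (induction r rule: pm_induct_on)
        case (single k' d)
        then show ?case by (cases k; cases k') (simp add: A.star_mult B.star_mult mult.commute)
      qed (simp_all add: pmul_add_left pmul_add_right pm_conj_add)
    qed (simp_all add: pmul_add_left pmul_add_right pm_conj_add)
    then show ?thesis by simp
  qed
qed (simp_all add: pm_conj_add pm_conj_scale)

lemma star_rels:
  assumes "r \<in> bilinear_rels A B"
  shows "pm_conj (map_prod (star A) (star B)) r \<in> bilinear_rels A B"
  using assms
proof (cases rule: rels_cases)
  case (add_l a a' b)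
  then show ?thesis
    using rel_add_l[of "star A a" "star A a'" "star B b"]
    by (simp add: pm_conj_diff A.star_closed B.star_closed A.star_add)
next
  case (add_r a b b')
  then show ?thesis
    using rel_add_r[of "star A a" "star B b" "star B b'"]
    by (simp add: pm_conj_diff A.star_closed B.star_closed B.star_add)
next
  case (sm_l c a b)
  then show ?thesis
    using rel_sm_l[of "star A a" "star B b" "cnj c"]
    by (simp add: pm_conj_diff A.star_closed B.star_closed A.star_smult)
next
  case (sm_r c a b)
  then show ?thesis
    using rel_sm_r[of "star A a" "star B b" "cnj c"]
    by (simp add: pm_conj_diff A.star_closed B.star_closed B.star_smult)
qed

lemma star_J: "j \<in> J \<Longrightarrow> star P j \<in> J"
proof -
  have "pm.subspace {j. pm_conj (map_prod (star A) (star B)) j \<in> J}"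
    by (intro pm.subspaceI) (auto simp: pm_conj_add pm_conj_scale pm.span_zero intro: pm.span_add pm.span_scale)
  from pm.span_minimal[OF _ this, of "bilinear_rels A B"] star_rels
  show "j \<in> J \<Longrightarrow> star P j \<in> J" by (auto intro: pm.span_base)
qed

sublocale T: pm_star_ideal P S J
  by (intro pm_star_ideal.intro pm_star_ideal_axioms.intro T.pm_ideal_axioms star_algebra_P star_J)

lemma star_algebra_tensor: "star_algebra (tensor A B)"
  using T.star_algebra_quot by (simp add: tensor_def)

lemma pure_star:
  assumes "a \<in> carrier A" "b \<in> carrier B"
  shows "star (tensor A B) (pure A B a b) = pure A B (star A a) (star B b)"
  using T.quot_star[of "single (a, b) 1"] assms by (simp add: pure_coset tensor_def)

end


section \<open>Algebras presented by generators and relations\<close>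

lemma ring_homI_alg:
  assumes "f \<in> linear_maps A B"
    and "\<And>x y. x \<in> carrier A \<Longrightarrow> y \<in> carrier A \<Longrightarrow> f (x \<otimes>\<^bsub>A\<^esub> y) = f x \<otimes>\<^bsub>B\<^esub> f y"
    and "f \<one>\<^bsub>A\<^esub> = \<one>\<^bsub>B\<^esub>"
  shows "f \<in> alg_hom A B"
  using assms by (auto simp: alg_hom_def ring_hom_def linear_maps_def)

lemma alg_hom_linear: "f \<in> alg_hom A B \<Longrightarrow> f \<in> linear_maps A B"
  by (simp add: alg_hom_def)

lemma alg_hom_mult: "f \<in> alg_hom A B \<Longrightarrow> x \<in> carrier A \<Longrightarrow> y \<in> carrier A \<Longrightarrow> f (x \<otimes>\<^bsub>A\<^esub> y) = f x \<otimes>\<^bsub>B\<^esub> f y"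
  by (simp add: alg_hom_def ring_hom_def)

lemma alg_hom_one: "f \<in> alg_hom A B \<Longrightarrow> f \<one>\<^bsub>A\<^esub> = \<one>\<^bsub>B\<^esub>"
  by (simp add: alg_hom_def ring_hom_def)

lemma pm_scale_mult_right: "p * pm_scale c r = pm_scale c (p * (r :: 'k::monoid_add \<Rightarrow>\<^sub>0 complex))"
proof -
  have "keys p \<subseteq> UNIV" "keys r \<subseteq> UNIV" by auto
  then show ?thesis
  proof (induction p rule: pm_induct_on)
    case (single k d)
    show ?case using single(2)
      by (induction r rule: pm_induct_on) (simp_all add: pm_scale_add distrib_left mult_single mult.left_commute)
  qed (simp_all add: pm_scale_add distrib_right)
qed

lemma free_alg_simps [simp]:
  "carrier free_alg = UNIV" "monoid.mult free_alg = (*)" "\<one>\<^bsub>free_alg\<^esub> = 1" "\<zero>\<^bsub>free_alg\<^esub> = 0"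
  "ring.add free_alg = (+)" "module.smult free_alg = pm_scale" "star free_alg = free_star"
  by (simp_all add: free_alg_def)

interpretation free: pm_space "free_alg :: 'g free_elem star_alg" UNIV
  by standard simp_all

lemma complex_algebra_free: "complex_algebra (free_alg :: 'g free_elem star_alg)"
  by (rule complex_algebraI[OF free.cvs_F])
     (simp_all add: algebra_simps pm_scale_mult pm_scale_mult_right)

lemma free_star_conj: "free_star = pm_conj word_star"
  by (simp add: fun_eq_iff free_star_def pm_conj_def)

lemma word_star_add: "word_star (v + w) = word_star w + word_star v"
  by (simp add: word_star_def plus_star_word_def)

lemma letter_star_star [simp]: "letter_star (letter_star a) = a"
  by (cases a) simp_all

lemma word_star_star [simp]: "word_star (word_star w) = w"
  by (cases w) (simp add: word_star_def rev_map comp_def)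

lemma free_star_mult: "free_star (p * r) = free_star r * free_star p"
proof -
  have "keys p \<subseteq> UNIV" "keys r \<subseteq> UNIV" by auto
  then show ?thesis
    unfolding free_star_conj
  proof (induction p rule: pm_induct_on)
    case (single k c)
    show ?case using single(2)
      by (induction r rule: pm_induct_on)
         (simp_all add: pm_conj_add algebra_simps mult_single word_star_add mult.commute)
  qed (simp_all add: pm_conj_add algebra_simps)
qed

lemma free_star_simps [simp]:
  "free_star 0 = 0" "free_star (p + r) = free_star p + free_star r"
  "free_star (p - r) = free_star p - free_star r" "free_star (pm_scale c p) = pm_scale (cnj c) (free_star p)"
  "free_star (letter_elem a) = letter_elem (letter_star a)" "free_star 1 = 1" "free_star (free_star p) = p"
proof -
  show "free_star (1 :: 'g free_elem) = 1"
    unfolding free_star_conj single_one[symmetric]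
    by (simp add: word_star_def zero_star_word_def)
  show "free_star (free_star p) = p"
    unfolding free_star_conj by (rule pm_conj_conj[of p UNIV]) simp_all
qed (simp_all add: free_star_conj pm_conj_add pm_conj_diff pm_conj_scale letter_elem_def word_star_def)

lemma free_star_gen [simp]: "free_star (gen g) = gen_star g" "free_star (gen_star g) = gen g"
  by (simp_all add: gen_def gen_star_def)

lemma star_algebra_free: "star_algebra (free_alg :: 'g free_elem star_alg)"
  by (intro star_algebra.intro complex_algebra_free star_algebra_axioms.intro) (simp_all add: free_star_mult)

lemma ideal_freeI:
  fixes I :: "'g free_elem set"
  assumes "0 \<in> I" "\<And>x y. x \<in> I \<Longrightarrow> y \<in> I \<Longrightarrow> x + y \<in> I" "\<And>x. x \<in> I \<Longrightarrow> - x \<in> I"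
    and "\<And>p x. x \<in> I \<Longrightarrow> p * x \<in> I" "\<And>p x. x \<in> I \<Longrightarrow> x * p \<in> I"
  shows "ideal I free_alg"
proof -
  interpret complex_algebra "free_alg :: 'g free_elem star_alg" by (rule complex_algebra_free)
  have m: "\<ominus>\<^bsub>free_alg\<^esub> x = - x" for x :: "'g free_elem"
    using sm_m1[of x] by simp
  show ?thesis
  proof (rule idealI)
    show "subgroup I (add_monoid free_alg)"
      by (rule M.add.subgroupI) (use assms in \<open>auto simp flip: a_inv_def simp: m\<close>)
  qed (use assms ring_axioms in auto)
qed

abbreviation cls :: "'g free_elem set \<Rightarrow> 'g free_elem \<Rightarrow> 'g free_elem set" where
  "cls R p \<equiv> star_ideal R +>\<^bsub>free_alg\<^esub> p"

lemma ideal_star_ideal: "ideal (star_ideal R) free_alg"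
proof -
  interpret complex_algebra "free_alg :: 'g free_elem star_alg" by (rule complex_algebra_free)
  show ?thesis unfolding star_ideal_def by (rule genideal_ideal) simp
qed

lemma star_ideal_base: "r \<in> R \<Longrightarrow> r \<in> star_ideal R" "r \<in> R \<Longrightarrow> free_star r \<in> star_ideal R"
proof -
  interpret complex_algebra "free_alg :: 'g free_elem star_alg" by (rule complex_algebra_free)
  have "R \<union> free_star ` R \<subseteq> star_ideal R" unfolding star_ideal_def by (rule genideal_self) simp
  then show "r \<in> R \<Longrightarrow> r \<in> star_ideal R" "r \<in> R \<Longrightarrow> free_star r \<in> star_ideal R" by auto
qed

lemma star_ideal_minimal:
  assumes "ideal I free_alg" "R \<subseteq> I" "free_star ` R \<subseteq> I"
  shows "star_ideal R \<subseteq> I"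
proof -
  interpret complex_algebra "free_alg :: 'g free_elem star_alg" by (rule complex_algebra_free)
  show ?thesis unfolding star_ideal_def by (rule genideal_minimal) (use assms in auto)
qed

lemma star_ideal_closed:
  "0 \<in> star_ideal R" "x \<in> star_ideal R \<Longrightarrow> y \<in> star_ideal R \<Longrightarrow> x + y \<in> star_ideal R"
  "x \<in> star_ideal R \<Longrightarrow> p * x \<in> star_ideal R" "x \<in> star_ideal R \<Longrightarrow> x * p \<in> star_ideal R"
  "x \<in> star_ideal R \<Longrightarrow> pm_scale c x \<in> star_ideal R"
proof -
  interpret ideal "star_ideal R" free_alg by (rule ideal_star_ideal)
  show "0 \<in> star_ideal R" using additive_subgroup.zero_closed[OF is_additive_subgroup] by simp
  show "x \<in> star_ideal R \<Longrightarrow> y \<in> star_ideal R \<Longrightarrow> x + y \<in> star_ideal R" using additive_subgroup.a_closed[OF is_additive_subgroup, of x y] by simp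
  show "x \<in> star_ideal R \<Longrightarrow> p * x \<in> star_ideal R" for p using I_l_closed[of x p] by simp
  then show "x \<in> star_ideal R \<Longrightarrow> pm_scale c x \<in> star_ideal R"
    using pm_scale_mult[of c 1 x] by (metis mult_1)
  show "x \<in> star_ideal R \<Longrightarrow> x * p \<in> star_ideal R" using I_r_closed[of x p] by simp
qed

text \<open>The elements whose star lies in the ideal form an ideal that contains the generators, since the
  set of generators is closed under the star.\<close>

lemma star_ideal_star: "x \<in> star_ideal R \<Longrightarrow> free_star x \<in> star_ideal R"
proof -
  have "ideal {x. free_star x \<in> star_ideal R} free_alg"
  proof (rule ideal_freeI; unfold mem_Collect_eq)
    show "free_star (- x) \<in> star_ideal R" if "free_star x \<in> star_ideal R" for x
      using star_ideal_closed(5)[OF that, of "- 1"] free_star_simps(4)[of "- 1" x] by simp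
  qed (simp_all add: free_star_mult star_ideal_closed)
  then have "star_ideal R \<subseteq> {x. free_star x \<in> star_ideal R}"
    by (rule star_ideal_minimal) (use star_ideal_base[of _ R] in \<open>auto simp del: free_star_gen\<close>)
  then show "x \<in> star_ideal R \<Longrightarrow> free_star x \<in> star_ideal R" by blast
qed

lemma presented_pm_star_ideal: "pm_star_ideal free_alg UNIV (star_ideal R)"
proof -
  have "pm_subspace free_alg UNIV (star_ideal R)"
    by (intro pm_subspace.intro pm_subspace_axioms.intro free.pm_space_axioms)
       (auto intro: star_ideal_closed)
  then show ?thesis
    by (intro pm_star_ideal.intro pm_star_ideal_axioms.intro pm_ideal.intro pm_ideal_axioms.intro
        complex_algebra_free star_algebra_free) (auto intro: star_ideal_closed star_ideal_star)
qed

lemma star_algebra_presented: "star_algebra (presented_alg R)"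
  unfolding presented_alg_def by (rule pm_star_ideal.star_algebra_quot[OF presented_pm_star_ideal])

lemma complex_algebra_presented: "complex_algebra (presented_alg R)"
  by (rule star_algebra.axioms[OF star_algebra_presented])

lemma cls_closed [simp, intro]: "cls R p \<in> carrier (presented_alg R)"
  and cls_add: "cls R (p + r) = cls R p \<oplus>\<^bsub>presented_alg R\<^esub> cls R r"
  and cls_mult: "cls R (p * r) = cls R p \<otimes>\<^bsub>presented_alg R\<^esub> cls R r"
  and cls_smult: "cls R (pm_scale c p) = c \<odot>\<^bsub>presented_alg R\<^esub> cls R p"
  and cls_star: "cls R (free_star p) = star (presented_alg R) (cls R p)"
  and cls_zero: "cls R 0 = \<zero>\<^bsub>presented_alg R\<^esub>"
  and cls_one: "cls R 1 = \<one>\<^bsub>presented_alg R\<^esub>"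
  and cls_eq: "cls R p = cls R r \<longleftrightarrow> p - r \<in> star_ideal R"
proof -
  interpret pm_star_ideal free_alg UNIV "star_ideal R" by (rule presented_pm_star_ideal)
  show "cls R p \<in> carrier (presented_alg R)" "cls R (p + r) = cls R p \<oplus>\<^bsub>presented_alg R\<^esub> cls R r"
    "cls R (p * r) = cls R p \<otimes>\<^bsub>presented_alg R\<^esub> cls R r"
    "cls R (pm_scale c p) = c \<odot>\<^bsub>presented_alg R\<^esub> cls R p"
    "cls R (free_star p) = star (presented_alg R) (cls R p)"
    "cls R 0 = \<zero>\<^bsub>presented_alg R\<^esub>" "cls R 1 = \<one>\<^bsub>presented_alg R\<^esub>"
    "cls R p = cls R r \<longleftrightarrow> p - r \<in> star_ideal R"
    unfolding presented_alg_def
    using coset_in[of p] by (simp_all add: quot_add quot_mult quot_smult quot_star quot_zero coset_0 quot_one coset_eq)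
qed

lemma presented_cases:
  assumes "x \<in> carrier (presented_alg R)"
  obtains p where "x = cls R p"
proof -
  interpret pm_star_ideal free_alg UNIV "star_ideal R" by (rule presented_pm_star_ideal)
  from assms that show thesis unfolding presented_alg_def by (auto elim: coset_cases)
qed

lemma cls_rel:
  assumes "r \<in> R"
  shows "cls R r = \<zero>\<^bsub>presented_alg R\<^esub>"
  using star_ideal_base(1)[OF assms] by (simp add: cls_eq flip: cls_zero)

lemma cls_rel_diff: "p - r \<in> R \<Longrightarrow> cls R p = cls R r"
  by (simp add: cls_eq star_ideal_base)


subsection \<open>Evaluation of words\<close>

text \<open>Evaluation with arbitrary values \<open>e\<close> on the letters, without a star on the target. For
  \<^term>\<open>e = letter_eval T f\<close> it gives \<^const>\<open>free_eval\<close>; the general form is for the representation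
  by operators below, which is not one of *-algebras.\<close>

definition word_eval :: "('b, 'n) star_alg_scheme \<Rightarrow> ('g letter \<Rightarrow> 'b) \<Rightarrow> 'g star_word \<Rightarrow> 'b" where
  "word_eval T e w = foldr (\<lambda>a t. e a \<otimes>\<^bsub>T\<^esub> t) (letters w) \<one>\<^bsub>T\<^esub>"

lemma free_eval_lin_ext: "free_eval T f = lin_ext T (word_eval T (letter_eval T f))"
  by (simp add: fun_eq_iff free_eval_def lin_ext_def word_eval_def)

locale letter_values = T: complex_algebra T
  for T :: "('b, 'n) star_alg_scheme" +
  fixes e :: "'g letter \<Rightarrow> 'b"
  assumes e_closed: "e a \<in> carrier T"
begin

abbreviation ev :: "'g free_elem \<Rightarrow> 'b" where
  "ev \<equiv> lin_ext T (word_eval T e)"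

lemma word_eval_closed [simp]: "word_eval T e w \<in> carrier T"
proof -
  have "foldr (\<lambda>a t. e a \<otimes>\<^bsub>T\<^esub> t) v \<one>\<^bsub>T\<^esub> \<in> carrier T" for v
    by (induction v) (simp_all add: e_closed)
  then show ?thesis by (simp add: word_eval_def)
qed

lemma word_eval_add: "word_eval T e (v + w) = word_eval T e v \<otimes>\<^bsub>T\<^esub> word_eval T e w"
proof -
  have *: "foldr (\<lambda>a t. e a \<otimes>\<^bsub>T\<^esub> t) v s = foldr (\<lambda>a t. e a \<otimes>\<^bsub>T\<^esub> t) v \<one>\<^bsub>T\<^esub> \<otimes>\<^bsub>T\<^esub> s \<and>
      foldr (\<lambda>a t. e a \<otimes>\<^bsub>T\<^esub> t) v \<one>\<^bsub>T\<^esub> \<in> carrier T" if "s \<in> carrier T" for v s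
    using that by (induction v) (simp_all add: e_closed T.m_assoc)
  have "foldr (\<lambda>a t. e a \<otimes>\<^bsub>T\<^esub> t) (letters w) \<one>\<^bsub>T\<^esub> \<in> carrier T"
    using word_eval_closed[of w] by (simp add: word_eval_def)
  from *[OF this, of "letters v"] show ?thesis
    by (simp add: word_eval_def plus_star_word_def)
qed

lemma ev_linear: "ev \<in> linear_maps free_alg T"
  by (rule free.lin_ext_linear[OF T.cvs_axioms]) simp

lemma ev_closed [simp]: "ev p \<in> carrier T"
  using linear_maps_closed[OF ev_linear, of p] by simp

lemma ev_add: "ev (p + r) = ev p \<oplus>\<^bsub>T\<^esub> ev r"
  using linear_maps_add[OF ev_linear, of p r] by simp

lemma ev_smult: "ev (pm_scale c p) = c \<odot>\<^bsub>T\<^esub> ev p"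
  using linear_maps_smult[OF ev_linear, of p c] by simp

lemma ev_diff: "ev (p - r) = ev p \<ominus>\<^bsub>T\<^esub> ev r"
  using ev_add[of p "pm_scale (-1) r"] unfolding ev_smult by (simp add: T.sm_m1 a_minus_def)

lemma ev_single: "ev (single w c) = c \<odot>\<^bsub>T\<^esub> word_eval T e w"
  by (simp add: T.lin_ext_single)

lemma ev_letter: "ev (letter_elem a) = e a"
  by (simp add: letter_elem_def ev_single word_eval_def e_closed)

lemma ev_one: "ev 1 = \<one>\<^bsub>T\<^esub>"
  unfolding single_one[symmetric] ev_single by (simp add: word_eval_def zero_star_word_def)

lemma ev_mult: "ev (p * r) = ev p \<otimes>\<^bsub>T\<^esub> ev r"
proof -
  have "keys p \<subseteq> UNIV" "keys r \<subseteq> UNIV" by auto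
  then show ?thesis
  proof (induction p rule: pm_induct_on)
    case (single k c)
    show ?case using single(2)
    proof (induction r rule: pm_induct_on)
      case (single k' d)
      then show ?case
        by (simp add: mult_single ev_single word_eval_add T.smult_mult_left T.smult_mult_right T.sm_sm mult.commute)
    qed (simp_all add: distrib_left ev_add T.r_distr)
  qed (simp_all add: distrib_right ev_add T.l_distr)
qed

text \<open>The kernel of the evaluation is an ideal. Without a star on the target, the relations and
  their stars have to be killed separately.\<close>

lemma ev_star_ideal:
  assumes "\<And>r. r \<in> R \<Longrightarrow> ev r = \<zero>\<^bsub>T\<^esub>" "\<And>r. r \<in> R \<Longrightarrow> ev (free_star r) = \<zero>\<^bsub>T\<^esub>"
  shows "j \<in> star_ideal R \<Longrightarrow> ev j = \<zero>\<^bsub>T\<^esub>"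
proof -
  have "ideal {p. ev p = \<zero>\<^bsub>T\<^esub>} free_alg"
    using ev_smult[of "- 1"] by (intro ideal_freeI) (auto simp: ev_add ev_mult)
  from star_ideal_minimal[OF this, of R] assms
  show "j \<in> star_ideal R \<Longrightarrow> ev j = \<zero>\<^bsub>T\<^esub>" by auto
qed

lemma
  assumes "\<And>r. r \<in> R \<Longrightarrow> ev r = \<zero>\<^bsub>T\<^esub>" "\<And>r. r \<in> R \<Longrightarrow> ev (free_star r) = \<zero>\<^bsub>T\<^esub>"
  shows the_elem_ev: "the_elem (ev ` cls R p) = ev p"
    and presented_lift_alg_hom: "(\<lambda>x. the_elem (ev ` x)) \<in> alg_hom (presented_alg R) T"
proof -
  interpret I: pm_star_ideal free_alg UNIV "star_ideal R" by (rule presented_pm_star_ideal)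
  note van = ev_star_ideal[OF assms]
  show *: "the_elem (ev ` cls R p) = ev p" for p
    by (rule I.the_elem_coset[OF ev_linear T.cvs_axioms van]) simp_all
  show "(\<lambda>x. the_elem (ev ` x)) \<in> alg_hom (presented_alg R) T"
  proof (rule ring_homI_alg)
    show "(\<lambda>x. the_elem (ev ` x)) \<in> linear_maps (presented_alg R) T"
      unfolding presented_alg_def by (rule I.quot_lift_linear[OF ev_linear T.cvs_axioms van])
  qed (auto elim!: presented_cases simp: * ev_mult ev_one simp flip: cls_mult cls_one)
qed

end

lemma letter_values_cls: "letter_values (presented_alg R) (\<lambda>a. cls R (letter_elem a))"
  by (intro letter_values.intro letter_values_axioms.intro complex_algebra_presented cls_closed)

lemma cls_eq_word_eval: "cls R p = lin_ext (presented_alg R) (word_eval (presented_alg R) (\<lambda>a. cls R (letter_elem a))) p"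
proof -
  interpret letter_values "presented_alg R" "\<lambda>a. cls R (letter_elem a)" by (rule letter_values_cls)
  have w: "cls R (single w 1) = word_eval (presented_alg R) (\<lambda>a. cls R (letter_elem a)) w" for w
  proof (cases w)
    case (Word v)
    have "cls R (single (Word v) 1) = word_eval (presented_alg R) (\<lambda>a. cls R (letter_elem a)) (Word v)"
    proof (induction v)
      case Nil
      have "single (Word [] :: 'a star_word) (1 :: complex) = 1"
        unfolding zero_star_word_def[symmetric] by simp
      then show ?case by (simp add: word_eval_def cls_one)
    next
      case (Cons a v)
      have "single (Word (a # v)) (1::complex) = letter_elem a * single (Word v) 1"
        by (simp add: letter_elem_def mult_single plus_star_word_def)
      with Cons show ?case by (simp add: cls_mult word_eval_def)
    qed
    with Word show ?thesis by simp
  qed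
  have "keys p \<subseteq> UNIV" by simp
  then show ?thesis
  proof (induction p rule: pm_induct_on)
    case (single k c)
    have "cls R (single k c) = c \<odot>\<^bsub>presented_alg R\<^esub> cls R (single k 1)"
      by (simp flip: cls_smult)
    then show ?case by (simp add: w ev_single)
  qed (simp_all add: cls_zero cls_add ev_add)
qed

lemma presented_induct [consumes 1, case_names one add smult letter]:
  assumes "x \<in> carrier (presented_alg R)"
    and "Q \<one>\<^bsub>presented_alg R\<^esub>"
    and "\<And>x y. x \<in> carrier (presented_alg R) \<Longrightarrow> y \<in> carrier (presented_alg R) \<Longrightarrow> Q x \<Longrightarrow> Q y \<Longrightarrow>
      Q (x \<oplus>\<^bsub>presented_alg R\<^esub> y)"
    and "\<And>c x. x \<in> carrier (presented_alg R) \<Longrightarrow> Q x \<Longrightarrow> Q (c \<odot>\<^bsub>presented_alg R\<^esub> x)"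
    and "\<And>a x. x \<in> carrier (presented_alg R) \<Longrightarrow> Q x \<Longrightarrow> Q (cls R (letter_elem a) \<otimes>\<^bsub>presented_alg R\<^esub> x)"
  shows "Q x"
proof -
  interpret letter_values "presented_alg R" "\<lambda>a. cls R (letter_elem a)" by (rule letter_values_cls)
  have w: "Q (word_eval (presented_alg R) (\<lambda>a. cls R (letter_elem a)) w)" for w
  proof (cases w)
    case (Word v)
    have "Q (word_eval (presented_alg R) (\<lambda>a. cls R (letter_elem a)) (Word v))"
    proof (induction v)
      case Nil
      then show ?case using assms(2) by (simp add: word_eval_def)
    next
      case (Cons a v)
      then show ?case
        using assms(5)[of "word_eval (presented_alg R) (\<lambda>a. cls R (letter_elem a)) (Word v)" a]
          word_eval_closed[of "Word v"] by (simp add: word_eval_def)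
    qed
    with Word show ?thesis by simp
  qed
  obtain p where x: "x = cls R p" using assms(1) by (rule presented_cases)
  have "keys p \<subseteq> UNIV" by simp
  then have "Q (ev p)"
  proof (induction p rule: pm_induct_on)
    case zero
    show ?case using assms(4)[OF _ assms(2), of 0] by simp
  next
    case (single k c)
    show ?case using assms(4)[OF _ w] by (simp add: ev_single)
  next
    case (add p r)
    then show ?case using assms(3) by (simp add: ev_add)
  qed
  then show ?thesis unfolding x by (subst cls_eq_word_eval)
qed

text \<open>For a *-algebra as target the evaluation commutes with the star, so it is enough that
  the relations themselves are killed.\<close>

lemma
  assumes T: "star_algebra T" and f: "\<And>g. f g \<in> carrier T" and R: "\<And>r. r \<in> R \<Longrightarrow> free_eval T f r = \<zero>\<^bsub>T\<^esub>"
  shows presented_map_cls: "presented_map T f (cls R p) = free_eval T f p"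
    and presented_map_gen: "presented_map T f (presented_gen R g) = f g"
    and presented_map_hom: "presented_map T f \<in> star_alg_hom (presented_alg R) T"
proof -
  interpret T: star_algebra T by fact
  interpret letter_values T "letter_eval T f"
  proof
    show "letter_eval T f a \<in> carrier T" for a by (cases a) (simp_all add: f T.star_closed)
  qed
  have e_star: "letter_eval T f (letter_star a) = star T (letter_eval T f a)" for a
    by (cases a) (simp_all add: T.star_star f)
  have star_one: "star T \<one>\<^bsub>T\<^esub> = \<one>\<^bsub>T\<^esub>"
    using T.star_mult[of "\<one>\<^bsub>T\<^esub>" "star T \<one>\<^bsub>T\<^esub>"] T.star_star[of "\<one>\<^bsub>T\<^esub>"] T.star_closed[of "\<one>\<^bsub>T\<^esub>"] by simp
  have star_zero: "star T \<zero>\<^bsub>T\<^esub> = \<zero>\<^bsub>T\<^esub>"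
    using T.star_smult[of "\<zero>\<^bsub>T\<^esub>" 0] T.star_closed[of "\<zero>\<^bsub>T\<^esub>"] by simp
  have ws: "word_eval T (letter_eval T f) (word_star w) = star T (word_eval T (letter_eval T f) w)" for w
  proof (cases w)
    case (Word v)
    have "word_eval T (letter_eval T f) (word_star (Word v)) = star T (word_eval T (letter_eval T f) (Word v))"
    proof (induction v)
      case Nil
      then show ?case by (simp add: word_eval_def word_star_def star_one)
    next
      case (Cons a v)
      have 1: "Word (a # v) = Word [a] + Word v" by (simp add: plus_star_word_def)
      have 2: "word_eval T (letter_eval T f) (Word [a]) = letter_eval T f a" for a
        by (simp add: word_eval_def e_closed)
      show ?case
        unfolding 1 word_star_add word_eval_add Cons.IH
        by (subst T.star_mult) (simp_all add: 2 word_star_def e_star e_closed)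
    qed
    with Word show ?thesis by simp
  qed
  have ev_star: "ev (free_star p) = star T (ev p)" for p
  proof -
    have "keys p \<subseteq> UNIV" by simp
    then show ?thesis
    proof (induction p rule: pm_induct_on)
      case (single k c)
      then show ?case by (simp add: free_star_conj ev_single ws T.star_smult)
    qed (simp_all add: star_zero ev_add T.star_add)
  qed
  have R1: "\<And>r. r \<in> R \<Longrightarrow> ev r = \<zero>\<^bsub>T\<^esub>" and R2: "\<And>r. r \<in> R \<Longrightarrow> ev (free_star r) = \<zero>\<^bsub>T\<^esub>"
    using R by (simp_all add: ev_star star_zero free_eval_lin_ext)
  have pm: "presented_map T f = (\<lambda>x. the_elem (ev ` x))"
    by (simp add: fun_eq_iff presented_map_def free_eval_lin_ext)
  show *: "presented_map T f (cls R p) = free_eval T f p" for p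
    unfolding pm free_eval_lin_ext by (rule the_elem_ev[OF R1 R2])
  show "presented_map T f (presented_gen R g) = f g"
    unfolding presented_gen_def * by (simp add: free_eval_lin_ext gen_def ev_letter)
  show "presented_map T f \<in> star_alg_hom (presented_alg R) T"
    using presented_lift_alg_hom[OF R1 R2]
    by (auto simp: star_alg_hom_def pm[symmetric] * free_eval_lin_ext ev_star elim!: presented_cases simp flip: cls_star)
qed


section \<open>The Hopf algebra of Laurent polynomials\<close>

lemma O_U1_simps [simp]:
  "carrier O_U1 = UNIV" "monoid.mult O_U1 = (*)" "\<one>\<^bsub>O_U1\<^esub> = 1" "\<zero>\<^bsub>O_U1\<^esub> = 0"
  "ring.add O_U1 = (+)" "module.smult O_U1 = pm_scale" "star O_U1 = pm_conj uminus"
  by (simp_all add: O_U1_def laurent_alg_def star_alg.defs hopf_alg.defs fun_eq_iff pm_conj_def)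

lemma tensor_laurent: "tensor laurent_alg laurent_alg = tensor O_U1 O_U1"
    "pure laurent_alg laurent_alg = pure O_U1 O_U1"
  by (simp_all add: tensor_def pure_def fun_eq_iff pair_alg_def bilinear_rels_def
      O_U1_def laurent_alg_def star_alg.defs hopf_alg.defs)

lemma comult_O_U1: "comult O_U1 = lin_ext (tensor O_U1 O_U1) (\<lambda>n. pure O_U1 O_U1 (u_pow n) (u_pow n))"
proof -
  have "comult O_U1 = (\<lambda>p. \<Oplus>\<^bsub>tensor laurent_alg laurent_alg\<^esub>n\<in>keys p.
        lookup p n \<odot>\<^bsub>tensor laurent_alg laurent_alg\<^esub>
          pure laurent_alg laurent_alg (u_pow n) (u_pow n))"
    by (simp add: O_U1_def star_alg.defs hopf_alg.defs)
  then show ?thesis unfolding tensor_laurent by (simp add: lin_ext_def fun_eq_iff)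
qed

lemma counit_O_U1: "counit O_U1 p = (\<Sum>n\<in>keys p. lookup p n)"
  by (simp add: O_U1_def star_alg.defs hopf_alg.defs)

lemma antipode_O_U1:
  "antipode O_U1 p = (\<Sum>n\<in>keys p. single (- n) (lookup p n))"
  by (simp add: O_U1_def star_alg.defs hopf_alg.defs)

lemma u_pow_add: "u_pow (m + n) = u_pow m * u_pow n"
  by (simp add: u_pow_def mult_single)

lemma u_pow_0 [simp]: "u_pow 0 = 1"
  by (simp add: u_pow_def)

lemma star_u_pow: "pm_conj uminus (u_pow n) = u_pow (- n)"
  by (simp add: u_pow_def)

lemma lookup_u_pow: "lookup (u_pow m) n = (if n = m then 1 else 0)"
  by (simp add: u_pow_def lookup_single when_def)

interpretation U1: pm_space O_U1 UNIV
  by standard simp_all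

lemma star_algebra_O_U1: "star_algebra O_U1"
proof -
  have "complex_algebra O_U1"
    by (rule complex_algebraI[OF U1.cvs_F])
       (simp_all add: algebra_simps pm_scale_mult pm_scale_mult_right)
  moreover have "pm_conj uminus (p * r) = pm_conj uminus r * pm_conj uminus p" for p r :: laurent
  proof -
    have "keys p \<subseteq> UNIV" "keys r \<subseteq> UNIV" by auto
    then show ?thesis
    proof (induction p rule: pm_induct_on)
      case (single k c)
      show ?case using single(2)
        by (induction r rule: pm_induct_on)
           (simp_all add: pm_conj_add algebra_simps mult_single mult.commute)
    qed (simp_all add: pm_conj_add algebra_simps)
  qed
  ultimately show ?thesis
    by (intro star_algebra.intro star_algebra_axioms.intro)
       (simp_all add: pm_conj_add pm_conj_scale pm_conj_conj[of _ UNIV])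
qed

interpretation U1: star_algebra O_U1 by (rule star_algebra_O_U1)
interpretation U1U1: star_pair O_U1 O_U1 by (intro star_pair.intro star_algebra_O_U1)

text \<open>The powers of \<open>u\<close> form a basis; all axioms of a Hopf algebra are checked on it.\<close>

lemma laurent_linear_eq:
  assumes "f \<in> linear_maps O_U1 T" "g \<in> linear_maps O_U1 T" "cvs T" "\<And>n. f (u_pow n) = g (u_pow n)"
  shows "f p = g p"
proof -
  have "keys p \<subseteq> UNIV" by simp
  then show ?thesis
  proof (induction p rule: pm_induct_on)
    case zero
    then show ?case
      using linear_maps_zero[OF assms(1) U1.cvs_F assms(3)] linear_maps_zero[OF assms(2) U1.cvs_F assms(3)] by simp
  next
    case (single n c)
    have "single n c = pm_scale c (u_pow n)" by (simp add: u_pow_def)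
    then show ?case
      using linear_maps_smult[OF assms(1), of "u_pow n" c] linear_maps_smult[OF assms(2), of "u_pow n" c]
      by (simp add: assms(4))
  next
    case (add p r)
    then show ?case
      using linear_maps_add[OF assms(1), of p r] linear_maps_add[OF assms(2), of p r] by simp
  qed
qed

lemma comult_linear: "comult O_U1 \<in> linear_maps O_U1 (tensor O_U1 O_U1)"
  unfolding comult_O_U1 by (rule U1.lin_ext_linear[OF U1U1.cvs_tensor]) simp

lemma comult_u_pow: "comult O_U1 (u_pow n) = pure O_U1 O_U1 (u_pow n) (u_pow n)"
  unfolding comult_O_U1 by (subst (2) u_pow_def) (simp add: U1U1.tensor.lin_ext_single)

lemma counit_linear: "counit O_U1 \<in> linear_maps O_U1 complex_alg"
proof (rule linear_mapsI)
  show "counit O_U1 (p \<oplus>\<^bsub>O_U1\<^esub> r) = counit O_U1 p \<oplus>\<^bsub>complex_alg\<^esub> counit O_U1 r" for p r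
    unfolding counit_O_U1 O_U1_simps complex_alg_simps by (rule setsum_keys_plus_distrib) simp_all
  show "counit O_U1 (c \<odot>\<^bsub>O_U1\<^esub> p) = c \<odot>\<^bsub>complex_alg\<^esub> counit O_U1 p" for c p
    by (cases "c = 0") (simp_all add: counit_O_U1 keys_pm_scale_eq sum_distrib_left)
qed simp

lemma counit_u_pow: "counit O_U1 (u_pow n) = 1"
  by (simp add: counit_O_U1 u_pow_def)

lemma antipode_linear: "antipode O_U1 \<in> linear_maps O_U1 O_U1"
proof (rule linear_mapsI)
  show "antipode O_U1 (p \<oplus>\<^bsub>O_U1\<^esub> r) = antipode O_U1 p \<oplus>\<^bsub>O_U1\<^esub> antipode O_U1 r" for p r
    unfolding antipode_O_U1 O_U1_simps by (rule setsum_keys_plus_distrib) (simp_all add: single_add)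
  show "antipode O_U1 (c \<odot>\<^bsub>O_U1\<^esub> p) = c \<odot>\<^bsub>O_U1\<^esub> antipode O_U1 p" for c p
    by (cases "c = 0") (simp_all add: antipode_O_U1 keys_pm_scale_eq pm_scale_sum)
qed simp

lemma antipode_u_pow: "antipode O_U1 (u_pow n) = u_pow (- n)"
  by (simp add: antipode_O_U1 u_pow_def)

lemma cvs_complex_alg: "cvs complex_alg"
  by (rule cvsI) (simp_all add: algebra_simps)

lemma smult_fixed_linear: "cvs V \<Longrightarrow> v \<in> carrier V \<Longrightarrow> f \<in> linear_maps A complex_alg \<Longrightarrow> (\<lambda>x. f x \<odot>\<^bsub>V\<^esub> v) \<in> linear_maps A V"
  using bilinear_left[OF bilinear_smult'[of V f A]] by blast

lemma laurent_bilinear_eq: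
  assumes "bilinear O_U1 O_U1 T f" "bilinear O_U1 O_U1 T g" "cvs T"
    and "\<And>m n. f (u_pow m) (u_pow n) = g (u_pow m) (u_pow n)"
  shows "f p r = g p r"
proof (rule laurent_linear_eq[OF bilinear_left[OF assms(1)] bilinear_left[OF assms(2)] assms(3)])
  show "f (u_pow n) r = g (u_pow n) r" for n
    by (rule laurent_linear_eq[OF bilinear_right[OF assms(1)] bilinear_right[OF assms(2)] assms(3)])
       (simp_all add: assms(4))
qed simp_all

lemma antipode_bij_O_U1: "bij_betw (antipode O_U1) (carrier O_U1) (carrier O_U1)"
proof -
  have "antipode O_U1 (antipode O_U1 p) = p" for p
    by (rule laurent_linear_eq[OF linear_maps_comp[OF antipode_linear antipode_linear] linear_maps_id U1.cvs_F])
       (simp add: antipode_u_pow)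
  then show ?thesis
    by (intro bij_betwI[of _ _ _ "antipode O_U1"]) auto
qed

lemma hopf_algebra_O_U1: "hopf_algebra O_U1"
proof (intro hopf_algebra.intro hopf_algebra_axioms.intro star_algebra_O_U1)
  note H = U1.complex_algebra_axioms and HH = U1U1.complex_algebra_tensor
  interpret HH_H: alg_pair "tensor O_U1 O_U1" O_U1 by (intro alg_pair.intro H HH)
  interpret H_HH: alg_pair O_U1 "tensor O_U1 O_U1" by (intro alg_pair.intro H HH)
  have c [simp]: "p \<in> carrier O_U1" for p by simp
  have id: "id \<in> linear_maps O_U1 O_U1" unfolding id_def by (rule linear_maps_id)
  show "comult O_U1 \<in> alg_hom O_U1 (tensor O_U1 O_U1)"
  proof (rule ring_homI_alg[OF comult_linear])
    show "comult O_U1 (p \<otimes>\<^bsub>O_U1\<^esub> r) = comult O_U1 p \<otimes>\<^bsub>tensor O_U1 O_U1\<^esub> comult O_U1 r" for p r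
      by (rule laurent_bilinear_eq[OF bilinear_post[OF U1.mult_bilinear comult_linear]
            bilinear_pre[OF U1U1.tensor.mult_bilinear comult_linear comult_linear] U1U1.cvs_tensor])
         (simp add: comult_u_pow U1U1.pure_mult flip: u_pow_add)
    show "comult O_U1 \<one>\<^bsub>O_U1\<^esub> = \<one>\<^bsub>tensor O_U1 O_U1\<^esub>"
      using comult_u_pow[of 0] by (simp add: U1U1.one_tensor)
  qed
  show "counit O_U1 \<in> alg_hom O_U1 complex_alg"
  proof (rule ring_homI_alg[OF counit_linear])
    have "complex_algebra complex_alg"
      by (rule complex_algebraI[OF cvs_complex_alg]) (simp_all add: algebra_simps)
    then interpret C: complex_algebra complex_alg .
    show "counit O_U1 (p \<otimes>\<^bsub>O_U1\<^esub> r) = counit O_U1 p \<otimes>\<^bsub>complex_alg\<^esub> counit O_U1 r" for p r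
      by (rule laurent_bilinear_eq[OF bilinear_post[OF U1.mult_bilinear counit_linear]
            bilinear_pre[OF C.mult_bilinear counit_linear counit_linear] cvs_complex_alg])
         (simp add: counit_u_pow flip: u_pow_add)
    show "counit O_U1 \<one>\<^bsub>O_U1\<^esub> = \<one>\<^bsub>complex_alg\<^esub>"
      using counit_u_pow[of 0] by simp
  qed
  show "antipode O_U1 \<in> linear_maps O_U1 O_U1" by (rule antipode_linear)
  show "tensor_assoc O_U1 O_U1 O_U1 (tensor_map (tensor O_U1 O_U1) O_U1 (comult O_U1) id (comult O_U1 h)) =
      tensor_map O_U1 (tensor O_U1 O_U1) id (comult O_U1) (comult O_U1 h)" for h
    by (rule laurent_linear_eq[OF linear_maps_comp[OF linear_maps_comp[OF comult_linear
            tensor_map_linear[OF H H HH H comult_linear id]] tensor_assoc_linear[OF H H H]]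
          linear_maps_comp[OF comult_linear tensor_map_linear[OF H H H HH id comult_linear]]
          H_HH.cvs_tensor])
       (simp add: comult_u_pow tensor_map_pure[OF H H HH H comult_linear id]
          tensor_map_pure[OF H H H HH id comult_linear] tensor_assoc_pure[OF H H H])
  note el = bilinear_smult'[OF U1.cvs_F counit_linear] and er = bilinear_smult[OF U1.cvs_F counit_linear]
  show "tensor_lift O_U1 (\<lambda>h' h''. counit O_U1 h' \<odot>\<^bsub>O_U1\<^esub> h'') (comult O_U1 h) = h" for h
    by (rule laurent_linear_eq[OF linear_maps_comp[OF comult_linear U1U1.tensor_lift_linear[OF el U1.cvs_F]]
          linear_maps_id U1.cvs_F])
       (simp only: comult_u_pow U1U1.tensor_lift_pure[OF el U1.cvs_F c c], simp add: counit_u_pow)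
  show "tensor_lift O_U1 (\<lambda>h' h''. counit O_U1 h'' \<odot>\<^bsub>O_U1\<^esub> h') (comult O_U1 h) = h" for h
    by (rule laurent_linear_eq[OF linear_maps_comp[OF comult_linear U1U1.tensor_lift_linear[OF er U1.cvs_F]]
          linear_maps_id U1.cvs_F])
       (simp only: comult_u_pow U1U1.tensor_lift_pure[OF er U1.cvs_F c c], simp add: counit_u_pow)
  note sl = bilinear_pre[OF U1.mult_bilinear antipode_linear linear_maps_id]
    and sr = bilinear_pre[OF U1.mult_bilinear linear_maps_id antipode_linear]
  note e1 = smult_fixed_linear[OF U1.cvs_F _ counit_linear, of "\<one>\<^bsub>O_U1\<^esub>", OF c]
  show "tensor_lift O_U1 (\<lambda>h' h''. antipode O_U1 h' \<otimes>\<^bsub>O_U1\<^esub> h'') (comult O_U1 h) =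
      counit O_U1 h \<odot>\<^bsub>O_U1\<^esub> \<one>\<^bsub>O_U1\<^esub>" for h
    by (rule laurent_linear_eq[OF linear_maps_comp[OF comult_linear U1U1.tensor_lift_linear[OF sl U1.cvs_F]]
          e1 U1.cvs_F])
       (simp only: comult_u_pow U1U1.tensor_lift_pure[OF sl U1.cvs_F c c],
        simp add: counit_u_pow antipode_u_pow flip: u_pow_add)
  show "tensor_lift O_U1 (\<lambda>h' h''. h' \<otimes>\<^bsub>O_U1\<^esub> antipode O_U1 h'') (comult O_U1 h) =
      counit O_U1 h \<odot>\<^bsub>O_U1\<^esub> \<one>\<^bsub>O_U1\<^esub>" for h
    by (rule laurent_linear_eq[OF linear_maps_comp[OF comult_linear U1U1.tensor_lift_linear[OF sr U1.cvs_F]]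
          e1 U1.cvs_F])
       (simp only: comult_u_pow U1U1.tensor_lift_pure[OF sr U1.cvs_F c c],
        simp add: counit_u_pow antipode_u_pow flip: u_pow_add)
qed


section \<open>Graded algebras as comodule algebras\<close>

text \<open>A coaction of the circle group is a grading by the integers: the elements of degree \<open>n\<close> are
  those with \<open>\<rho> v = v \<otimes> u\<^sup>n\<close>.\<close>

definition homog :: "('a, 'm) star_alg_scheme \<Rightarrow> ('a \<Rightarrow> ('a, laurent) tens) \<Rightarrow> int \<Rightarrow> 'a set" where
  "homog A \<rho> n = {a \<in> carrier A. \<rho> a = pure A O_U1 a (u_pow n)}"

inductive_set homog_sums :: "('a, 'm) star_alg_scheme \<Rightarrow> ('a \<Rightarrow> ('a, laurent) tens) \<Rightarrow> 'a set"
  for A :: "('a, 'm) star_alg_scheme" and \<rho> where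
  zero: "\<zero>\<^bsub>A\<^esub> \<in> homog_sums A \<rho>"
| add: "a \<in> homog A \<rho> n \<Longrightarrow> x \<in> homog_sums A \<rho> \<Longrightarrow> a \<oplus>\<^bsub>A\<^esub> x \<in> homog_sums A \<rho>"

locale graded_algebra = star_algebra A
  for A :: "('a, 'm) star_alg_scheme" (structure) +
  fixes \<rho> :: "'a \<Rightarrow> ('a, laurent) tens"
  assumes \<rho>_star_hom: "\<rho> \<in> star_alg_hom A (tensor A O_U1)"
    and spanned: "carrier A \<subseteq> homog_sums A \<rho>"
begin

abbreviation "H n \<equiv> homog A \<rho> n"
abbreviation "T \<equiv> tensor A O_U1"
abbreviation "B \<equiv> coinv_alg O_U1 A \<rho>"

sublocale AH: star_pair A O_U1
  by (intro star_pair.intro star_algebra_axioms star_algebra_O_U1)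
sublocale AA: star_pair A A
  by (intro star_pair.intro star_algebra_axioms)

lemma \<rho>_hom: "\<rho> \<in> alg_hom A T"
  using \<rho>_star_hom by (simp add: star_alg_hom_def)

lemma \<rho>_linear: "\<rho> \<in> linear_maps A T"
  by (rule alg_hom_linear[OF \<rho>_hom])

lemma homog_closed: "a \<in> H n \<Longrightarrow> a \<in> carrier A"
  by (simp add: homog_def)

lemma \<rho>_homog: "a \<in> H n \<Longrightarrow> \<rho> a = pure A O_U1 a (u_pow n)"
  by (simp add: homog_def)

lemma homog_zero: "\<zero> \<in> H n"
  using AH.pure_sm_l[of \<zero> "u_pow n" 0] linear_maps_zero[OF \<rho>_linear cvs_axioms AH.cvs_tensor]
    AH.pure_closed[of \<zero> "u_pow n"]
  by (simp add: homog_def AH.tensor.sm_0)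

lemma homog_add: "a \<in> H n \<Longrightarrow> b \<in> H n \<Longrightarrow> a \<oplus> b \<in> H n"
  by (simp add: homog_def linear_maps_add[OF \<rho>_linear] AH.pure_add_l)

lemma homog_smult: "a \<in> H n \<Longrightarrow> c \<odot> a \<in> H n"
  by (simp add: homog_def linear_maps_smult[OF \<rho>_linear] AH.pure_sm_l)

lemma homog_mult: "a \<in> H m \<Longrightarrow> b \<in> H n \<Longrightarrow> a \<otimes> b \<in> H (m + n)"
  by (simp add: homog_def alg_hom_mult[OF \<rho>_hom] AH.pure_mult u_pow_add)

lemma homog_mult': "a \<in> H m \<Longrightarrow> b \<in> H n \<Longrightarrow> k = m + n \<Longrightarrow> a \<otimes> b \<in> H k"
  using homog_mult by simp

lemma homog_one: "\<one> \<in> H 0"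
  by (simp add: homog_def alg_hom_one[OF \<rho>_hom] AH.one_tensor)

lemma homog_star: "a \<in> H n \<Longrightarrow> star A a \<in> H (- n)"
  using \<rho>_star_hom by (simp add: homog_def star_alg_hom_def star_closed AH.pure_star star_u_pow)

lemma homog_induct [consumes 1, case_names zero homog add]:
  assumes "x \<in> carrier A" "Q \<zero>" "\<And>n a. a \<in> H n \<Longrightarrow> Q a"
    and "\<And>x y. x \<in> carrier A \<Longrightarrow> y \<in> carrier A \<Longrightarrow> Q x \<Longrightarrow> Q y \<Longrightarrow> Q (x \<oplus> y)"
  shows "Q x"
proof -
  from assms(1) spanned have "x \<in> homog_sums A \<rho>" by auto
  then have "Q x \<and> x \<in> carrier A"
  proof induction
    case (add a n x)
    then show ?case using assms(3)[OF add(1)] assms(4)[of a x] homog_closed[OF add(1)] by simp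
  qed (simp add: assms(2))
  then show ?thesis ..
qed

lemma linear_eq_on_homog:
  assumes "f \<in> linear_maps A V" "g \<in> linear_maps A V" "cvs V" "\<And>n a. a \<in> H n \<Longrightarrow> f a = g a"
    and "x \<in> carrier A"
  shows "f x = g x"
  using assms(5)
  by (induction rule: homog_induct)
     (simp_all add: assms(4) linear_maps_zero[OF assms(1) cvs_axioms assms(3)]
        linear_maps_zero[OF assms(2) cvs_axioms assms(3)]
        linear_maps_add[OF assms(1)] linear_maps_add[OF assms(2)])

lemma id_linear: "id \<in> linear_maps A A" "id \<in> linear_maps O_U1 O_U1"
  unfolding id_def by (rule linear_maps_id)+

text \<open>Both comodule axioms are identities between linear maps, and they are evident on homogeneous
  elements.\<close>

lemma comodule_algebra: "comodule_algebra O_U1 A \<rho>"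
proof (intro comodule_algebra.intro comodule_algebra_axioms.intro hopf_algebra_O_U1 star_algebra_axioms \<rho>_hom)
  note ca = complex_algebra_axioms U1.complex_algebra_axioms AH.complex_algebra_tensor U1U1.complex_algebra_tensor
  interpret A_HH: alg_pair A "tensor O_U1 O_U1" by (intro alg_pair.intro ca)
  note m1 = tensor_map_linear[OF ca(1,2,3,2) \<rho>_linear id_linear(2)]
    tensor_map_pure[OF ca(1,2,3,2) \<rho>_linear id_linear(2)]
  note m2 = tensor_map_linear[OF ca(1,2,1,4) id_linear(1) comult_linear]
    tensor_map_pure[OF ca(1,2,1,4) id_linear(1) comult_linear]
  note as = tensor_assoc_linear[OF ca(1,2,2)] tensor_assoc_pure[OF ca(1,2,2)]
  show "tensor_assoc A O_U1 O_U1 (tensor_map (tensor A O_U1) O_U1 \<rho> id (\<rho> a)) =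
      tensor_map A (tensor O_U1 O_U1) id (comult O_U1) (\<rho> a)" if "a \<in> carrier A" for a
    by (rule linear_eq_on_homog[OF linear_maps_comp[OF linear_maps_comp[OF \<rho>_linear m1(1)] as(1)]
          linear_maps_comp[OF \<rho>_linear m2(1)] A_HH.cvs_tensor _ that])
       (simp add: \<rho>_homog homog_closed m1(2) m2(2) as(2) comult_u_pow)
  note er = bilinear_smult[OF cvs_axioms counit_linear]
  show "tensor_lift A (\<lambda>a' h. counit O_U1 h \<odot> a') (\<rho> a) = a" if "a \<in> carrier A" for a
    by (rule linear_eq_on_homog[OF linear_maps_comp[OF \<rho>_linear AH.tensor_lift_linear[OF er cvs_axioms]]
          linear_maps_id cvs_axioms _ that])
       (simp add: \<rho>_homog homog_closed AH.tensor_lift_pure[OF er cvs_axioms] counit_u_pow)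
qed


subsection \<open>Homogeneous components\<close>

text \<open>The homogeneous component of degree \<open>n\<close>: the coefficient of \<open>u\<^sup>n\<close> in \<open>\<rho> x\<close>.\<close>

definition proj :: "int \<Rightarrow> 'a \<Rightarrow> 'a" where
  "proj n x = tensor_lift A (\<lambda>a h. lookup h n \<odot> a) (\<rho> x)"

lemma lookup_linear: "(\<lambda>h. lookup h n) \<in> linear_maps O_U1 complex_alg"
  by (rule linear_mapsI) (simp_all add: lookup_add)

lemma proj_linear: "proj n \<in> linear_maps A A"
  using linear_maps_comp[OF \<rho>_linear AH.tensor_lift_linear[OF bilinear_smult[OF cvs_axioms lookup_linear] cvs_axioms]]
  by (simp add: proj_def[abs_def])

lemma proj_on_homog:
  assumes "a \<in> H m"
  shows "proj n a = (if n = m then a else \<zero>)"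
  using assms unfolding proj_def \<rho>_homog[OF assms]
  by (subst AH.tensor_lift_pure[OF bilinear_smult[OF cvs_axioms lookup_linear] cvs_axioms])
     (auto simp: lookup_u_pow homog_closed)

lemma proj_homog:
  assumes "x \<in> carrier A"
  shows "proj n x \<in> H n"
  using assms
  by (induction rule: homog_induct)
     (auto simp: linear_maps_zero[OF proj_linear cvs_axioms cvs_axioms] homog_zero proj_on_homog
        linear_maps_add[OF proj_linear] homog_add)


subsection \<open>The coinvariant subalgebra\<close>

lemma coinv_simps [simp]:
  "carrier B = H 0" "monoid.mult B = monoid.mult A" "\<one>\<^bsub>B\<^esub> = \<one>" "\<zero>\<^bsub>B\<^esub> = \<zero>"
  "ring.add B = ring.add A" "module.smult B = module.smult A" "star B = star A"
  by (simp_all add: coinv_alg_def homog_def)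

lemma complex_algebra_coinv: "complex_algebra B"
proof (rule complex_algebraI)
  show "cvs B"
  proof (rule cvsI; unfold coinv_simps)
    show "(- 1) \<odot> x \<oplus> x = \<zero>" if "x \<in> H 0" for x
      using homog_closed[OF that] by (simp add: sm_m1 M.l_neg)
  qed (simp_all add: homog_zero homog_add homog_smult homog_closed M.a_ac sm_add_l sm_add_r sm_sm)
qed (use homog_mult[of _ 0 _ 0] in \<open>auto simp: homog_one homog_closed m_assoc l_distr r_distr
      smult_mult_left smult_mult_right\<close>)

sublocale B: complex_algebra B by (rule complex_algebra_coinv)
sublocale BA: alg_pair B A by (intro alg_pair.intro complex_algebra_coinv complex_algebra_axioms)

lemma coinv_inclusion: "id \<in> linear_maps B A"
  by (intro linear_mapsI) (simp_all add: homog_closed)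

lemma proj_coinv: "proj 0 \<in> linear_maps A B"
  using proj_linear by (intro linear_mapsI) (simp_all add: proj_homog linear_maps_add linear_maps_smult)

end

text \<open>The product \<open>A\<^sub>-\<^sub>n A\<^sub>n\<close> of two homogeneous components. The grading is strong if it contains \<open>1\<close>
  for all \<open>n\<close>.\<close>

inductive_set degree_products ::
    "('a, 'm) star_alg_scheme \<Rightarrow> ('a \<Rightarrow> ('a, laurent) tens) \<Rightarrow> int \<Rightarrow> 'a set"
  for A :: "('a, 'm) star_alg_scheme" and \<rho> n where
  zero: "\<zero>\<^bsub>A\<^esub> \<in> degree_products A \<rho> n"
| add: "\<nu> \<in> homog A \<rho> (- n) \<Longrightarrow> \<omega> \<in> homog A \<rho> n \<Longrightarrow> x \<in> degree_products A \<rho> n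
    \<Longrightarrow> \<nu> \<otimes>\<^bsub>A\<^esub> \<omega> \<oplus>\<^bsub>A\<^esub> x \<in> degree_products A \<rho> n"

context graded_algebra
begin

abbreviation "DP n \<equiv> degree_products A \<rho> n"

lemma DP_closed: "x \<in> DP n \<Longrightarrow> x \<in> carrier A"
  by (induction rule: degree_products.induct) (simp_all add: homog_closed)

lemma DP_prod: "\<nu> \<in> H (- n) \<Longrightarrow> \<omega> \<in> H n \<Longrightarrow> \<nu> \<otimes> \<omega> \<in> DP n"
  using degree_products.add[OF _ _ degree_products.zero, of \<nu> A \<rho> n \<omega>] by (simp add: homog_closed)

lemma DP_add: "x \<in> DP n \<Longrightarrow> y \<in> DP n \<Longrightarrow> x \<oplus> y \<in> DP n"
proof (induction rule: degree_products.induct)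
  case zero
  then show ?case by (simp add: DP_closed)
next
  case (add \<nu> \<omega> x)
  then show ?case
    using degree_products.add[of \<nu> A \<rho> n \<omega> "x \<oplus> y"] by (simp add: homog_closed DP_closed M.a_assoc)
qed

lemma DP_smult: "x \<in> DP n \<Longrightarrow> c \<odot> x \<in> DP n"
proof (induction rule: degree_products.induct)
  case zero
  then show ?case by (simp add: degree_products.zero)
next
  case (add \<nu> \<omega> x)
  then show ?case
    using degree_products.add[OF homog_smult[of \<nu> "- n" c], of \<omega> "c \<odot> x"]
    by (simp add: homog_closed DP_closed sm_add_r smult_mult_left)
qed

text \<open>If \<open>\<nu>'\<close>, \<open>\<omega>'\<close> have degrees \<open>-m\<close>, \<open>m\<close> and \<open>\<nu>\<close>, \<open>\<omega>\<close> have degrees \<open>-n\<close>, \<open>n\<close>, then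
  \<open>\<nu> (\<nu>' \<omega>') \<omega> = (\<nu> \<nu>') (\<omega>' \<omega>)\<close>. Together with \<open>1\<close> in place of \<open>\<nu>' \<omega>'\<close> this propagates strongness
  from the degrees \<open>1\<close> and \<open>-1\<close> to all degrees.\<close>

lemma DP_sandwich:
  assumes "x \<in> DP m" "\<nu> \<in> H (- n)" "\<omega> \<in> H n"
  shows "\<nu> \<otimes> x \<otimes> \<omega> \<in> DP (m + n)"
  using assms(1)
proof (induction rule: degree_products.induct)
  case zero
  then show ?case using assms by (simp add: degree_products.zero homog_closed)
next
  case (add \<nu>' \<omega>' x)
  have "(\<nu> \<otimes> \<nu>') \<otimes> (\<omega>' \<otimes> \<omega>) \<in> DP (m + n)"
    using homog_mult[OF assms(2) add(1)] homog_mult[OF add(2) assms(3)] by (intro DP_prod) (simp_all add: algebra_simps)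
  from DP_add[OF this add.IH] show ?case
    using assms add DP_closed[OF add(3)] by (simp add: homog_closed r_distr l_distr m_assoc)
qed

lemma DP_mono:
  assumes "\<one> \<in> DP m" "x \<in> DP n"
  shows "x \<in> DP (m + n)"
  using assms(2)
proof (induction x rule: degree_products.induct)
  case zero
  then show ?case by (simp add: degree_products.zero)
next
  case (add \<nu> \<omega> x)
  then show ?case
    using DP_sandwich[OF assms(1), of \<nu> n \<omega>] by (simp add: DP_add homog_closed)
qed

end

locale strongly_graded_algebra = graded_algebra +
  assumes one_plus: "\<one> \<in> degree_products A \<rho> 1" and one_minus: "\<one> \<in> degree_products A \<rho> (- 1)"
begin

lemma one_in_DP: "\<one> \<in> DP n"
proof (induction n rule: int_induct[where k = 0])
  case base
  then show ?case using DP_prod[of \<one> 0 \<one>] homog_one by simp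
next
  case (step1 i)
  then show ?case using DP_mono[OF step1(2) one_plus] by simp
next
  case (step2 i)
  then show ?case using DP_mono[OF step2(2) one_minus] by simp
qed

text \<open>A formal sum \<open>\<Sum> \<nu>\<^sub>i \<otimes> \<omega>\<^sub>i\<close> with \<open>\<Sum> \<nu>\<^sub>i \<omega>\<^sub>i = 1\<close>: the value of a strong connection at \<open>u\<^sup>n\<close>. It is kept
  as a combination of pairs, so that it can be pushed into different tensor products.\<close>

definition conn :: "int \<Rightarrow> ('a \<times> 'a \<Rightarrow>\<^sub>0 complex)" where
  "conn n = (SOME p. keys p \<subseteq> H (- n) \<times> H n \<and> lin_ext A (\<lambda>k. fst k \<otimes> snd k) p = \<one>)"

lemma conn: "keys (conn n) \<subseteq> H (- n) \<times> H n" "lin_ext A (\<lambda>k. fst k \<otimes> snd k) (conn n) = \<one>"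
proof -
  have "\<exists>p. keys p \<subseteq> H (- n) \<times> H n \<and> lin_ext A (\<lambda>k. fst k \<otimes> snd k) p = x" if "x \<in> DP n" for x
    using that
  proof (induction rule: degree_products.induct)
    case zero
    show ?case by (rule exI[of _ 0]) simp
  next
    case (add \<nu> \<omega> x)
    then obtain p where p: "keys p \<subseteq> H (- n) \<times> H n" "lin_ext A (\<lambda>k. fst k \<otimes> snd k) p = x" by auto
    have g: "(\<lambda>k. fst k \<otimes> snd k) \<in> H (- n) \<times> H n \<rightarrow> carrier A" by (auto simp: homog_closed)
    have s: "keys (single (\<nu>, \<omega>) (1::complex)) \<subseteq> H (- n) \<times> H n" using add by simp
    have "keys (single (\<nu>, \<omega>) 1 + p) \<subseteq> H (- n) \<times> H n"
      using keys_add[of "single (\<nu>, \<omega>) 1" p] s p(1) by blast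
    moreover have "lin_ext A (\<lambda>k. fst k \<otimes> snd k) (single (\<nu>, \<omega>) 1 + p) = \<nu> \<otimes> \<omega> \<oplus> x"
      unfolding lin_ext_add[OF g s p(1)] p(2) using add by (simp add: lin_ext_single homog_closed)
    ultimately show ?case by blast
  qed
  from someI_ex[OF this[OF one_in_DP]] show "keys (conn n) \<subseteq> H (- n) \<times> H n"
      "lin_ext A (\<lambda>k. fst k \<otimes> snd k) (conn n) = \<one>"
    unfolding conn_def by blast+
qed

lemma conn_keys: "k \<in> keys (conn n) \<Longrightarrow> fst k \<in> H (- n)" "k \<in> keys (conn n) \<Longrightarrow> snd k \<in> H n"
  using conn(1)[of n] by auto

lemmas conn_closed = conn_keys[THEN homog_closed]

lemma conn_unit:
  assumes "a \<in> carrier A"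
  shows "lin_ext A (\<lambda>k. a \<otimes> (fst k \<otimes> snd k)) (conn n) = a"
  using linear_maps_lin_ext[OF mult_left_linear[OF assms] cvs_axioms cvs_axioms,
      of "\<lambda>k. fst k \<otimes> snd k" "conn n"] assms conn(2)[of n] by (simp add: conn_closed)

text \<open>The map \<open>a \<otimes> u\<^sup>n \<mapsto> \<Sum> m (a \<nu>\<^sub>i) \<omega>\<^sub>i\<close>. With \<open>m\<close> the balanced tensor product it is the inverse of
  the canonical map; with the tensor product over the complex numbers, restricted to the
  coinvariants in the first factor, it yields the splitting of the multiplication.\<close>

definition translation :: "('c, 'k) star_alg_scheme \<Rightarrow> ('a \<Rightarrow> 'a \<Rightarrow> 'c) \<Rightarrow> ('a, laurent) tens \<Rightarrow> 'c" where
  "translation V m = tensor_lift V (\<lambda>a h. lin_ext V (\<lambda>n. lin_ext V (\<lambda>k. m (a \<otimes> fst k) (snd k)) (conn n)) h)"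

lemma
  assumes V: "cvs V" and m: "bilinear A A V m"
  shows translation_linear: "translation V m \<in> linear_maps T V"
    and translation_pure: "a \<in> carrier A \<Longrightarrow>
      translation V m (pure A O_U1 a (u_pow n)) = lin_ext V (\<lambda>k. m (a \<otimes> fst k) (snd k)) (conn n)"
proof -
  interpret V: cvs V by fact
  have mc: "m (a \<otimes> fst k) (snd k) \<in> carrier V" if "k \<in> keys (conn n)" "a \<in> carrier A" for a k n
    using that by (intro bilinear_closed[OF m]) (simp_all add: conn_closed)
  let ?g = "\<lambda>n a. lin_ext V (\<lambda>k. m (a \<otimes> fst k) (snd k)) (conn n)"
  have gc: "?g n a \<in> carrier V" if "a \<in> carrier A" for a n
    using that mc by (intro V.lin_ext_closed) auto
  have lin: "(\<lambda>a. m (a \<otimes> fst k) (snd k)) \<in> linear_maps A V" if "k \<in> keys (conn n)" for k n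
    using that by (intro linear_maps_comp[OF mult_right_linear bilinear_left[OF m]]) (simp_all add: conn_closed)
  have gl: "?g n \<in> linear_maps A V" for n
  proof (rule linear_mapsI)
    show "?g n (a \<oplus> b) = ?g n a \<oplus>\<^bsub>V\<^esub> ?g n b" if "a \<in> carrier A" "b \<in> carrier A" for a b
    proof -
      have "?g n (a \<oplus> b) = lin_ext V (\<lambda>k. m (a \<otimes> fst k) (snd k) \<oplus>\<^bsub>V\<^esub> m (b \<otimes> fst k) (snd k)) (conn n)"
        by (rule V.lin_ext_cong) (simp_all only: linear_maps_add[OF lin that], use that mc in auto)
      also have "\<dots> = ?g n a \<oplus>\<^bsub>V\<^esub> ?g n b"
        using that mc by (intro V.lin_ext_fun_add) simp_all
      finally show ?thesis .
    qed
    show "?g n (c \<odot> a) = c \<odot>\<^bsub>V\<^esub> ?g n a" if "a \<in> carrier A" for a c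
    proof -
      have "?g n (c \<odot> a) = lin_ext V (\<lambda>k. c \<odot>\<^bsub>V\<^esub> m (a \<otimes> fst k) (snd k)) (conn n)"
        by (rule V.lin_ext_cong) (simp_all only: linear_maps_smult[OF lin that], use that mc in auto)
      also have "\<dots> = c \<odot>\<^bsub>V\<^esub> ?g n a"
        using that mc by (intro V.lin_ext_fun_smult) simp_all
      finally show ?thesis .
    qed
  qed (rule gc)
  have b: "bilinear A O_U1 V (\<lambda>a h. lin_ext V (\<lambda>n. ?g n a) h)"
  proof (rule bilinearI)
    show "(\<lambda>h. lin_ext V (\<lambda>n. ?g n a) h) \<in> linear_maps O_U1 V" if "a \<in> carrier A" for a
      using U1.lin_ext_linear[OF V, of "\<lambda>n. ?g n a"] gc[OF that] by simp
    show "(\<lambda>a. lin_ext V (\<lambda>n. ?g n a) h) \<in> linear_maps A V" for h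
    proof (rule linear_mapsI)
      show "lin_ext V (\<lambda>n. ?g n (a \<oplus> b)) h = lin_ext V (\<lambda>n. ?g n a) h \<oplus>\<^bsub>V\<^esub> lin_ext V (\<lambda>n. ?g n b) h"
        if "a \<in> carrier A" "b \<in> carrier A" for a b
        using that gc by (simp add: linear_maps_add[OF gl] V.lin_ext_fun_add)
      show "lin_ext V (\<lambda>n. ?g n (c \<odot> a)) h = c \<odot>\<^bsub>V\<^esub> lin_ext V (\<lambda>n. ?g n a) h" if "a \<in> carrier A" for a c
        using that gc by (simp add: linear_maps_smult[OF gl] V.lin_ext_fun_smult)
    qed (rule V.lin_ext_closed, use gc in simp)
  qed
  show "translation V m \<in> linear_maps T V"
    unfolding translation_def by (rule AH.tensor_lift_linear[OF b V])
  show "translation V m (pure A O_U1 a (u_pow n)) = ?g n a" if "a \<in> carrier A"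
    unfolding translation_def using that gc
    by (subst AH.tensor_lift_pure[OF b V]) (simp_all add: u_pow_def V.lin_ext_single)
qed


subsection \<open>The splitting of the multiplication map\<close>

text \<open>The projection is the identity on \<open>x \<nu>\<^sub>i\<close> for \<open>x\<close> of degree \<open>n\<close>; it turns
  \<open>pure\<close> into a map that is bilinear on all of \<open>A \<times> A\<close>, with coinvariants in the first factor.\<close>

definition split :: "'a \<Rightarrow> ('a, 'a) tens" where
  "split x = translation (tensor B A) (\<lambda>b a. pure B A (proj 0 b) a) (\<rho> x)"

lemma split_bilinear: "bilinear A A (tensor B A) (\<lambda>b a. pure B A (proj 0 b) a)"
  by (rule bilinear_pre[OF BA.pure_bilinear proj_coinv linear_maps_id])

lemma split_linear: "split \<in> linear_maps A (tensor B A)"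
  using linear_maps_comp[OF \<rho>_linear translation_linear[OF BA.cvs_tensor split_bilinear]]
  by (simp add: split_def[abs_def])

lemma conn_deg0: "a \<in> H n \<Longrightarrow> k \<in> keys (conn n) \<Longrightarrow> a \<otimes> fst k \<in> H 0"
  using homog_mult[OF _ conn_keys(1), of a n k n] by simp

lemma split_homog:
  assumes "a \<in> H n"
  shows "split a = lin_ext (tensor B A) (\<lambda>k. pure B A (a \<otimes> fst k) (snd k)) (conn n)"
  unfolding split_def \<rho>_homog[OF assms] translation_pure[OF BA.cvs_tensor split_bilinear homog_closed[OF assms]]
  by (rule BA.tensor.lin_ext_cong) (auto simp: proj_on_homog[OF conn_deg0[OF assms]] conn_deg0[OF assms] conn_closed)

lemma split_pure_closed:
  "a \<in> H n \<Longrightarrow> (\<lambda>k. pure B A (a \<otimes> fst k) (snd k)) \<in> keys (conn n) \<rightarrow> carrier (tensor B A)"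
  by (auto simp: conn_deg0 conn_closed)

text \<open>All conditions are linear in the argument, so it may be taken of degree \<open>n\<close>. The splitting
  property is \<open>\<Sum> a \<nu>\<^sub>i \<omega>\<^sub>i = a\<close>; multiplication by a coinvariant from the left preserves the degree;
  colinearity holds because all \<open>\<omega>\<^sub>i\<close> have the degree of \<open>a\<close>.\<close>

lemma mult_splitting: "mult_splitting O_U1 A \<rho> split"
proof -
  note cB = complex_algebra_coinv and cA = complex_algebra_axioms and cH = U1.complex_algebra_axioms
    and cT = AH.complex_algebra_tensor and cBA = BA.complex_algebra_tensor
  have bm: "bilinear B A A (\<lambda>b a. b \<otimes> a)"
    using bilinear_pre[OF mult_bilinear coinv_inclusion linear_maps_id] by simp
  note mu = BA.tensor_lift_linear[OF bm cvs_axioms] BA.tensor_lift_pure[OF bm cvs_axioms]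
  have 1: "tensor_lift A (\<lambda>b a'. b \<otimes> a') (split a) = a" if "a \<in> carrier A" for a
  proof (rule linear_eq_on_homog[OF linear_maps_comp[OF split_linear mu(1)] linear_maps_id cvs_axioms _ that])
    fix n a assume a: "a \<in> H n"
    have "tensor_lift A (\<lambda>b a'. b \<otimes> a') (split a) = lin_ext A (\<lambda>k. a \<otimes> (fst k \<otimes> snd k)) (conn n)"
      unfolding split_homog[OF a] linear_maps_lin_ext[OF mu(1) BA.cvs_tensor cvs_axioms split_pure_closed[OF a]]
      using a by (intro lin_ext_cong) (auto simp: mu(2) conn_deg0 conn_closed homog_closed m_assoc)
    then show "tensor_lift A (\<lambda>b a'. b \<otimes> a') (split a) = a" by (simp add: conn_unit homog_closed[OF a])
  qed
  have 2: "split (b \<otimes> a) = pure B A b \<one> \<otimes>\<^bsub>tensor B A\<^esub> split a" if b: "b \<in> H 0" and a: "a \<in> carrier A" for a b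
  proof (rule linear_eq_on_homog[OF linear_maps_comp[OF mult_left_linear split_linear]
        linear_maps_comp[OF split_linear BA.tensor.mult_left_linear] BA.cvs_tensor _ a])
    show "b \<in> carrier A" using b by (rule homog_closed)
    show b1: "pure B A b \<one> \<in> carrier (tensor B A)" using b by (intro BA.pure_closed) simp_all
    fix n a assume a: "a \<in> H n"
    have ba: "b \<otimes> a \<in> H n" using homog_mult[OF b a] by simp
    show "split (b \<otimes> a) = pure B A b \<one> \<otimes>\<^bsub>tensor B A\<^esub> split a"
      unfolding split_homog[OF a] split_homog[OF ba]
        linear_maps_lin_ext[OF BA.tensor.mult_left_linear[OF b1] BA.cvs_tensor BA.cvs_tensor split_pure_closed[OF a]]
      using a b by (intro BA.tensor.lin_ext_cong)
        (auto simp: BA.pure_mult conn_deg0 conn_closed homog_closed m_assoc homog_mult'[OF b conn_deg0])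
  qed
  note m1 = tensor_map_linear[OF cB cA cB cT _ \<rho>_linear, of id] tensor_map_pure[OF cB cA cB cT _ \<rho>_linear, of id]
  have idB: "id \<in> linear_maps B B" unfolding id_def by (rule linear_maps_id)
  note m2 = tensor_map_linear[OF cA cH cBA cH split_linear id_linear(2)]
    tensor_map_pure[OF cA cH cBA cH split_linear id_linear(2)]
  note as = tensor_assoc_linear[OF cB cA cH] tensor_assoc_pure[OF cB cA cH]
  interpret B_T: alg_pair B T by (intro alg_pair.intro cB cT)
  interpret BA_H: alg_pair "tensor B A" O_U1 by (intro alg_pair.intro cBA cH)
  have 3: "tensor_map B T id \<rho> (split a) = tensor_assoc B A O_U1 (tensor_map (tensor B A) O_U1 split id (\<rho> a))"
    if "a \<in> carrier A" for a
  proof (rule linear_eq_on_homog[OF linear_maps_comp[OF split_linear m1(1)[OF idB]]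
        linear_maps_comp[OF linear_maps_comp[OF \<rho>_linear m2(1)] as(1)] B_T.cvs_tensor _ that])
    fix n a assume a: "a \<in> H n"
    have u: "u_pow n \<in> carrier O_U1" by simp
    have "tensor_map B T id \<rho> (split a) =
        lin_ext (tensor B T) (\<lambda>k. pure B T (a \<otimes> fst k) (pure A O_U1 (snd k) (u_pow n))) (conn n)"
      unfolding split_homog[OF a] linear_maps_lin_ext[OF m1(1)[OF idB] BA.cvs_tensor B_T.cvs_tensor split_pure_closed[OF a]]
      using a by (intro B_T.tensor.lin_ext_cong)
        (auto simp: m1(2)[OF idB] conn_deg0 conn_closed \<rho>_homog[OF conn_keys(2)])
    also have "\<dots> = tensor_assoc B A O_U1 (pure (tensor B A) O_U1 (split a) (u_pow n))"
      unfolding split_homog[OF a]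
        linear_maps_lin_ext[OF linear_maps_comp[OF bilinear_left[OF BA_H.pure_bilinear u] as(1)]
          BA.cvs_tensor B_T.cvs_tensor split_pure_closed[OF a]]
      using a by (intro B_T.tensor.lin_ext_cong[symmetric]) (auto simp: as(2) conn_deg0 conn_closed)
    also have "\<dots> = tensor_assoc B A O_U1 (tensor_map (tensor B A) O_U1 split id (\<rho> a))"
      using a by (simp add: \<rho>_homog m2(2) homog_closed)
    finally show "tensor_map B T id \<rho> (split a) = tensor_assoc B A O_U1 (tensor_map (tensor B A) O_U1 split id (\<rho> a))" .
  qed
  show ?thesis
    unfolding mult_splitting_def Let_def using split_linear 1 2 3 by simp
qed

end


subsection \<open>Bijectivity of the canonical map\<close>

context graded_algebra
begin

abbreviation "Bal \<equiv> pm_span (bilinear_rels A A \<union> balanced_rels B A)"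
abbreviation "M \<equiv> quot_alg (pair_alg A A) Bal"

lemma balanced_rels_sub: "balanced_rels B A \<subseteq> carrier (pair_alg A A)"
proof -
  have s: "k \<in> carrier A \<times> carrier A \<Longrightarrow> single k c \<in> carrier (pair_alg A A)" for k c
    by (rule AA.P.F_closed)
  show ?thesis
    unfolding balanced_rels_def
    by (clarsimp simp del: AA.P_simps(1)) (intro AA.P.F_closed(3) s SigmaI; simp add: homog_closed)
qed

sublocale bal: pm_subspace "pair_alg A A" "carrier A \<times> carrier A" Bal
  by (rule AA.P.pm_subspace_span) (use AA.bilinear_rels_sub balanced_rels_sub in blast)

text \<open>The class of \<open>a \<otimes> a'\<close> in the tensor product over the coinvariants.\<close>

definition bal :: "'a \<Rightarrow> 'a \<Rightarrow> ('a, 'a) tens" where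
  "bal a a' = bal.coset (single (a, a') 1)"

lemma bal_closed: "a \<in> carrier A \<Longrightarrow> a' \<in> carrier A \<Longrightarrow> bal a a' \<in> carrier M"
  unfolding bal_def by (intro bal.coset_in AA.P.F_closed(5)) simp

lemma bal_bilinear: "bilinear A A M bal"
proof -
  have i: "r \<in> Bal" if "r \<in> bilinear_rels A A" for r
    using that by (intro pm.span_base) blast
  show ?thesis
  proof (intro bilinearI linear_mapsI)
    fix a a' b assume "a \<in> carrier A" "a' \<in> carrier A" "b \<in> carrier A"
    note ab = this
    show "bal (a \<oplus> a') b = bal a b \<oplus>\<^bsub>M\<^esub> bal a' b"
      using i[OF AA.rel_add_l[OF ab]] unfolding bal_def bal.quot_add bal.coset_eq diff_diff_eq .
    show "bal a (a' \<oplus> b) = bal a a' \<oplus>\<^bsub>M\<^esub> bal a b"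
      using i[OF AA.rel_add_r[OF ab]] unfolding bal_def bal.quot_add bal.coset_eq diff_diff_eq .
  next
    fix a b c assume "a \<in> carrier A" "b \<in> carrier A"
    note ab = this
    show "bal (c \<odot> a) b = c \<odot>\<^bsub>M\<^esub> bal a b"
      using i[OF AA.rel_sm_l[OF ab]] unfolding bal_def bal.quot_smult bal.coset_eq pm_scale_single mult_1_right .
    show "bal a (c \<odot> b) = c \<odot>\<^bsub>M\<^esub> bal a b"
      using i[OF AA.rel_sm_r[OF ab]] unfolding bal_def bal.quot_smult bal.coset_eq pm_scale_single mult_1_right .
  qed (simp_all add: bal_closed)
qed

lemma bal_balanced:
  assumes "a \<in> carrier A" "b \<in> H 0" "a' \<in> carrier A"
  shows "bal (a \<otimes> b) a' = bal a (b \<otimes> a')"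
proof -
  have "single (a \<otimes> b, a') 1 - single (a, b \<otimes> a') 1 \<in> balanced_rels B A"
    unfolding balanced_rels_def using assms by auto
  then show ?thesis
    unfolding bal_def bal.coset_eq by (intro pm.span_base) blast
qed

lemma bal_induct [consumes 1, case_names zero bal add]:
  assumes "t \<in> carrier M" and "Q \<zero>\<^bsub>M\<^esub>"
    and "\<And>a a'. a \<in> carrier A \<Longrightarrow> a' \<in> carrier A \<Longrightarrow> Q (bal a a')"
    and "\<And>t t'. t \<in> carrier M \<Longrightarrow> t' \<in> carrier M \<Longrightarrow> Q t \<Longrightarrow> Q t' \<Longrightarrow> Q (t \<oplus>\<^bsub>M\<^esub> t')"
  shows "Q t"
proof -
  obtain p where p: "p \<in> carrier (pair_alg A A)" "t = bal.coset p"
    using assms(1) by (rule bal.coset_cases)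
  from p(1) have "keys p \<subseteq> carrier A \<times> carrier A" by simp
  then have "Q (bal.coset p)"
  proof (induction p rule: pm_induct_on)
    case zero
    then show ?case using assms(2) by (simp add: bal.quot_zero bal.coset_0)
  next
    case (single k c)
    obtain a a' where k: "k = (a, a')" "a \<in> carrier A" "a' \<in> carrier A" using single by auto
    have "bal.coset (single k c) = c \<odot>\<^bsub>M\<^esub> bal a a'"
      by (simp add: k bal_def bal.quot_smult)
    also have "\<dots> = bal (c \<odot> a) a'"
      using linear_maps_smult[OF bilinear_left[OF bal_bilinear k(3)] k(2)] by simp
    finally show ?case using assms(3) k by simp
  next
    case (add p r)
    then show ?case
      using assms(4)[of "bal.coset p" "bal.coset r"] bal.coset_in by (simp add: bal.quot_add)
  qed
  with p show ?thesis by simp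
qed

lemma balanced_tensors_carrier: "balanced_tensors B A = carrier M"
  by (simp add: balanced_tensors_def quot_alg_def FactRing_def)

lemma can_bilinear: "bilinear A A T (\<lambda>a a'. pure A O_U1 a \<one>\<^bsub>O_U1\<^esub> \<otimes>\<^bsub>T\<^esub> \<rho> a')"
proof -
  have "\<one>\<^bsub>O_U1\<^esub> \<in> carrier O_U1" by simp
  from bilinear_pre[OF AH.tensor.mult_bilinear bilinear_left[OF AH.pure_bilinear this] \<rho>_linear]
  show ?thesis .
qed

text \<open>The canonical map is well defined on the balanced tensor product because \<open>\<rho> (b a') = (b \<otimes> 1) \<rho> a'\<close>
  for coinvariant \<open>b\<close>.\<close>

lemma canonical_linear: "canonical_map O_U1 A \<rho> \<in> linear_maps M T"
  and canonical_bal: "a \<in> carrier A \<Longrightarrow> a' \<in> carrier A \<Longrightarrow>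
    canonical_map O_U1 A \<rho> (bal a a') = pure A O_U1 a \<one>\<^bsub>O_U1\<^esub> \<otimes>\<^bsub>T\<^esub> \<rho> a'"
proof -
  let ?f = "\<lambda>a a'. pure A O_U1 a \<one>\<^bsub>O_U1\<^esub> \<otimes>\<^bsub>T\<^esub> \<rho> a'"
  let ?g = "\<lambda>k. ?f (fst k) (snd k)"
  have fT: "?f a a' \<in> carrier T" if "a \<in> carrier A" "a' \<in> carrier A" for a a'
    by (rule bilinear_closed[OF can_bilinear that])
  have L: "lin_ext T ?g \<in> linear_maps (pair_alg A A) T"
    by (rule AA.P.lin_ext_linear[OF AH.cvs_tensor], rule fT) auto
  have sg: "lin_ext T ?g (single (a, a') 1) = ?f a a'"
    if "a \<in> carrier A" "a' \<in> carrier A" for a a'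
    using fT[OF that] by (subst AH.tensor.lin_ext_single) simp_all
  have v1: "lin_ext T ?g r = \<zero>\<^bsub>T\<^esub>" if r: "r \<in> balanced_rels B A" for r
  proof -
    obtain a b a' where *: "r = single (a \<otimes> b, a') 1 - single (a, b \<otimes> a') 1"
      "a \<in> carrier A" "b \<in> H 0" "a' \<in> carrier A"
      using r unfolding balanced_rels_def by auto
    have b: "b \<in> carrier A" using *(3) by (rule homog_closed)
    have c: "single (a \<otimes> b, a') 1 \<in> carrier (pair_alg A A)"
        "single (a, b \<otimes> a') 1 \<in> carrier (pair_alg A A)"
      using * b by (auto intro!: AA.P.F_closed(5) simp del: AA.P_simps(1))
    have "?f (a \<otimes> b) a' = ?f a (b \<otimes> a')"
      using * b linear_maps_closed[OF \<rho>_linear, of a']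
      by (simp add: alg_hom_mult[OF \<rho>_hom] \<rho>_homog AH.tensor.m_assoc[symmetric] AH.pure_mult)
    moreover have "lin_ext T ?g r = lin_ext T ?g (single (a \<otimes> b, a') 1)
        \<oplus>\<^bsub>T\<^esub> (-1) \<odot>\<^bsub>T\<^esub> lin_ext T ?g (single (a, b \<otimes> a') 1)"
      using linear_maps_add[OF L c(1) AA.P.F_closed(4)[OF c(2)], of "-1"] linear_maps_smult[OF L c(2), of "-1"]
      by (simp add: *(1) single_uminus)
    ultimately show ?thesis
      using * b fT[of a "b \<otimes> a'"] by (simp add: sg[unfolded O_U1_simps] AH.tensor.sm_m1 AH.tensor.M.r_neg)
  qed
  have v: "lin_ext T ?g j = \<zero>\<^bsub>T\<^esub>" if "j \<in> Bal" for j
    using AA.P.linear_vanish_span[OF L AH.cvs_tensor _ _ that] v1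
      AA.lin_ext_bilinear_rels[OF can_bilinear AH.cvs_tensor] AA.bilinear_rels_sub balanced_rels_sub
    by blast
  have c: "canonical_map O_U1 A \<rho> = (\<lambda>x. the_elem (lin_ext T ?g ` x))"
    by (simp add: canonical_map_def tensor_lift_def lin_ext_def fun_eq_iff)
  show "canonical_map O_U1 A \<rho> \<in> linear_maps M T"
    unfolding c by (rule bal.quot_lift_linear[OF L AH.cvs_tensor v])
  show "canonical_map O_U1 A \<rho> (bal a a') = ?f a a'" if "a \<in> carrier A" "a' \<in> carrier A"
    unfolding c bal_def using that AA.P.F_closed(5)[of "(a, a')" 1]
    by (subst bal.the_elem_coset[OF L AH.cvs_tensor v]) (simp_all add: sg[unfolded O_U1_simps])
qed

lemma canonical_bal_homog:
  assumes "a \<in> carrier A" "a' \<in> H n"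
  shows "canonical_map O_U1 A \<rho> (bal a a') = pure A O_U1 (a \<otimes> a') (u_pow n)"
  using assms by (simp add: canonical_bal homog_closed \<rho>_homog AH.pure_mult)

end

context strongly_graded_algebra
begin

text \<open>For \<open>a'\<close> of degree \<open>n\<close> the composite is \<open>a \<otimes> a' \<mapsto> \<Sum> a a' \<nu>\<^sub>i \<otimes> \<omega>\<^sub>i\<close>. Since \<open>a' \<nu>\<^sub>i\<close> is coinvariant, it can
  be moved to the right factor, where \<open>\<Sum> a' \<nu>\<^sub>i \<omega>\<^sub>i = a'\<close>.\<close>

lemma canonical_left_inverse:
  assumes "t \<in> carrier M"
  shows "translation M bal (canonical_map O_U1 A \<rho> t) = t"
proof -
  note L = linear_maps_comp[OF canonical_linear translation_linear[OF bal.cvs_quot bal_bilinear]]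
  interpret M: cvs M by (rule bal.cvs_quot)
  show ?thesis using assms
  proof (induction rule: bal_induct)
    case zero
    then show ?case using linear_maps_zero[OF L bal.cvs_quot bal.cvs_quot] by simp
  next
    case (bal a a')
    show ?case
    proof (rule linear_eq_on_homog[OF linear_maps_comp[OF bilinear_right[OF bal_bilinear bal(1)] L]
          bilinear_right[OF bal_bilinear bal(1)] bal.cvs_quot _ bal(2)])
      fix n a' assume a': "a' \<in> H n"
      note a'c = homog_closed[OF a']
      have "translation M bal (canonical_map O_U1 A \<rho> (bal a a')) =
          lin_ext M (\<lambda>k. bal (a \<otimes> a' \<otimes> fst k) (snd k)) (conn n)"
        unfolding canonical_bal_homog[OF bal(1) a']
        using bal(1) a'c by (simp add: translation_pure[OF bal.cvs_quot bal_bilinear])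
      also have "\<dots> = lin_ext M (\<lambda>k. bal a (a' \<otimes> (fst k \<otimes> snd k))) (conn n)"
      proof (rule M.lin_ext_cong)
        fix k assume k: "k \<in> keys (conn n)"
        then have "bal (a \<otimes> (a' \<otimes> fst k)) (snd k) = bal a (a' \<otimes> fst k \<otimes> snd k)"
          using conn_deg0[OF a' k] bal(1) by (intro bal_balanced) (simp_all add: conn_closed)
        with k bal(1) a'c show "bal (a \<otimes> a' \<otimes> fst k) (snd k) = bal a (a' \<otimes> (fst k \<otimes> snd k))"
          by (simp add: m_assoc conn_closed)
      qed (use bal(1) a'c in \<open>simp add: bal_closed conn_closed\<close>)
      also have "\<dots> = bal a (lin_ext A (\<lambda>k. a' \<otimes> (fst k \<otimes> snd k)) (conn n))"
        using a'c by (intro linear_maps_lin_ext[OF bilinear_right[OF bal_bilinear bal(1)] cvs_axioms bal.cvs_quot, symmetric])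
          (simp add: conn_closed)
      finally show "translation M bal (canonical_map O_U1 A \<rho> (bal a a')) = bal a a'"
        by (simp add: conn_unit a'c)
    qed
  next
    case (add t t')
    then show ?case using linear_maps_add[OF L] by simp
  qed
qed

lemma canonical_right_inverse:
  assumes "t \<in> carrier T"
  shows "canonical_map O_U1 A \<rho> (translation M bal t) = t"
proof (rule AH.linear_eq_on_pure[OF linear_maps_comp[OF translation_linear[OF bal.cvs_quot bal_bilinear] canonical_linear]
      linear_maps_id AH.cvs_tensor _ assms])
  fix a h assume a: "a \<in> carrier A"
  note L = linear_maps_comp[OF translation_linear[OF bal.cvs_quot bal_bilinear] canonical_linear]
  show "canonical_map O_U1 A \<rho> (translation M bal (pure A O_U1 a h)) = pure A O_U1 a h"
  proof (rule laurent_linear_eq[OF linear_maps_comp[OF bilinear_right[OF AH.pure_bilinear a] L]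
        bilinear_right[OF AH.pure_bilinear a] AH.cvs_tensor])
    fix n
    have u: "u_pow n \<in> carrier O_U1" by simp
    have "canonical_map O_U1 A \<rho> (translation M bal (pure A O_U1 a (u_pow n))) =
        lin_ext T (\<lambda>k. canonical_map O_U1 A \<rho> (bal (a \<otimes> fst k) (snd k))) (conn n)"
      unfolding translation_pure[OF bal.cvs_quot bal_bilinear a]
      using a by (intro linear_maps_lin_ext[OF canonical_linear bal.cvs_quot AH.cvs_tensor])
        (simp add: bal_closed conn_closed)
    also have "\<dots> = lin_ext T (\<lambda>k. pure A O_U1 (a \<otimes> (fst k \<otimes> snd k)) (u_pow n)) (conn n)"
      using a by (intro AH.tensor.lin_ext_cong)
        (simp_all add: canonical_bal_homog[OF _ conn_keys(2)] conn_closed m_assoc)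
    also have "\<dots> = pure A O_U1 (lin_ext A (\<lambda>k. a \<otimes> (fst k \<otimes> snd k)) (conn n)) (u_pow n)"
      using a by (intro linear_maps_lin_ext[OF bilinear_left[OF AH.pure_bilinear u] cvs_axioms AH.cvs_tensor, symmetric])
        (simp add: conn_closed)
    finally show "canonical_map O_U1 A \<rho> (translation M bal (pure A O_U1 a (u_pow n))) = pure A O_U1 a (u_pow n)"
      by (simp add: conn_unit a)
  qed
qed

theorem principal_comodule_algebra: "principal_comodule_algebra O_U1 A \<rho>"
proof (intro principal_comodule_algebra.intro principal_comodule_algebra_axioms.intro
    comodule_algebra antipode_bij_O_U1)
  show "bij_betw (canonical_map O_U1 A \<rho>) (balanced_tensors B A) (carrier T)"
    unfolding balanced_tensors_carrier
    by (rule bij_betwI[where g = "translation M bal"])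
       (simp_all add: Pi_def linear_maps_closed[OF canonical_linear]
          linear_maps_closed[OF translation_linear[OF bal.cvs_quot bal_bilinear]]
          canonical_left_inverse canonical_right_inverse)
  show "\<exists>s. mult_splitting O_U1 A \<rho> s" using mult_splitting by blast
qed

end


subsection \<open>Gradings of presented algebras\<close>

fun letter_degree :: "('g \<Rightarrow> int) \<Rightarrow> 'g letter \<Rightarrow> int" where
  "letter_degree d (Gen g) = d g"
| "letter_degree d (Gen_star g) = - d g"

definition word_degree :: "('g \<Rightarrow> int) \<Rightarrow> 'g star_word \<Rightarrow> int" where
  "word_degree d w = (\<Sum>a\<leftarrow>letters w. letter_degree d a)"

definition homog_elem :: "('g \<Rightarrow> int) \<Rightarrow> int \<Rightarrow> 'g free_elem \<Rightarrow> bool" where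
  "homog_elem d n p \<longleftrightarrow> keys p \<subseteq> {w. word_degree d w = n}"

lemma homog_elem_letter: "homog_elem d (letter_degree d a) (letter_elem a)"
  by (auto simp: homog_elem_def letter_elem_def word_degree_def)

lemma homog_elem_gen: "d g = n \<Longrightarrow> homog_elem d n (gen g)" "- d g = n \<Longrightarrow> homog_elem d n (gen_star g)"
  using homog_elem_letter[of d "Gen g"] homog_elem_letter[of d "Gen_star g"]
  by (auto simp: gen_def gen_star_def)

lemma homog_elem_add: "homog_elem d n p \<Longrightarrow> homog_elem d n r \<Longrightarrow> homog_elem d n (p + r)"
  unfolding homog_elem_def using keys_add[of p r] by blast

lemma homog_elem_diff: "homog_elem d n p \<Longrightarrow> homog_elem d n r \<Longrightarrow> homog_elem d n (p - r)"
  unfolding homog_elem_def using keys_diff_subset[of p r] by blast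

lemma homog_elem_scale: "homog_elem d n p \<Longrightarrow> homog_elem d n (pm_scale c p)"
  unfolding homog_elem_def using keys_pm_scale[of c p] by blast

lemma homog_elem_mult:
  assumes "homog_elem d m p" "homog_elem d n r" "k = m + n"
  shows "homog_elem d k (p * r)"
proof -
  have "word_degree d (v + w) = word_degree d v + word_degree d w" for v w
    by (simp add: word_degree_def plus_star_word_def)
  then show ?thesis
    using assms keys_mult[of p r] by (fastforce simp: homog_elem_def)
qed

lemma homog_elem_one: "homog_elem d 0 1"
  by (simp add: homog_elem_def word_degree_def zero_star_word_def)

lemma homog_elem_prod_list: "(\<And>p. p \<in> set ps \<Longrightarrow> homog_elem d 0 p) \<Longrightarrow> homog_elem d 0 (prod_list ps)"
  by (induction ps) (simp_all add: homog_elem_one homog_elem_mult[of d 0 _ 0])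

text \<open>Homogeneous relations define a grading of the presented algebra. On the free algebra, an
  element \<open>p\<close> all of whose words have degree \<open>n\<close> is mapped by the prospective coaction to
  \<open>[p] \<otimes> u\<^sup>n\<close>, where \<open>[p]\<close> is the class of \<open>p\<close>. For a relation this is zero, and no computation in the
  tensor product is required.\<close>

lemma
  fixes R :: "'g free_elem set" and d :: "'g \<Rightarrow> int"
  assumes hom: "\<And>r. r \<in> R \<Longrightarrow> \<exists>n. homog_elem d n r"
    and \<rho>: "\<rho> = presented_map (tensor (presented_alg R) O_U1)
      (\<lambda>g. pure (presented_alg R) O_U1 (presented_gen R g) (u_pow (d g)))"
  shows graded_presented: "graded_algebra (presented_alg R) \<rho>"
    and gen_homog: "presented_gen R g \<in> homog (presented_alg R) \<rho> (d g)"
proof -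
  let ?A = "presented_alg R"
  interpret A: star_algebra ?A by (rule star_algebra_presented)
  interpret AH: star_pair ?A O_U1 by (intro star_pair.intro star_algebra_presented star_algebra_O_U1)
  let ?T = "tensor ?A O_U1"
  let ?f = "\<lambda>g. pure ?A O_U1 (presented_gen R g) (u_pow (d g))"
  have fc: "?f g \<in> carrier ?T" for g by (simp add: presented_gen_def)
  interpret S: star_algebra ?T by (rule AH.star_algebra_tensor)
  interpret c: letter_values ?A "\<lambda>a. cls R (letter_elem a)" by (rule letter_values_cls)
  interpret e: letter_values ?T "letter_eval ?T ?f"
  proof
    show "letter_eval ?T ?f a \<in> carrier ?T" for a
      by (cases a) (simp_all add: fc S.star_closed)
  qed
  have l: "letter_eval ?T ?f a = pure ?A O_U1 (cls R (letter_elem a)) (u_pow (letter_degree d a))" for a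
    by (cases a) (simp_all add: presented_gen_def gen_def AH.pure_star star_u_pow flip: cls_star)
  have w: "word_eval ?T (letter_eval ?T ?f) w =
      pure ?A O_U1 (word_eval ?A (\<lambda>a. cls R (letter_elem a)) w) (u_pow (word_degree d w))" for w
  proof (cases w)
    case (Word v)
    have "word_eval ?T (letter_eval ?T ?f) (Word v) =
      pure ?A O_U1 (word_eval ?A (\<lambda>a. cls R (letter_elem a)) (Word v)) (u_pow (word_degree d (Word v)))"
    proof (induction v)
      case Nil
      then show ?case by (simp add: word_eval_def word_degree_def AH.one_tensor)
    next
      case (Cons a v)
      have 1: "word_eval T e (Word (a # v)) = e a \<otimes>\<^bsub>T\<^esub> word_eval T e (Word v)"
        for T :: "('x, 'y) star_alg_scheme" and e by (simp add: word_eval_def)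
      have 2: "word_degree d (Word (a # v)) = letter_degree d a + word_degree d (Word v)"
        by (simp add: word_degree_def)
      show ?case
        unfolding 1 2 Cons.IH by (simp add: l AH.pure_mult u_pow_add)
    qed
    with Word show ?thesis by simp
  qed
  have main: "free_eval ?T ?f p = pure ?A O_U1 (cls R p) (u_pow n)" if "homog_elem d n p" for n p
    using that unfolding homog_elem_def free_eval_lin_ext
  proof (induction p rule: pm_induct_on)
    case zero
    then show ?case
      using linear_maps_zero[OF bilinear_left[OF AH.pure_bilinear, of "u_pow n"] A.cvs_axioms AH.cvs_tensor]
      by (simp add: cls_zero)
  next
    case (single k c)
    have "cls R (single k c) = c \<odot>\<^bsub>?A\<^esub> word_eval ?A (\<lambda>a. cls R (letter_elem a)) k"
      by (simp add: cls_eq_word_eval[of R "single k c"] c.ev_single)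
    then show ?case using single unfolding e.ev_single by (simp add: w AH.pure_sm_l)
  qed (simp_all add: e.ev_add cls_add AH.pure_add_l)
  have R: "free_eval ?T ?f r = \<zero>\<^bsub>?T\<^esub>" if "r \<in> R" for r
  proof -
    obtain n where "homog_elem d n r" using hom[OF \<open>r \<in> R\<close>] by blast
    then show ?thesis
      using linear_maps_zero[OF bilinear_left[OF AH.pure_bilinear, of "u_pow n"] A.cvs_axioms AH.cvs_tensor]
      by (simp add: main cls_rel[OF that])
  qed
  have hom_p: "cls R p \<in> homog ?A \<rho> n" if "homog_elem d n p" for p n
    using main[OF that] unfolding \<rho> homog_def by (simp add: presented_map_cls[OF S.star_algebra_axioms fc R])
  show "presented_gen R g \<in> homog ?A \<rho> (d g)"
    unfolding presented_gen_def by (intro hom_p homog_elem_gen) simp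
  have sums: "cls R p \<in> homog_sums ?A \<rho>" for p
  proof -
    have "cls R (\<Sum>k\<in>K. single k (lookup p k)) \<in> homog_sums ?A \<rho>" if "finite K" for K
      using that
    proof (induction K rule: finite_induct)
      case empty
      then show ?case by (simp add: cls_zero homog_sums.zero)
    next
      case (insert k K)
      have "homog_elem d (word_degree d k) (single k (lookup p k))"
        by (simp add: homog_elem_def)
      from homog_sums.add[OF hom_p[OF this] insert.IH] insert.hyps
      show ?case by (simp add: cls_add)
    qed
    from this[OF finite_keys[of p]] show ?thesis by (simp flip: pm_sum_singles)
  qed
  show "graded_algebra ?A \<rho>"
  proof (intro graded_algebra.intro graded_algebra_axioms.intro star_algebra_presented)
    show "\<rho> \<in> star_alg_hom ?A ?T"
      unfolding \<rho> by (rule presented_map_hom[OF S.star_algebra_axioms fc R])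
    show "carrier ?A \<subseteq> homog_sums ?A \<rho>"
      using sums by (auto elim!: presented_cases)
  qed
qed


section \<open>The relations of the quantum Seifert spaces\<close>

text \<open>Integer powers with \<open>w\<^sup>*\<close> in the role of the inverse of \<open>w\<close>, also when \<open>w\<close> is not unitary.\<close>

definition ipow :: "('a, 'm) star_alg_scheme \<Rightarrow> 'a \<Rightarrow> int \<Rightarrow> 'a" where
  "ipow A w k = (if 0 \<le> k then w [^]\<^bsub>A\<^esub> nat k else star A w [^]\<^bsub>A\<^esub> nat (- k))"

lemma (in complex_algebra) commute_one_minus:
  assumes "b \<in> carrier A" "w \<in> carrier A" "b \<otimes> w = w \<otimes> b"
  shows "(\<one> \<ominus> c \<odot> b) \<otimes> w = w \<otimes> (\<one> \<ominus> c \<odot> b)"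
  using assms by (simp add: a_minus_def l_distr r_distr l_minus r_minus smult_mult_left smult_mult_right)

lemma (in complex_algebra) commute_mult:
  assumes "u \<in> carrier A" "v \<in> carrier A" "w \<in> carrier A" "u \<otimes> v = v \<otimes> u" "u \<otimes> w = w \<otimes> u"
  shows "u \<otimes> (v \<otimes> w) = (v \<otimes> w) \<otimes> u"
  using assms(1-3) by (metis assms(4,5) m_assoc)

text \<open>The relations common to the two families: \<open>x y = Q y x\<close>, and \<open>x x\<^sup>*\<close> and \<open>x\<^sup>* x\<close> are products of
  factors \<open>1 - c y\<^sup>2 z\<close>, with \<open>c\<close> from the lists \<open>cs\<close> and \<open>ds\<close>. They hold for \<open>\<zeta>\<^sub>0, \<zeta>\<^sub>1, \<xi>\<close> with
  \<open>Q = q\<close> and lists of length one, for \<open>\<zeta>\<^sub>0\<^sup>l, \<zeta>\<^sub>1, \<xi>\<close>, and for the generators of \<open>O_Sigma_l\<close>.\<close>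

locale seifert_relations = star_algebra A
  for A :: "('a, 'm) star_alg_scheme" (structure) +
  fixes x y z :: 'a and Q :: complex and cs ds :: "complex list"
  assumes gens [simp]: "x \<in> carrier A" "y \<in> carrier A" "z \<in> carrier A"
    and Q: "Q \<noteq> 0" "cnj Q = Q"
    and y_star: "star A y = y \<otimes> z"
    and xy: "x \<otimes> y = Q \<odot> (y \<otimes> x)"
    and xx_star: "x \<otimes> star A x = foldr (\<lambda>c t. (\<one> \<ominus> c \<odot> (y \<otimes> y \<otimes> z)) \<otimes> t) cs \<one>"
    and star_xx: "star A x \<otimes> x = foldr (\<lambda>c t. (\<one> \<ominus> c \<odot> (y \<otimes> y \<otimes> z)) \<otimes> t) ds \<one>"
    and z_unitary: "z \<otimes> star A z = \<one>" "star A z \<otimes> z = \<one>"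
    and z_central: "w \<in> carrier A \<Longrightarrow> z \<otimes> w = w \<otimes> z"
begin

abbreviation "a \<equiv> y \<otimes> y \<otimes> z"

definition pol :: "complex list \<Rightarrow> 'a" where
  "pol es = foldr (\<lambda>c t. (\<one> \<ominus> c \<odot> a) \<otimes> t) es \<one>"

lemma star_gens [simp]: "star A x \<in> carrier A" "star A y \<in> carrier A" "star A z \<in> carrier A"
  by (simp_all add: star_closed)

lemma pol_simps: "pol [] = \<one>" "pol (c # es) = (\<one> \<ominus> c \<odot> a) \<otimes> pol es"
  by (simp_all add: pol_def)

lemma pol_closed [simp]: "pol es \<in> carrier A"
  by (induction es) (simp_all add: pol_simps)

lemma z_star_central:
  assumes "w \<in> carrier A"
  shows "star A z \<otimes> w = w \<otimes> star A z"
proof -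
  have "star A z \<otimes> w = star A z \<otimes> (w \<otimes> (z \<otimes> star A z))"
    using assms by (simp add: z_unitary)
  also have "\<dots> = star A z \<otimes> ((w \<otimes> z) \<otimes> star A z)"
    using assms by (simp add: m_assoc)
  also have "\<dots> = (star A z \<otimes> z) \<otimes> (w \<otimes> star A z)"
    unfolding z_central[OF assms, symmetric] using assms by (simp add: m_assoc)
  finally show ?thesis using assms by (simp add: z_unitary)
qed

text \<open>The star of \<open>x y = Q y x\<close>, with \<open>y\<^sup>* = y z\<close> and the central unitary \<open>z\<close> cancelled.\<close>

lemma yx_star: "y \<otimes> star A x = Q \<odot> (star A x \<otimes> y)"
proof -
  have "star A (x \<otimes> y) = star A (Q \<odot> (y \<otimes> x))" by (simp add: xy)
  then have 1: "(y \<otimes> z) \<otimes> star A x = Q \<odot> (star A x \<otimes> (y \<otimes> z))"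
    by (simp add: star_mult star_smult Q y_star)
  have "y \<otimes> star A x = y \<otimes> ((z \<otimes> star A x) \<otimes> star A z)"
    unfolding z_central[OF star_gens(1)] by (simp add: m_assoc z_unitary)
  also have "\<dots> = ((y \<otimes> z) \<otimes> star A x) \<otimes> star A z" by (simp add: m_assoc)
  also have "\<dots> = Q \<odot> (star A x \<otimes> y)"
    unfolding 1 by (simp add: smult_mult_left m_assoc z_unitary)
  finally show ?thesis .
qed

lemma q_commute_power:
  assumes "v \<in> carrier A" "w \<in> carrier A" "v \<otimes> w = c \<odot> (w \<otimes> v)"
  shows "v \<otimes> w [^] r = c ^ r \<odot> (w [^] (r :: nat) \<otimes> v)" "v [^] (r :: nat) \<otimes> w = c ^ r \<odot> (w \<otimes> v [^] r)"
proof -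
  show "v \<otimes> w [^] r = c ^ r \<odot> (w [^] r \<otimes> v)"
  proof (induction r)
    case (Suc r)
    have "v \<otimes> w [^] Suc r = (v \<otimes> w [^] r) \<otimes> w" using assms by (simp add: m_assoc)
    also have "\<dots> = c ^ r \<odot> (w [^] r \<otimes> (v \<otimes> w))"
      using assms(1,2) by (simp add: Suc.IH smult_mult_left m_assoc)
    also have "\<dots> = c ^ Suc r \<odot> (w [^] Suc r \<otimes> v)"
      using assms(1,2) by (simp add: assms(3) smult_mult_right sm_sm m_assoc mult.commute)
    finally show ?case .
  qed (use assms in simp)
  show "v [^] r \<otimes> w = c ^ r \<odot> (w \<otimes> v [^] r)"
  proof (induction r)
    case (Suc r)
    have "v [^] Suc r \<otimes> w = v [^] r \<otimes> (v \<otimes> w)" using assms by (simp add: m_assoc)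
    also have "\<dots> = c \<odot> ((v [^] r \<otimes> w) \<otimes> v)"
      using assms(1,2) by (simp add: assms(3) smult_mult_right m_assoc)
    also have "\<dots> = c ^ Suc r \<odot> (w \<otimes> v [^] Suc r)"
      using assms(1,2) by (simp add: Suc.IH smult_mult_left sm_sm m_assoc)
    finally show ?case .
  qed (use assms in simp)
qed

lemma ipow_of_nat: "ipow A w (int r) = w [^] r"
  by (simp add: ipow_def)

lemma ipow_minus: "ipow A w (- int r) = star A w [^] r"
proof (cases "r = 0")
  case False
  then have "\<not> 0 \<le> - int r" "nat (- (- int r)) = r" by simp_all
  then show ?thesis by (simp only: ipow_def if_False)
qed (simp add: ipow_def)

lemma ipow_closed [simp]: "w \<in> carrier A \<Longrightarrow> ipow A w k \<in> carrier A"
  by (cases k rule: int_cases2) (simp_all add: ipow_of_nat ipow_minus star_closed)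

lemma ipow_add_one: "w \<in> carrier A \<Longrightarrow> w \<otimes> ipow A w (int r) = ipow A w (int r + 1)"
  using ipow_of_nat[of w "Suc r"] nat_pow_Suc2[of w r] by (simp add: ipow_of_nat add.commute)

lemma ipow_diff_one: "w \<in> carrier A \<Longrightarrow> star A w \<otimes> ipow A w (- int r) = ipow A w (- int r - 1)"
proof -
  assume "w \<in> carrier A"
  moreover have "- int r - 1 = - int (Suc r)" by simp
  ultimately show ?thesis
    by (simp only: ipow_minus nat_pow_Suc2 star_closed)
qed

lemma y_ipow_x: "\<exists>c. y \<otimes> ipow A x k = c \<odot> (ipow A x k \<otimes> y)"
proof -
  have "y \<otimes> x = inverse Q \<odot> (x \<otimes> y)" using Q by (simp add: xy sm_sm)
  note 1 = q_commute_power(1)[OF gens(2) gens(1) this] and 2 = q_commute_power(1)[OF gens(2) star_gens(1) yx_star]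
  show ?thesis
    by (cases k rule: int_cases2; hypsubst; unfold ipow_of_nat ipow_minus) (rule exI, rule 1, rule exI, rule 2)
qed

lemma z_ipow: "z \<otimes> ipow A z n = ipow A z (n + 1)"
proof (cases n rule: int_cases)
  case (nonneg r)
  then show ?thesis by (simp add: ipow_add_one)
next
  case (neg r)
  have "z \<otimes> star A z [^] Suc r = (z \<otimes> star A z) \<otimes> star A z [^] r"
    unfolding nat_pow_Suc2[OF star_gens(3)] by (simp add: m_assoc)
  then show ?thesis
    unfolding neg ipow_minus using ipow_minus[of z r] by (simp add: z_unitary)
qed

lemma z_star_ipow: "star A z \<otimes> ipow A z n = ipow A z (n - 1)"
proof (cases n rule: int_cases3)
  case (pos r)
  then obtain s where s: "r = Suc s" by (cases r) auto
  have "star A z \<otimes> z [^] Suc s = (star A z \<otimes> z) \<otimes> z [^] s"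
    unfolding nat_pow_Suc2[OF gens(3)] by (simp add: m_assoc)
  then show ?thesis
    unfolding pos s ipow_of_nat using ipow_of_nat[of z s] by (simp add: z_unitary)
next
  case (neg r)
  then show ?thesis by (simp add: ipow_diff_one)
qed (use ipow_diff_one[of z 0] in simp)


subsection \<open>Spanning by monomials\<close>

definition nmono :: "nat \<times> int \<times> int \<Rightarrow> 'a" where
  "nmono = (\<lambda>(m, n, k). ipow A x k \<otimes> (y [^] m \<otimes> ipow A z n))"

abbreviation lin :: "(nat \<times> int \<times> int \<Rightarrow>\<^sub>0 complex) \<Rightarrow> 'a" where
  "lin \<equiv> lin_ext A nmono"

lemma nmono_closed [simp]: "nmono t \<in> carrier A"
  by (cases t) (simp add: nmono_def)

lemma lin_closed [simp]: "lin c \<in> carrier A"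
  by (rule lin_ext_closed) simp

lemma lin_add: "lin (c + d) = lin c \<oplus> lin d"
  by (rule lin_ext_add[of _ UNIV]) simp_all

lemma lin_scale: "lin (pm_scale s c) = s \<odot> lin c"
  by (rule lin_ext_scale) simp

lemma lin_single: "lin (single t s) = s \<odot> nmono t"
  by (rule lin_ext_single) simp

lemma mono_in_range: "s \<odot> nmono t \<in> range lin"
  by (metis lin_single rangeI)

lemma nmono_range [simp]: "nmono t \<in> range lin"
  using mono_in_range[of 1 t] by simp

lemma range_lin_add: "v \<in> range lin \<Longrightarrow> w \<in> range lin \<Longrightarrow> v \<oplus> w \<in> range lin"
  by (auto simp flip: lin_add)

lemma range_lin_scale: "v \<in> range lin \<Longrightarrow> s \<odot> v \<in> range lin"
  by (auto simp flip: lin_scale)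

lemma range_lin_closed: "v \<in> range lin \<Longrightarrow> v \<in> carrier A"
  by auto

text \<open>The span of the monomials contains \<open>1\<close>; it is the whole algebra once it is closed under left
  multiplication by the generators and their stars. The only generators that do not map
  monomials to multiples of monomials are \<open>x\<close> and \<open>x\<^sup>*\<close>: there a product \<open>x x\<^sup>*\<close> or \<open>x\<^sup>* x\<close> may appear on the left,
  and it is a polynomial in \<open>y\<^sup>2 z\<close>, under which the span is already closed.\<close>

lemma left_mult_closed:
  assumes w: "w \<in> carrier A" and m: "\<And>t. w \<otimes> nmono t \<in> range lin" and v: "v \<in> range lin"
  shows "w \<otimes> v \<in> range lin"
proof -
  obtain c where c: "v = lin c" using v by auto
  have "keys c \<subseteq> UNIV" by simp
  then have "w \<otimes> lin c \<in> range lin"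
  proof (induction c rule: pm_induct_on)
    case zero
    then show ?case using mono_in_range[of 0] w by simp
  next
    case (single t s)
    then show ?case using range_lin_scale[OF m[of t], of s] w by (simp add: lin_single smult_mult_right)
  next
    case (add c d)
    then show ?case using w by (simp add: lin_add r_distr range_lin_add)
  qed
  with c show ?thesis by simp
qed

lemma central_mono:
  assumes "w \<in> carrier A" "\<And>v. v \<in> carrier A \<Longrightarrow> w \<otimes> v = v \<otimes> w"
  shows "w \<otimes> nmono (m, n, k) = ipow A x k \<otimes> (y [^] m \<otimes> (w \<otimes> ipow A z n))"
proof -
  have "w \<otimes> nmono (m, n, k) = (w \<otimes> ipow A x k) \<otimes> (y [^] m \<otimes> ipow A z n)"
    using assms(1) by (simp add: nmono_def m_assoc)
  also have "\<dots> = ipow A x k \<otimes> ((w \<otimes> y [^] m) \<otimes> ipow A z n)"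
    using assms(1) by (subst assms(2)) (simp_all add: m_assoc)
  also have "\<dots> = ipow A x k \<otimes> (y [^] m \<otimes> (w \<otimes> ipow A z n))"
    using assms(1) by (subst assms(2)) (simp_all add: m_assoc)
  finally show ?thesis .
qed

lemma z_mono: "z \<otimes> nmono (m, n, k) = nmono (m, n + 1, k)"
  using central_mono[OF gens(3) z_central] by (simp add: z_ipow nmono_def)

lemma z_star_mono: "star A z \<otimes> nmono (m, n, k) = nmono (m, n - 1, k)"
  using central_mono[OF star_gens(3) z_star_central] by (simp add: z_star_ipow nmono_def)

lemma z_range: "v \<in> range lin \<Longrightarrow> z \<otimes> v \<in> range lin"
proof (rule left_mult_closed)
  show "z \<otimes> nmono t \<in> range lin" for t
    using mono_in_range[of 1] by (cases t) (simp add: z_mono)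
qed simp

lemma z_star_range: "v \<in> range lin \<Longrightarrow> star A z \<otimes> v \<in> range lin"
proof (rule left_mult_closed)
  show "star A z \<otimes> nmono t \<in> range lin" for t
    using mono_in_range[of 1] by (cases t) (simp add: z_star_mono)
qed simp

lemma y_range: "v \<in> range lin \<Longrightarrow> y \<otimes> v \<in> range lin"
proof (rule left_mult_closed)
  show "y \<otimes> nmono t \<in> range lin" for t
  proof (cases t)
    case (fields m n k)
    obtain c where c: "y \<otimes> ipow A x k = c \<odot> (ipow A x k \<otimes> y)" using y_ipow_x by blast
    have "y \<otimes> nmono t = (y \<otimes> ipow A x k) \<otimes> (y [^] m \<otimes> ipow A z n)"
      by (simp add: fields nmono_def m_assoc)
    also have "\<dots> = c \<odot> (ipow A x k \<otimes> ((y \<otimes> y [^] m) \<otimes> ipow A z n))"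
      unfolding c by (simp add: smult_mult_left m_assoc)
    also have "\<dots> = c \<odot> nmono (Suc m, n, k)"
      unfolding nat_pow_Suc2[OF gens(2), symmetric] by (simp add: nmono_def)
    finally show ?thesis by (simp add: mono_in_range)
  qed
qed simp

lemma y_star_range: "v \<in> range lin \<Longrightarrow> star A y \<otimes> v \<in> range lin"
  using y_range[OF z_range] by (auto simp: y_star m_assoc)

lemma pol_range:
  assumes "v \<in> range lin"
  shows "pol es \<otimes> v \<in> range lin"
proof (induction es)
  case Nil
  then show ?case using assms by (auto simp: pol_simps)
next
  case (Cons c es)
  let ?w = "pol es \<otimes> v"
  have w: "?w \<in> carrier A" using range_lin_closed[OF Cons.IH] .
  have v: "v \<in> carrier A" using range_lin_closed[OF assms] .
  have "y \<otimes> (y \<otimes> (z \<otimes> ?w)) \<in> range lin" by (intro y_range z_range Cons.IH)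
  then have aw: "a \<otimes> ?w \<in> range lin" using v by (simp add: m_assoc)
  have "pol (c # es) \<otimes> v = (\<one> \<oplus> (- c) \<odot> a) \<otimes> ?w"
    using v sm_sm[of a "-1" c] by (simp add: pol_simps m_assoc a_minus_def sm_m1)
  also have "\<dots> = ?w \<oplus> (- c) \<odot> (a \<otimes> ?w)"
    using w by (simp add: l_distr smult_mult_left del: m_assoc)
  also have "\<dots> \<in> range lin"
    by (intro range_lin_add range_lin_scale Cons.IH aw)
  finally show ?case .
qed

lemma x_range: "v \<in> range lin \<Longrightarrow> x \<otimes> v \<in> range lin"
proof (rule left_mult_closed)
  show "x \<otimes> nmono t \<in> range lin" for t
  proof (cases t)
    case (fields m n k)
    show ?thesis
    proof (cases k rule: int_cases)
      case (nonneg r)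
      have "x \<otimes> nmono t = (x \<otimes> ipow A x k) \<otimes> (y [^] m \<otimes> ipow A z n)"
        by (simp add: fields nmono_def m_assoc)
      also have "\<dots> = 1 \<odot> nmono (m, n, k + 1)"
        by (simp add: nonneg ipow_add_one nmono_def)
      finally show ?thesis by (simp add: mono_in_range)
    next
      case (neg r)
      have "x \<otimes> nmono t = (x \<otimes> star A x [^] Suc r) \<otimes> (y [^] m \<otimes> ipow A z n)"
        unfolding fields neg nmono_def prod.case ipow_minus by (simp add: m_assoc del: nat_pow_Suc)
      also have "\<dots> = pol cs \<otimes> (1 \<odot> nmono (m, n, - int r))"
        unfolding nat_pow_Suc2[OF star_gens(1)] pol_def xx_star[symmetric] nmono_def prod.case ipow_minus
        by (simp add: m_assoc)
      finally show ?thesis by (simp add: pol_range)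
    qed
  qed
qed simp

lemma x_star_range: "v \<in> range lin \<Longrightarrow> star A x \<otimes> v \<in> range lin"
proof (rule left_mult_closed)
  show "star A x \<otimes> nmono t \<in> range lin" for t
  proof (cases t)
    case (fields m n k)
    show ?thesis
    proof (cases "k \<le> 0")
      case True
      then obtain r where r: "k = - int r" by (metis nonpos_int_cases)
      have "star A x \<otimes> nmono t = (star A x \<otimes> ipow A x k) \<otimes> (y [^] m \<otimes> ipow A z n)"
        by (simp add: fields nmono_def m_assoc)
      also have "\<dots> = 1 \<odot> nmono (m, n, k - 1)"
        by (simp add: r ipow_diff_one nmono_def)
      finally show ?thesis by (simp add: mono_in_range)
    next
      case False
      then obtain r where r: "k = int (Suc r)" by (metis not_le zero_less_imp_eq_int gr0_implies_Suc)
      have "star A x \<otimes> nmono t = (star A x \<otimes> x [^] Suc r) \<otimes> (y [^] m \<otimes> ipow A z n)"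
        unfolding fields r nmono_def prod.case ipow_of_nat by (simp add: m_assoc del: nat_pow_Suc)
      also have "\<dots> = pol ds \<otimes> (1 \<odot> nmono (m, n, int r))"
        unfolding nat_pow_Suc2[OF gens(1)] pol_def star_xx[symmetric] nmono_def prod.case ipow_of_nat
        by (simp add: m_assoc)
      finally show ?thesis by (simp add: pol_range)
    qed
  qed
qed simp

lemma one_range: "\<one> \<in> range lin"
  using mono_in_range[of 1 "(0, 0, 0)"] by (simp add: nmono_def ipow_def)


subsection \<open>Powers of the generator \<open>x\<close>\<close>

lemma star_pow: "w \<in> carrier A \<Longrightarrow> star A (w [^] (r :: nat)) = star A w [^] r"
proof (induction r)
  case 0
  have "star A \<one> = \<one>"
    using star_mult[of "\<one>" "star A \<one>"] star_star[of \<one>] star_closed[of \<one>] by simp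
  then show ?case by simp
next
  case (Suc r)
  then show ?case using nat_pow_Suc2[of "star A w" r] by (simp add: star_mult star_closed)
qed

lemma ipow_ipow: "ipow A (x [^] l) k = ipow A x (int l * k)"
proof (cases k rule: int_cases2)
  case (nonneg r)
  have "int l * int r = int (l * r)" by simp
  then show ?thesis unfolding nonneg by (simp only: ipow_of_nat nat_pow_pow gens)
next
  case (nonpos r)
  have "int l * (- int r) = - int (l * r)" by simp
  then show ?thesis unfolding nonpos by (simp only: ipow_minus star_pow nat_pow_pow gens star_gens)
qed

lemma a_commutes:
  assumes "v \<in> carrier A" "v \<otimes> y = c \<odot> (y \<otimes> v)"
  shows "v \<otimes> a = c\<^sup>2 \<odot> (a \<otimes> v)"
proof -
  have "v \<otimes> a = ((v \<otimes> y) \<otimes> y) \<otimes> z" using assms(1) by (simp add: m_assoc)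
  also have "\<dots> = c \<odot> ((y \<otimes> (v \<otimes> y)) \<otimes> z)"
    using assms(1) by (simp add: assms(2) smult_mult_left m_assoc)
  also have "\<dots> = c\<^sup>2 \<odot> (y \<otimes> (y \<otimes> (v \<otimes> z)))"
    using assms(1) by (simp add: assms(2) smult_mult_left smult_mult_right sm_sm m_assoc power2_eq_square)
  also have "\<dots> = c\<^sup>2 \<odot> (a \<otimes> v)"
    using assms(1) by (simp add: z_central[OF assms(1), symmetric] m_assoc)
  finally show ?thesis .
qed

lemma pol_snoc: "pol (es @ [c]) = pol (c # es)"
proof -
  have ac: "a \<in> carrier A" by simp
  have uc: "\<one> \<ominus> c \<odot> a \<in> carrier A" for c by simp
  have "a \<otimes> pol es = pol es \<otimes> a"
  proof (induction es)
    case (Cons c es)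
    show ?case
      unfolding pol_simps
      by (rule commute_mult[OF ac uc pol_closed commute_one_minus[OF ac ac refl, symmetric] Cons.IH])
  qed (simp add: pol_simps)
  from commute_one_minus[OF ac pol_closed this]
  have "pol (c # es) = pol es \<otimes> (\<one> \<ominus> c \<odot> a)"
    by (simp only: pol_simps)
  also have "\<dots> = pol (es @ [c])"
    by (induction es) (simp_all only: append.simps pol_simps m_assoc[OF uc pol_closed uc] l_one r_one uc one_closed)
  finally show ?thesis ..
qed

text \<open>Passing \<open>v\<^sup>r\<close> through \<open>1 - e a\<close> replaces \<open>e\<close> by \<open>e c\<^bsup>2 r\<^esup>\<close>, so each step of the induction
  contributes one new factor. For \<open>v = x\<close> and \<open>v = x\<^sup>*\<close> this gives the relations of \<open>O_Sigma_l\<close>.\<close>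

lemma power_mult_star_power:
  assumes v: "v \<in> carrier A" "w \<in> carrier A" "v \<otimes> y = c \<odot> (y \<otimes> v)" "v \<otimes> w = pol [e]"
  shows "v [^] (r :: nat) \<otimes> w [^] r = pol (map (\<lambda>p. e * c ^ (2 * p)) [0..<r])"
proof (induction r)
  case (Suc r)
  have ac: "a \<in> carrier A" by simp
  have comm: "v [^] r \<otimes> a = (c ^ r)\<^sup>2 \<odot> (a \<otimes> v [^] r)"
    using v(1) by (intro a_commutes q_commute_power(2)[OF v(1) gens(2) v(3)]) simp
  have "v [^] Suc r \<otimes> w [^] Suc r = v [^] r \<otimes> ((v \<otimes> w) \<otimes> w [^] r)"
    unfolding nat_pow_Suc2[OF v(2)] using v(1,2) by (simp add: m_assoc)
  also have "\<dots> = (v [^] r \<otimes> (\<one> \<ominus> e \<odot> a)) \<otimes> w [^] r"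
    unfolding v(4) pol_simps using v(1,2) by (simp add: m_assoc)
  also have "v [^] r \<otimes> (\<one> \<ominus> e \<odot> a) = v [^] r \<ominus> e \<odot> (v [^] r \<otimes> a)"
    using v(1) by (simp only: a_minus_def r_distr r_minus smult_mult_right ac nat_pow_closed one_closed
        sm_closed M.a_inv_closed r_one)
  also have "\<dots> = (\<one> \<ominus> (e * c ^ (2 * r)) \<odot> a) \<otimes> v [^] r"
    using v(1) by (simp only: comm a_minus_def l_distr l_minus smult_mult_left ac nat_pow_closed one_closed
        sm_closed M.a_inv_closed l_one sm_sm m_closed power_mult[symmetric] mult.commute[of r 2])
  also have "\<dots> \<otimes> w [^] r = pol ((e * c ^ (2 * r)) # map (\<lambda>p. e * c ^ (2 * p)) [0..<r])"
    unfolding pol_simps Suc.IH[symmetric] using v(1,2) by (simp add: m_assoc)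
  finally show ?case by (simp add: pol_snoc)
qed (simp add: pol_simps)

end


subsection \<open>Graded algebras with the relations of the quantum Seifert spaces\<close>

locale graded_seifert = graded_algebra A \<rho> + seifert_relations A x y z Q cs ds
  for A :: "('a, 'm) star_alg_scheme" (structure) and \<rho> and x y z :: 'a and Q cs ds +
  fixes dx dy dz :: int
  assumes gens_homog: "x \<in> homog A \<rho> dx" "y \<in> homog A \<rho> dy" "z \<in> homog A \<rho> dz"
    and spanned_by_monomials: "carrier A \<subseteq> range (lin_ext A nmono)"
begin

lemma pow_homog: "w \<in> H d \<Longrightarrow> w [^] (r :: nat) \<in> H (int r * d)"
proof (induction r)
  case (Suc r)
  then show ?case using homog_mult[of "w [^] r" "int r * d" w d] by (simp add: algebra_simps)
qed (simp add: homog_one)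

lemma ipow_homog: "w \<in> H d \<Longrightarrow> ipow A w k \<in> H (k * d)"
  using pow_homog[of w d] pow_homog[OF homog_star, of w d]
  by (cases k rule: int_cases2) (simp_all add: ipow_of_nat ipow_minus)

definition mdeg :: "nat \<times> int \<times> int \<Rightarrow> int" where
  "mdeg = (\<lambda>(m, n, k). k * dx + (int m * dy + n * dz))"

lemma nmono_homog: "nmono t \<in> H (mdeg t)"
  using homog_mult[OF ipow_homog[OF gens_homog(1)] homog_mult[OF pow_homog[OF gens_homog(2)] ipow_homog[OF gens_homog(3)]]]
  by (cases t) (simp add: nmono_def mdeg_def)

text \<open>Apply the projection onto the component of degree \<open>n\<close> to any expansion into monomials: it keeps
  the monomials of degree \<open>n\<close> and discards the others.\<close>

lemma homog_lin:
  assumes "v \<in> H n"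
  obtains c where "v = lin c" "\<And>t. t \<in> keys c \<Longrightarrow> mdeg t = n"
proof -
  have "\<exists>c'. proj n (lin c) = lin c' \<and> keys c' \<subseteq> {t. mdeg t = n}" for c
  proof -
    have "keys c \<subseteq> UNIV" by simp
    then show ?thesis
    proof (induction c rule: pm_induct_on)
      case zero
      show ?case
        by (rule exI[of _ 0]) (simp add: linear_maps_zero[OF proj_linear cvs_axioms cvs_axioms])
    next
      case (single t s)
      have "proj n (lin (single t s)) = s \<odot> proj n (nmono t)"
        by (simp add: lin_single linear_maps_smult[OF proj_linear])
      also have "\<dots> = lin (if n = mdeg t then single t s else 0)"
        by (simp add: proj_on_homog[OF nmono_homog] lin_single)
      finally show ?case
        by (intro exI[of _ "if n = mdeg t then single t s else 0"]) auto
    next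
      case (add c d)
      then obtain c' d' where "proj n (lin c) = lin c'" "keys c' \<subseteq> {t. mdeg t = n}"
        "proj n (lin d) = lin d'" "keys d' \<subseteq> {t. mdeg t = n}" by auto
      then show ?case
        using keys_add[of c' d']
        by (intro exI[of _ "c' + d'"]) (auto simp: lin_add linear_maps_add[OF proj_linear])
    qed
  qed
  moreover obtain c where "v = lin c"
    using homog_closed[OF assms] spanned_by_monomials by auto
  ultimately obtain c' where "proj n v = lin c'" "keys c' \<subseteq> {t. mdeg t = n}" by metis
  then show thesis
    using proj_on_homog[OF assms, of n] by (intro that[of c']) auto
qed

text \<open>Every term of \<open>1 - \<Prod> (1 - c a)\<close> is a multiple of \<open>a\<close>, and \<open>a p\<close> for \<open>p\<close> of degree zero factors both
  as \<open>(y z) (y p)\<close> and as \<open>y ((y z) p)\<close>.\<close>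

lemma pol_DP:
  assumes deg: "dx = 1" "dy = 1" "dz = - 2"
  shows "pol es \<in> H 0 \<and> \<one> \<oplus> (- 1) \<odot> pol es \<in> DP 1 \<and> \<one> \<oplus> (- 1) \<odot> pol es \<in> DP (- 1)"
proof (induction es)
  case Nil
  have "\<one> \<oplus> (- 1) \<odot> \<one> = \<zero>" by (simp add: sm_m1 M.r_neg)
  then show ?case by (simp add: pol_simps homog_one degree_products.zero)
next
  case (Cons c es)
  have yz: "y \<otimes> z \<in> H (- 1)"
    using homog_mult[OF gens_homog(2,3)] by (simp add: deg)
  have y1: "y \<in> H 1" using gens_homog(2) by (simp add: deg)
  have ac: "a \<in> carrier A" by simp
  have a0: "a \<in> H 0" using homog_mult[OF y1 yz] by (simp add: m_assoc)
  have p0: "pol es \<in> H 0" and d: "\<one> \<oplus> (- 1) \<odot> pol es \<in> DP 1" "\<one> \<oplus> (- 1) \<odot> pol es \<in> DP (- 1)"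
    using Cons.IH by auto
  have e: "\<one> \<ominus> c \<odot> a = \<one> \<oplus> (- c) \<odot> a"
    using sm_sm[OF ac, of "- 1" c] by (simp only: a_minus_def sm_m1[symmetric] sm_closed ac) simp
  have pe: "pol (c # es) = pol es \<oplus> (- c) \<odot> (a \<otimes> pol es)"
    unfolding pol_simps e
    by (simp only: l_distr smult_mult_left ac sm_closed one_closed pol_closed l_one)
  have pH: "pol (c # es) \<in> H 0"
    unfolding pe using homog_mult[OF a0 p0] by (intro homog_add homog_smult p0) simp
  have E: "\<one> \<oplus> (- 1) \<odot> pol (c # es) = (\<one> \<oplus> (- 1) \<odot> pol es) \<oplus> c \<odot> (a \<otimes> pol es)"
    unfolding pe
    by (simp only: sm_add_r sm_sm sm_closed m_closed ac pol_closed one_closed M.a_assoc) simp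
  have "(y \<otimes> z) \<otimes> (y \<otimes> pol es) \<in> DP 1"
    using homog_mult[OF y1 p0] yz by (intro DP_prod) simp_all
  moreover have "(y \<otimes> z) \<otimes> (y \<otimes> pol es) = a \<otimes> pol es"
    by (simp add: m_assoc z_central)
  moreover have "y \<otimes> ((y \<otimes> z) \<otimes> pol es) \<in> DP (- 1)"
    using homog_mult[OF yz p0] y1 by (intro DP_prod) simp_all
  moreover have "y \<otimes> ((y \<otimes> z) \<otimes> pol es) = a \<otimes> pol es"
    by (simp add: m_assoc)
  ultimately show ?case
    unfolding E using pH d by (simp add: DP_add DP_smult)
qed

lemma strongly_graded:
  assumes deg: "dx = 1" "dy = 1" "dz = - 2"
  shows "strongly_graded_algebra A \<rho>"
proof (intro strongly_graded_algebra.intro strongly_graded_algebra_axioms.intro graded_algebra_axioms)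
  have x1: "x \<in> H 1" "star A x \<in> H (- 1)" using gens_homog(1) homog_star[of x dx] by (simp_all add: deg)
  have eq: "pol es \<oplus> (\<one> \<oplus> (- 1) \<odot> pol es) = \<one>" for es
    using M.r_neg[of "pol es"] by (simp add: sm_m1 M.a_lcomm)
  have "pol ds \<in> DP 1" "pol cs \<in> DP (- 1)"
    using DP_prod[of "star A x" 1 x] DP_prod[of x "- 1" "star A x"] x1
    by (simp_all add: star_xx xx_star pol_def)
  then show "\<one> \<in> DP 1" "\<one> \<in> DP (- 1)"
    using DP_add[of "pol ds" 1 "\<one> \<oplus> (- 1) \<odot> pol ds"] DP_add[of "pol cs" "- 1" "\<one> \<oplus> (- 1) \<odot> pol cs"]
      pol_DP[OF deg, of ds] pol_DP[OF deg, of cs] by (simp_all add: eq)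
qed

end


subsection \<open>The presented algebras\<close>

lemma cls_diff: "cls R (p - r) = cls R p \<ominus>\<^bsub>presented_alg R\<^esub> cls R r"
proof -
  interpret complex_algebra "presented_alg R" by (rule complex_algebra_presented)
  have "cls R (p + pm_scale (- 1) r) = cls R p \<ominus>\<^bsub>presented_alg R\<^esub> cls R r"
    unfolding cls_add cls_smult by (simp add: sm_m1 a_minus_def)
  then show ?thesis by simp
qed

lemma cls_prod_list: "cls R (prod_list (map f es)) =
    foldr (\<lambda>e t. cls R (f e) \<otimes>\<^bsub>presented_alg R\<^esub> t) es \<one>\<^bsub>presented_alg R\<^esub>"
  by (induction es) (simp_all add: cls_one cls_mult)

lemma cls_gen_star: "cls R (gen_star g) = star (presented_alg R) (cls R (gen g))"
  by (simp flip: cls_star)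

text \<open>The relations say that \<open>z\<close> commutes with the generators and their stars, hence with everything.\<close>

lemma central_unitary:
  assumes "central_unitary_rels g \<subseteq> R"
  defines "A \<equiv> presented_alg R" and "z \<equiv> cls R (gen g)"
  shows "z \<otimes>\<^bsub>A\<^esub> star A z = \<one>\<^bsub>A\<^esub>" "star A z \<otimes>\<^bsub>A\<^esub> z = \<one>\<^bsub>A\<^esub>"
    "w \<in> carrier A \<Longrightarrow> z \<otimes>\<^bsub>A\<^esub> w = w \<otimes>\<^bsub>A\<^esub> z"
proof -
  interpret A: complex_algebra A unfolding A_def by (rule complex_algebra_presented)
  have "cls R (gen g * gen_star g) = cls R 1" "cls R (gen_star g * gen g) = cls R 1"
    using assms(1) by (auto intro!: cls_rel_diff simp: central_unitary_rels_def)
  then show "z \<otimes>\<^bsub>A\<^esub> star A z = \<one>\<^bsub>A\<^esub>" "star A z \<otimes>\<^bsub>A\<^esub> z = \<one>\<^bsub>A\<^esub>"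
    by (simp_all add: A_def z_def cls_mult cls_one cls_gen_star)
  have zl: "z \<otimes>\<^bsub>A\<^esub> cls R (letter_elem b) = cls R (letter_elem b) \<otimes>\<^bsub>A\<^esub> z" for b
  proof -
    have "cls R (gen g * letter_elem b) = cls R (letter_elem b * gen g)"
      using assms(1) by (auto intro!: cls_rel_diff simp: central_unitary_rels_def)
    then show ?thesis by (simp add: A_def z_def cls_mult)
  qed
  have zc: "z \<in> carrier A" and lc: "cls R (letter_elem b) \<in> carrier A" for b by (simp_all add: A_def z_def)
  show "z \<otimes>\<^bsub>A\<^esub> w = w \<otimes>\<^bsub>A\<^esub> z" if "w \<in> carrier A"
    using that unfolding A_def
  proof (induction rule: presented_induct)
    case (letter b v)
    then show ?case
      using A.commute_mult[OF zc lc _ zl] by (simp add: A_def)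
  qed (use zc in \<open>simp_all add: A_def[symmetric] A.l_distr A.r_distr A.smult_mult_left A.smult_mult_right\<close>)
qed

lemma seifert_O_Sigma_l:
  fixes l :: nat
  assumes "0 < q"
  defines "R \<equiv> Sigma_l_rels q l"
  shows "seifert_relations (O_Sigma_l q l) (presented_gen R X) (presented_gen R Y) (presented_gen R Z)
    (of_real (q ^ l)) (map (\<lambda>p. of_real (q ^ (2 * p))) [0..<l]) (map (\<lambda>p. of_real (1 / q ^ (2 * p))) [1..<l + 1])"
proof -
  let ?A = "presented_alg R"
  interpret A: star_algebra ?A by (rule star_algebra_presented)
  have e: "cls R (1 - pm_scale c ((gen Y)\<^sup>2 * gen Z)) =
      \<one>\<^bsub>?A\<^esub> \<ominus>\<^bsub>?A\<^esub> c \<odot>\<^bsub>?A\<^esub> (cls R (gen Y) \<otimes>\<^bsub>?A\<^esub> cls R (gen Y) \<otimes>\<^bsub>?A\<^esub> cls R (gen Z))" for c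
    by (simp add: cls_diff cls_one cls_smult cls_mult power2_eq_square)
  have cu: "central_unitary_rels Z \<subseteq> R" unfolding R_def Sigma_l_rels_def by (rule Un_upper2)
  have sub: "V \<subseteq> R" if "Sigma_l_rels q l = V \<union> W" for V W
    unfolding R_def that by (rule Un_upper1)
  have r: "cls R (gen_star Y) = cls R (gen Y * gen Z)"
    "cls R (gen X * gen Y) = cls R (pm_scale (of_real (q ^ l)) (gen Y * gen X))"
    "cls R (gen X * gen_star X) =
       cls R (prod_list (map (\<lambda>p. 1 - pm_scale (of_real (q ^ (2 * p))) (gen Y ^ 2 * gen Z)) [0..<l]))"
    "cls R (gen_star X * gen X) =
       cls R (prod_list (map (\<lambda>p. 1 - pm_scale (of_real (1 / q ^ (2 * p))) (gen Y ^ 2 * gen Z)) [1..<l + 1]))"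
    by (rule cls_rel_diff, rule subsetD[OF sub[OF Sigma_l_rels_def]], (rule insertI1 | rule insertI2)+)+
  show ?thesis
    unfolding O_Sigma_l_def R_def[symmetric] presented_gen_def
  proof (intro seifert_relations.intro seifert_relations_axioms.intro star_algebra_presented)
    show "star ?A (cls R (gen Y)) = cls R (gen Y) \<otimes>\<^bsub>?A\<^esub> cls R (gen Z)"
      using r(1) by (simp add: cls_mult cls_gen_star)
    show "cls R (gen X) \<otimes>\<^bsub>?A\<^esub> cls R (gen Y) = of_real (q ^ l) \<odot>\<^bsub>?A\<^esub> (cls R (gen Y) \<otimes>\<^bsub>?A\<^esub> cls R (gen X))"
      using r(2) by (simp only: cls_mult cls_smult)
    show "cls R (gen X) \<otimes>\<^bsub>?A\<^esub> star ?A (cls R (gen X)) =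
        foldr (\<lambda>c t. (\<one>\<^bsub>?A\<^esub> \<ominus>\<^bsub>?A\<^esub> c \<odot>\<^bsub>?A\<^esub> (cls R (gen Y) \<otimes>\<^bsub>?A\<^esub> cls R (gen Y) \<otimes>\<^bsub>?A\<^esub> cls R (gen Z))) \<otimes>\<^bsub>?A\<^esub> t)
          (map (\<lambda>p. of_real (q ^ (2 * p))) [0..<l]) \<one>\<^bsub>?A\<^esub>"
      using r(3) by (simp only: cls_mult[of R "gen X"] cls_prod_list e cls_gen_star foldr_map comp_def)
    show "star ?A (cls R (gen X)) \<otimes>\<^bsub>?A\<^esub> cls R (gen X) =
        foldr (\<lambda>c t. (\<one>\<^bsub>?A\<^esub> \<ominus>\<^bsub>?A\<^esub> c \<odot>\<^bsub>?A\<^esub> (cls R (gen Y) \<otimes>\<^bsub>?A\<^esub> cls R (gen Y) \<otimes>\<^bsub>?A\<^esub> cls R (gen Z))) \<otimes>\<^bsub>?A\<^esub> t)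
          (map (\<lambda>p. of_real (1 / q ^ (2 * p))) [1..<l + 1]) \<one>\<^bsub>?A\<^esub>"
      using r(4) by (simp only: cls_mult[of R "gen_star X"] cls_prod_list e cls_gen_star foldr_map comp_def)
    show "cls R (gen Z) \<otimes>\<^bsub>?A\<^esub> w = w \<otimes>\<^bsub>?A\<^esub> cls R (gen Z)" if "w \<in> carrier ?A" for w
      by (rule central_unitary(3)[OF cu that])
  qed (use assms central_unitary(1,2)[OF cu] in simp_all)
qed

text \<open>The two relations for \<open>\<zeta>\<^sub>0 \<zeta>\<^sub>0\<^sup>*\<close> amount to \<open>\<zeta>\<^sub>0 \<zeta>\<^sub>0\<^sup>* = 1 - a\<close> and \<open>\<zeta>\<^sub>0\<^sup>* \<zeta>\<^sub>0 = 1 - q\<^sup>-\<^sup>2 a\<close>, where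
  \<open>a = \<zeta>\<^sub>1\<^sup>2 \<xi>\<close>.\<close>

lemma seifert_O_Sigma:
  assumes "0 < q"
  defines "R \<equiv> Sigma_rels q"
  shows "seifert_relations (O_Sigma q) (presented_gen R Zeta0) (presented_gen R Zeta1) (presented_gen R Xi)
    (of_real q) [1] [of_real (1 / q ^ 2)]"
proof -
  let ?A = "presented_alg R"
  interpret A: star_algebra ?A by (rule star_algebra_presented)
  have cu: "central_unitary_rels Xi \<subseteq> R" unfolding R_def Sigma_rels_def by (rule Un_upper2)
  have sub: "V \<subseteq> R" if "Sigma_rels q = V \<union> W" for V W
    unfolding R_def that by (rule Un_upper1)
  have r: "cls R (gen_star Zeta1) = cls R (gen Zeta1 * gen Xi)"
    "cls R (gen Zeta0 * gen Zeta1) = cls R (pm_scale (of_real q) (gen Zeta1 * gen Zeta0))"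
    "cls R (gen Zeta0 * gen_star Zeta0) = cls R (gen_star Zeta0 * gen Zeta0
          + pm_scale (of_real (1 / q ^ 2 - 1)) (gen Zeta1 ^ 2 * gen Xi))"
    "cls R (gen Zeta0 * gen_star Zeta0 + gen Zeta1 ^ 2 * gen Xi) = cls R 1"
    by (rule cls_rel_diff, rule subsetD[OF sub[OF Sigma_rels_def]], (rule insertI1 | rule insertI2)+)+
  let ?a = "gen Zeta1 ^ 2 * gen Xi"
  have e: "cls R (1 - pm_scale c ?a) =
      \<one>\<^bsub>?A\<^esub> \<ominus>\<^bsub>?A\<^esub> c \<odot>\<^bsub>?A\<^esub> (cls R (gen Zeta1) \<otimes>\<^bsub>?A\<^esub> cls R (gen Zeta1) \<otimes>\<^bsub>?A\<^esub> cls R (gen Xi))" for c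
    by (simp add: cls_diff cls_one cls_smult cls_mult power2_eq_square)
  have ec: "\<one>\<^bsub>?A\<^esub> \<ominus>\<^bsub>?A\<^esub> c \<odot>\<^bsub>?A\<^esub> (cls R (gen Zeta1) \<otimes>\<^bsub>?A\<^esub> cls R (gen Zeta1) \<otimes>\<^bsub>?A\<^esub> cls R (gen Xi)) \<in> carrier ?A" for c
    by (simp flip: e)
  have x1: "cls R (gen Zeta0 * gen_star Zeta0) = cls R (1 - pm_scale 1 ?a)"
    using r(4) by (simp add: cls_eq algebra_simps)
  have "cls R (gen_star Zeta0 * gen Zeta0) = cls R (gen Zeta0 * gen_star Zeta0 - pm_scale (of_real (1 / q ^ 2 - 1)) ?a)"
    using r(3) star_ideal_closed(5)[of "gen Zeta0 * gen_star Zeta0 - (gen_star Zeta0 * gen Zeta0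
          + pm_scale (of_real (1 / q ^ 2 - 1)) ?a)" R "- 1"] by (simp add: cls_eq algebra_simps)
  also have "\<dots> = cls R (1 - pm_scale 1 ?a - pm_scale (of_real (1 / q ^ 2 - 1)) ?a)"
    unfolding cls_diff x1 ..
  also have "1 - pm_scale 1 ?a - pm_scale (of_real (1 / q ^ 2 - 1)) ?a = 1 - pm_scale (of_real (1 / q ^ 2)) ?a"
    using pm_scale_add(3)[of 1 "of_real (1 / q ^ 2 - 1)" ?a] by (simp add: algebra_simps)
  finally have x2: "cls R (gen_star Zeta0 * gen Zeta0) = cls R (1 - pm_scale (of_real (1 / q ^ 2)) ?a)" .
  show ?thesis
    unfolding O_Sigma_def R_def[symmetric] presented_gen_def
  proof (intro seifert_relations.intro seifert_relations_axioms.intro star_algebra_presented)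
    show "star ?A (cls R (gen Zeta1)) = cls R (gen Zeta1) \<otimes>\<^bsub>?A\<^esub> cls R (gen Xi)"
      using r(1) by (simp add: cls_mult cls_gen_star)
    show "cls R (gen Zeta0) \<otimes>\<^bsub>?A\<^esub> cls R (gen Zeta1) = of_real q \<odot>\<^bsub>?A\<^esub> (cls R (gen Zeta1) \<otimes>\<^bsub>?A\<^esub> cls R (gen Zeta0))"
      using r(2) by (simp only: cls_mult cls_smult)
    show "cls R (gen Zeta0) \<otimes>\<^bsub>?A\<^esub> star ?A (cls R (gen Zeta0)) =
        foldr (\<lambda>c t. (\<one>\<^bsub>?A\<^esub> \<ominus>\<^bsub>?A\<^esub> c \<odot>\<^bsub>?A\<^esub> (cls R (gen Zeta1) \<otimes>\<^bsub>?A\<^esub> cls R (gen Zeta1) \<otimes>\<^bsub>?A\<^esub> cls R (gen Xi))) \<otimes>\<^bsub>?A\<^esub> t)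
          [1] \<one>\<^bsub>?A\<^esub>"
      using x1 unfolding e cls_mult[of R "gen Zeta0"] cls_gen_star using ec[of 1] by simp
    show "star ?A (cls R (gen Zeta0)) \<otimes>\<^bsub>?A\<^esub> cls R (gen Zeta0) =
        foldr (\<lambda>c t. (\<one>\<^bsub>?A\<^esub> \<ominus>\<^bsub>?A\<^esub> c \<odot>\<^bsub>?A\<^esub> (cls R (gen Zeta1) \<otimes>\<^bsub>?A\<^esub> cls R (gen Zeta1) \<otimes>\<^bsub>?A\<^esub> cls R (gen Xi))) \<otimes>\<^bsub>?A\<^esub> t)
          [of_real (1 / q ^ 2)] \<one>\<^bsub>?A\<^esub>"
      using x2 unfolding e cls_mult[of R "gen_star Zeta0"] cls_gen_star using ec by simp
    show "cls R (gen Xi) \<otimes>\<^bsub>?A\<^esub> w = w \<otimes>\<^bsub>?A\<^esub> cls R (gen Xi)" if "w \<in> carrier ?A" for w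
      by (rule central_unitary(3)[OF cu that])
  qed (use assms central_unitary(1,2)[OF cu] in simp_all)
qed

lemma presented_spanned:
  assumes S: "seifert_relations (presented_alg R) x y z Q cs ds"
    and letters: "\<And>b. cls R (letter_elem b) \<in> {x, y, z, star (presented_alg R) x,
      star (presented_alg R) y, star (presented_alg R) z}"
  shows "carrier (presented_alg R) \<subseteq> range (lin_ext (presented_alg R) (seifert_relations.nmono (presented_alg R) x y z))"
proof
  interpret seifert_relations "presented_alg R" x y z Q cs ds by (rule S)
  have step: "cls R (letter_elem b) \<otimes>\<^bsub>presented_alg R\<^esub> v \<in> range lin" if "v \<in> range lin" for b v
    using letters[of b] x_range[OF that] y_range[OF that] z_range[OF that]
      x_star_range[OF that] y_star_range[OF that] z_star_range[OF that] by auto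
  fix v assume "v \<in> carrier (presented_alg R)"
  then show "v \<in> range lin"
  proof (induction rule: presented_induct)
    case one
    show ?case by (rule one_range)
  next
    case (add v w)
    show ?case by (rule range_lin_add[OF add(3,4)])
  next
    case (smult c v)
    show ?case by (rule range_lin_scale[OF smult(2)])
  next
    case (letter b v)
    show ?case by (rule step[OF letter(2)])
  qed
qed

definition degree_l :: "sigma_l_gen \<Rightarrow> int" where
  "degree_l g = (case g of X \<Rightarrow> 1 | Y \<Rightarrow> 1 | Z \<Rightarrow> - 2)"

definition degree_Sigma :: "nat \<Rightarrow> sigma_gen \<Rightarrow> int" where
  "degree_Sigma l g = (case g of Zeta0 \<Rightarrow> 1 | Zeta1 \<Rightarrow> int l | Xi \<Rightarrow> - 2 * int l)"

lemma central_unitary_homog: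
  assumes "r \<in> central_unitary_rels g"
  shows "\<exists>n. homog_elem d n r"
proof -
  have "homog_elem d 0 (gen g * gen_star g - 1)" "homog_elem d 0 (gen_star g * gen g - 1)"
    by (intro homog_elem_diff homog_elem_mult[OF homog_elem_gen(1)[OF refl] homog_elem_gen(2)[OF refl]]
        homog_elem_mult[OF homog_elem_gen(2)[OF refl] homog_elem_gen(1)[OF refl]] homog_elem_one; simp)+
  moreover have "homog_elem d (d g + letter_degree d b) (gen g * letter_elem b - letter_elem b * gen g)" for b
    by (intro homog_elem_diff homog_elem_mult[OF homog_elem_gen(1)[OF refl] homog_elem_letter]
        homog_elem_mult[OF homog_elem_letter homog_elem_gen(1)[OF refl]]) simp_all
  ultimately show ?thesis using assms by (auto simp: central_unitary_rels_def)
qed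

lemma Sigma_l_rels_homog:
  assumes "r \<in> Sigma_l_rels q l"
  shows "\<exists>n. homog_elem degree_l n r"
proof -
  have g: "homog_elem degree_l 1 (gen X)" "homog_elem degree_l (- 1) (gen_star X)"
    "homog_elem degree_l 1 (gen Y)" "homog_elem degree_l (- 1) (gen_star Y)" "homog_elem degree_l (- 2) (gen Z)"
    by (simp_all add: homog_elem_gen degree_l_def)
  note i = homog_elem_diff homog_elem_mult homog_elem_one homog_elem_scale
  have p: "homog_elem degree_l 0 (1 - pm_scale c (gen Y ^ 2 * gen Z))" for c
    unfolding power2_eq_square by (intro i) (rule g | arith)+
  have f1: "homog_elem degree_l (- 1) (gen_star Y - gen Y * gen Z)"
    "homog_elem degree_l 2 (gen X * gen Y - pm_scale (of_real (q ^ l)) (gen Y * gen X))"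
    by (intro i, (rule g | arith)+)+
  have f2: "homog_elem degree_l 0 (gen X * gen_star X -
      prod_list (map (\<lambda>p. 1 - pm_scale (c p) (gen Y ^ 2 * gen Z)) es))"
    "homog_elem degree_l 0 (gen_star X * gen X -
      prod_list (map (\<lambda>p. 1 - pm_scale (c p) (gen Y ^ 2 * gen Z)) es))" for c and es :: "nat list"
  proof -
    have pl: "homog_elem degree_l 0 (prod_list (map (\<lambda>p. 1 - pm_scale (c p) (gen Y ^ 2 * gen Z)) es))"
      by (rule homog_elem_prod_list) (auto simp: p)
    have x: "homog_elem degree_l 0 (gen X * gen_star X)" "homog_elem degree_l 0 (gen_star X * gen X)"
      by (intro i, (rule g | arith)+)+
    show "homog_elem degree_l 0 (gen X * gen_star X -
        prod_list (map (\<lambda>p. 1 - pm_scale (c p) (gen Y ^ 2 * gen Z)) es))"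
      "homog_elem degree_l 0 (gen_star X * gen X -
        prod_list (map (\<lambda>p. 1 - pm_scale (c p) (gen Y ^ 2 * gen Z)) es))"
      by (rule homog_elem_diff[OF x(1) pl], rule homog_elem_diff[OF x(2) pl])
  qed
  show ?thesis
    by (insert assms[unfolded Sigma_l_rels_def], elim UnE insertE emptyE;
        (rule central_unitary_homog, assumption | hypsubst, rule exI, rule f1 f2))
qed

lemma Sigma_rels_homog:
  assumes "r \<in> Sigma_rels q"
  shows "\<exists>n. homog_elem (degree_Sigma l) n r"
proof -
  let ?d = "degree_Sigma l"
  have g: "homog_elem ?d 1 (gen Zeta0)" "homog_elem ?d (- 1) (gen_star Zeta0)"
    "homog_elem ?d (int l) (gen Zeta1)" "homog_elem ?d (- int l) (gen_star Zeta1)"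
    "homog_elem ?d (- 2 * int l) (gen Xi)"
    by (simp_all add: homog_elem_gen degree_Sigma_def)
  note i = homog_elem_diff homog_elem_add homog_elem_mult homog_elem_one homog_elem_scale
  have "homog_elem ?d (1 + int l) (gen Zeta0 * gen Zeta1 - pm_scale (of_real q) (gen Zeta1 * gen Zeta0))"
    by (intro i) (rule g | arith)+
  moreover have "homog_elem ?d (1 - int l) (gen Zeta0 * gen_star Zeta1 - pm_scale (of_real q) (gen_star Zeta1 * gen Zeta0))"
    by (intro i) (rule g | arith)+
  moreover have "homog_elem ?d 0 (gen Zeta0 * gen_star Zeta0
       - (gen_star Zeta0 * gen Zeta0 + pm_scale (of_real (1 / q ^ 2 - 1)) (gen Zeta1 ^ 2 * gen Xi)))"
    unfolding power2_eq_square by (intro i) (rule g | arith)+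
  moreover have "homog_elem ?d 0 (gen Zeta0 * gen_star Zeta0 + gen Zeta1 ^ 2 * gen Xi - 1)"
    unfolding power2_eq_square by (intro i) (rule g | arith)+
  moreover have "homog_elem ?d (- int l) (gen_star Zeta1 - gen Zeta1 * gen Xi)"
    by (intro i) (rule g | arith)+
  ultimately show ?thesis
    using assms central_unitary_homog[of r Xi] unfolding Sigma_rels_def by (elim UnE insertE emptyE) blast+
qed

lemma graded_seifert_O_Sigma_l:
  assumes "0 < q"
  shows "graded_seifert (O_Sigma_l q l) (phi_l q l) (presented_gen (Sigma_l_rels q l) X)
    (presented_gen (Sigma_l_rels q l) Y) (presented_gen (Sigma_l_rels q l) Z)
    (of_real (q ^ l)) (map (\<lambda>p. of_real (q ^ (2 * p))) [0..<l]) (map (\<lambda>p. of_real (1 / q ^ (2 * p))) [1..<l + 1])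
    1 1 (- 2)"
proof -
  let ?R = "Sigma_l_rels q l"
  have phi: "phi_l q l = presented_map (tensor (presented_alg ?R) O_U1)
      (\<lambda>g. pure (presented_alg ?R) O_U1 (presented_gen ?R g) (u_pow (degree_l g)))"
    unfolding phi_l_def O_Sigma_l_def
    by (intro arg_cong[where f = "presented_map _"]) (auto simp: fun_eq_iff degree_l_def split: sigma_l_gen.split)
  have hom: "\<exists>n. homog_elem degree_l n r" if "r \<in> ?R" for r
    by (rule Sigma_l_rels_homog[OF that])
  have g: "graded_algebra (O_Sigma_l q l) (phi_l q l)"
    unfolding O_Sigma_l_def by (rule graded_presented[OF hom phi])
  have h: "presented_gen ?R g \<in> homog (O_Sigma_l q l) (phi_l q l) (degree_l g)" for g
    unfolding O_Sigma_l_def by (rule gen_homog[OF hom phi])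
  interpret S: seifert_relations "O_Sigma_l q l" "presented_gen ?R X" "presented_gen ?R Y" "presented_gen ?R Z"
    "of_real (q ^ l)" "map (\<lambda>p. of_real (q ^ (2 * p))) [0..<l]" "map (\<lambda>p. of_real (1 / q ^ (2 * p))) [1..<l + 1]"
    by (rule seifert_O_Sigma_l[OF assms])
  have "carrier (O_Sigma_l q l) \<subseteq> range S.lin"
    unfolding O_Sigma_l_def
  proof (rule presented_spanned[OF S.seifert_relations_axioms[unfolded O_Sigma_l_def]])
    fix b :: "sigma_l_gen letter"
    show "cls ?R (letter_elem b) \<in> {presented_gen ?R X, presented_gen ?R Y, presented_gen ?R Z,
        star (presented_alg ?R) (presented_gen ?R X), star (presented_alg ?R) (presented_gen ?R Y),
        star (presented_alg ?R) (presented_gen ?R Z)}"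
      by (cases b; rename_tac g; case_tac g)
         (simp_all add: presented_gen_def O_Sigma_l_def gen_star_def flip: cls_star gen_def)
  qed
  then show ?thesis
    using g h[where g = X] h[where g = Y] h[where g = Z] S.seifert_relations_axioms
    by (intro graded_seifert.intro graded_seifert_axioms.intro) (simp_all add: degree_l_def)
qed

lemma graded_seifert_O_Sigma:
  assumes "0 < q"
  shows "graded_seifert (O_Sigma q) (rho_Sigma q l) (presented_gen (Sigma_rels q) Zeta0)
    (presented_gen (Sigma_rels q) Zeta1) (presented_gen (Sigma_rels q) Xi)
    (of_real q) [1] [of_real (1 / q ^ 2)] 1 (int l) (- 2 * int l)"
proof -
  let ?R = "Sigma_rels q"
  have rho: "rho_Sigma q l = presented_map (tensor (presented_alg ?R) O_U1)
      (\<lambda>g. pure (presented_alg ?R) O_U1 (presented_gen ?R g) (u_pow (degree_Sigma l g)))"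
    unfolding rho_Sigma_def O_Sigma_def
    by (intro arg_cong[where f = "presented_map _"]) (auto simp: fun_eq_iff degree_Sigma_def split: sigma_gen.split)
  have hom: "\<exists>n. homog_elem (degree_Sigma l) n r" if "r \<in> ?R" for r
    by (rule Sigma_rels_homog[OF that])
  have g: "graded_algebra (O_Sigma q) (rho_Sigma q l)"
    unfolding O_Sigma_def by (rule graded_presented[OF hom rho])
  have h: "presented_gen ?R g \<in> homog (O_Sigma q) (rho_Sigma q l) (degree_Sigma l g)" for g
    unfolding O_Sigma_def by (rule gen_homog[OF hom rho])
  interpret S: seifert_relations "O_Sigma q" "presented_gen ?R Zeta0" "presented_gen ?R Zeta1" "presented_gen ?R Xi"
    "of_real q" "[1]" "[of_real (1 / q ^ 2)]"
    by (rule seifert_O_Sigma[OF assms])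
  have "carrier (O_Sigma q) \<subseteq> range S.lin"
    unfolding O_Sigma_def
  proof (rule presented_spanned[OF S.seifert_relations_axioms[unfolded O_Sigma_def]])
    fix b :: "sigma_gen letter"
    show "cls ?R (letter_elem b) \<in> {presented_gen ?R Zeta0, presented_gen ?R Zeta1, presented_gen ?R Xi,
        star (presented_alg ?R) (presented_gen ?R Zeta0), star (presented_alg ?R) (presented_gen ?R Zeta1),
        star (presented_alg ?R) (presented_gen ?R Xi)}"
      by (cases b; rename_tac g; case_tac g)
         (simp_all add: presented_gen_def O_Sigma_def gen_star_def flip: cls_star gen_def)
  qed
  then show ?thesis
    using g h[where g = Zeta0] h[where g = Zeta1] h[where g = Xi] S.seifert_relations_axioms
    by (intro graded_seifert.intro graded_seifert_axioms.intro) (simp_all add: degree_Sigma_def)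
qed


section \<open>The embedding\<close>

lemma seifert_O_Sigma_power:
  fixes l :: nat
  assumes q: "0 < q"
  shows "seifert_relations (O_Sigma q) (presented_gen (Sigma_rels q) Zeta0 [^]\<^bsub>O_Sigma q\<^esub> l)
    (presented_gen (Sigma_rels q) Zeta1) (presented_gen (Sigma_rels q) Xi) (of_real (q ^ l))
    (map (\<lambda>p. of_real (q ^ (2 * p))) [0..<l]) (map (\<lambda>p. of_real (1 / q ^ (2 * p))) [1..<l + 1])"
proof -
  interpret S: seifert_relations "O_Sigma q" "presented_gen (Sigma_rels q) Zeta0" "presented_gen (Sigma_rels q) Zeta1"
    "presented_gen (Sigma_rels q) Xi" "of_real q" "[1]" "[of_real (1 / q ^ 2)]"
    by (rule seifert_O_Sigma[OF q])
  let ?x = "presented_gen (Sigma_rels q) Zeta0" and ?y = "presented_gen (Sigma_rels q) Zeta1"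
  let ?A = "O_Sigma q"
  have p1: "?x \<otimes>\<^bsub>?A\<^esub> star ?A ?x = S.pol [1]" unfolding S.pol_def by (rule S.xx_star)
  have p2: "star ?A ?x \<otimes>\<^bsub>?A\<^esub> ?x = S.pol [of_real (1 / q ^ 2)]" unfolding S.pol_def by (rule S.star_xx)
  have c2: "star ?A ?x \<otimes>\<^bsub>?A\<^esub> ?y = inverse (of_real q) \<odot>\<^bsub>?A\<^esub> (?y \<otimes>\<^bsub>?A\<^esub> star ?A ?x)"
    using q by (simp add: S.yx_star S.sm_sm)
  have e1: "map (\<lambda>p. 1 * complex_of_real q ^ (2 * p)) [0..<l] = map (\<lambda>p. of_real (q ^ (2 * p))) [0..<l]"
    by simp
  have e2: "map (\<lambda>p. of_real (1 / q ^ 2) * inverse (complex_of_real q) ^ (2 * p)) [0..<l] =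
      map (\<lambda>p. of_real (1 / q ^ (2 * p))) [1..<l + 1]"
    using map_Suc_upt[of 0 l] by (simp add: map_Suc_upt[symmetric] comp_def field_simps power2_eq_square del: upt_Suc)
  show ?thesis
  proof (intro seifert_relations.intro seifert_relations_axioms.intro S.star_algebra_axioms)
    show "?x [^]\<^bsub>?A\<^esub> l \<otimes>\<^bsub>?A\<^esub> ?y = of_real (q ^ l) \<odot>\<^bsub>?A\<^esub> (?y \<otimes>\<^bsub>?A\<^esub> ?x [^]\<^bsub>?A\<^esub> l)"
      using S.q_commute_power(2)[OF S.gens(1,2) S.xy, of l] by simp
    show "?x [^]\<^bsub>?A\<^esub> l \<otimes>\<^bsub>?A\<^esub> star ?A (?x [^]\<^bsub>?A\<^esub> l) =
      foldr (\<lambda>c t. (\<one>\<^bsub>?A\<^esub> \<ominus>\<^bsub>?A\<^esub> c \<odot>\<^bsub>?A\<^esub> S.a) \<otimes>\<^bsub>?A\<^esub> t) (map (\<lambda>p. of_real (q ^ (2 * p))) [0..<l]) \<one>\<^bsub>?A\<^esub>"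
      using S.power_mult_star_power[OF S.gens(1) S.star_gens(1) S.xy p1, of l]
      unfolding S.star_pow[OF S.gens(1)] e1 S.pol_def .
    show "star ?A (?x [^]\<^bsub>?A\<^esub> l) \<otimes>\<^bsub>?A\<^esub> ?x [^]\<^bsub>?A\<^esub> l =
      foldr (\<lambda>c t. (\<one>\<^bsub>?A\<^esub> \<ominus>\<^bsub>?A\<^esub> c \<odot>\<^bsub>?A\<^esub> S.a) \<otimes>\<^bsub>?A\<^esub> t) (map (\<lambda>p. of_real (1 / q ^ (2 * p))) [1..<l + 1]) \<one>\<^bsub>?A\<^esub>"
      using S.power_mult_star_power[OF S.star_gens(1) S.gens(1) c2 p2, of l]
      unfolding S.star_pow[OF S.gens(1)] e2 S.pol_def .
  qed (use q S.y_star S.z_unitary S.z_central in simp_all)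
qed

text \<open>So \<open>x \<mapsto> \<zeta>\<^sub>0\<^sup>l\<close>, \<open>y \<mapsto> \<zeta>\<^sub>1\<close>, \<open>z \<mapsto> \<xi>\<close> respects the relations of \<open>O_Sigma_l\<close>.\<close>

lemma seifert_free_eval:
  fixes l :: nat
  assumes S: "seifert_relations T x y z (of_real (q ^ l)) (map (\<lambda>p. of_real (q ^ (2 * p))) [0..<l])
      (map (\<lambda>p. of_real (1 / q ^ (2 * p))) [1..<l + 1])"
    and r: "r \<in> Sigma_l_rels q l"
  shows "free_eval T (\<lambda>g. case g of X \<Rightarrow> x | Y \<Rightarrow> y | Z \<Rightarrow> z) r = \<zero>\<^bsub>T\<^esub>"
proof -
  interpret S: seifert_relations T x y z "of_real (q ^ l)" "map (\<lambda>p. of_real (q ^ (2 * p))) [0..<l]"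
    "map (\<lambda>p. of_real (1 / q ^ (2 * p))) [1..<l + 1]" by (rule S)
  let ?f = "\<lambda>g. case g of X \<Rightarrow> x | Y \<Rightarrow> y | Z \<Rightarrow> z"
  interpret letter_values T "letter_eval T ?f"
  proof
    show "letter_eval T ?f b \<in> carrier T" for b
      by (cases b; rename_tac g; case_tac g) simp_all
  qed
  have g: "ev (gen X) = x" "ev (gen Y) = y" "ev (gen Z) = z" "ev (gen_star X) = star T x"
    "ev (gen_star Y) = star T y" "ev (gen_star Z) = star T z"
    by (simp_all add: gen_def gen_star_def ev_letter)
  have prod: "ev (prod_list (map h es)) = foldr (\<lambda>e t. ev (h e) \<otimes>\<^bsub>T\<^esub> t) es \<one>\<^bsub>T\<^esub>" for h and es :: "nat list"
    by (induction es) (simp_all add: ev_one ev_mult)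
  have f: "ev (1 - pm_scale c ((gen Y)\<^sup>2 * gen Z)) = \<one>\<^bsub>T\<^esub> \<ominus>\<^bsub>T\<^esub> c \<odot>\<^bsub>T\<^esub> (y \<otimes>\<^bsub>T\<^esub> y \<otimes>\<^bsub>T\<^esub> z)" for c
    by (simp add: ev_diff ev_one ev_smult ev_mult g power2_eq_square)
  have eqI: "ev (p - r) = \<zero>\<^bsub>T\<^esub>" if "ev p = ev r" for p r
    unfolding ev_diff that by (simp add: a_minus_def S.M.r_neg)
  have 1: "ev (gen_star Y - gen Y * gen Z) = \<zero>\<^bsub>T\<^esub>"
    by (rule eqI) (simp add: ev_mult g S.y_star)
  have 2: "ev (gen X * gen Y - pm_scale (of_real (q ^ l)) (gen Y * gen X)) = \<zero>\<^bsub>T\<^esub>"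
    by (rule eqI) (simp only: ev_mult ev_smult g S.xy)
  have 3: "ev (gen X * gen_star X
       - (\<Prod>p\<leftarrow>[0..<l]. 1 - pm_scale (of_real (q ^ (2 * p))) (gen Y ^ 2 * gen Z))) = \<zero>\<^bsub>T\<^esub>"
    by (rule eqI) (simp only: ev_mult[of "gen X"] g S.xx_star prod f foldr_map comp_def)
  have 4: "ev (gen_star X * gen X
       - (\<Prod>p\<leftarrow>[1..<l + 1]. 1 - pm_scale (of_real (1 / q ^ (2 * p))) (gen Y ^ 2 * gen Z))) = \<zero>\<^bsub>T\<^esub>"
    by (rule eqI) (simp only: ev_mult[of "gen_star X"] g S.star_xx prod f foldr_map comp_def)
  have 5: "ev r = \<zero>\<^bsub>T\<^esub>" if r: "r \<in> central_unitary_rels Z" for r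
  proof -
    have "ev (gen Z * letter_elem b - letter_elem b * gen Z) = \<zero>\<^bsub>T\<^esub>" for b
      by (rule eqI) (simp add: ev_mult g S.z_central)
    moreover have "ev (gen Z * gen_star Z - 1) = \<zero>\<^bsub>T\<^esub>" "ev (gen_star Z * gen Z - 1) = \<zero>\<^bsub>T\<^esub>"
      by (rule eqI, simp add: ev_mult ev_one g S.z_unitary)+
    ultimately show ?thesis using r by (auto simp: central_unitary_rels_def)
  qed
  show ?thesis
    unfolding free_eval_lin_ext
    by (insert r[unfolded Sigma_l_rels_def], elim UnE insertE emptyE; (rule 5, assumption | hypsubst, rule 1 2 3 4))
qed

lemma alg_hom_pow:
  assumes "f \<in> alg_hom A C" "complex_algebra A" "complex_algebra C" "w \<in> carrier A"
  shows "f (w [^]\<^bsub>A\<^esub> (r :: nat)) = f w [^]\<^bsub>C\<^esub> r"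
proof -
  interpret A: complex_algebra A by fact
  interpret C: complex_algebra C by fact
  show ?thesis
    by (induction r) (simp_all add: alg_hom_one[OF assms(1)] alg_hom_mult[OF assms(1)] assms(4))
qed


section \<open>A representation by difference operators\<close>

type_synonym oper = "(int \<Rightarrow> complex poly) \<Rightarrow> (int \<Rightarrow> complex poly)"

text \<open>The linear operators on functions from the integers to \<open>\<complex>[Y]\<close>. With an
  indeterminate in place of a number, the nonzero coefficients of two operators have a nonzero
  product.\<close>

definition op_alg :: "oper star_alg" where
  "op_alg =
    \<lparr>carrier = {T. (\<forall>F G. T (\<lambda>i. F i + G i) = (\<lambda>i. T F i + T G i)) \<and>
        (\<forall>c F. T (\<lambda>i. [:c:] * F i) = (\<lambda>i. [:c:] * T F i))},
     monoid.mult = (\<lambda>S T F. S (T F)), monoid.one = (\<lambda>F. F), ring.zero = (\<lambda>F i. 0),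
     ring.add = (\<lambda>S T F i. S F i + T F i), module.smult = (\<lambda>c T F i. [:c:] * T F i), star = id\<rparr>"

lemma op_alg_simps [simp]:
  "carrier op_alg = {T. (\<forall>F G. T (\<lambda>i. F i + G i) = (\<lambda>i. T F i + T G i)) \<and>
        (\<forall>c F. T (\<lambda>i. [:c:] * F i) = (\<lambda>i. [:c:] * T F i))}"
  "monoid.mult op_alg = (\<lambda>S T F. S (T F))" "\<one>\<^bsub>op_alg\<^esub> = (\<lambda>F. F)" "\<zero>\<^bsub>op_alg\<^esub> = (\<lambda>F i. 0)"
  "ring.add op_alg = (\<lambda>S T F i. S F i + T F i)" "module.smult op_alg = (\<lambda>c T F i. [:c:] * T F i)"
  by (simp_all add: op_alg_def)

lemma complex_algebra_op: "complex_algebra op_alg"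
proof (rule complex_algebraI)
  show "cvs op_alg"
    by (rule cvsI) (auto simp: fun_eq_iff algebra_simps smult_add_left smult_add_right)
  show "S \<otimes>\<^bsub>op_alg\<^esub> T \<in> carrier op_alg" if "S \<in> carrier op_alg" "T \<in> carrier op_alg" for S T
    using that by simp
qed (auto simp: fun_eq_iff algebra_simps smult_add_right)

context
  fixes q :: real
  assumes q: "0 < q" "q < 1"
begin

abbreviation wt :: "int \<Rightarrow> complex" where
  "wt i \<equiv> of_real q powi i"

lemma wt_add_1: "wt (i + 1) = of_real q * wt i"
  using q by (simp add: power_int_add)

lemma wt_diff_1: "wt (i - 1) = wt i / of_real q"
  using q by (simp add: power_int_diff)

lemma wt_nz: "wt i \<noteq> 0"
  using q by simp

text \<open>The action of \<open>\<zeta>\<^sub>0\<^sup>*\<close> is forced by that of \<open>\<zeta>\<^sub>0\<close> and \<open>\<zeta>\<^sub>1\<close>, as \<open>\<zeta>\<^sub>0 \<zeta>\<^sub>0\<^sup>*\<close> has to multiply the value at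
  \<open>i\<close> by \<open>1 - q\<^bsup>2 i\<^esup> Y\<^sup>2\<close>. Its weight at \<open>i\<close> therefore involves \<open>i - 1\<close>.\<close>

fun op_letter :: "sigma_gen letter \<Rightarrow> oper" where
  "op_letter (Gen Zeta0) = (\<lambda>F i. F (i + 1))"
| "op_letter (Gen_star Zeta0) = (\<lambda>F i. [:1, 0, - (wt (i - 1))\<^sup>2:] * F (i - 1))"
| "op_letter (Gen Zeta1) = (\<lambda>F i. [:0, wt i:] * F i)"
| "op_letter (Gen_star Zeta1) = (\<lambda>F i. [:0, wt i:] * F i)"
| "op_letter (Gen Xi) = (\<lambda>F. F)"
| "op_letter (Gen_star Xi) = (\<lambda>F. F)"

lemma op_letter_closed: "op_letter a \<in> carrier op_alg"
  by (cases a rule: op_letter.cases)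
     (auto simp: fun_eq_iff distrib_left mult.left_commute simp del: mult_pCons_left mult_pCons_right)

interpretation opv: letter_values op_alg op_letter
  by (intro letter_values.intro letter_values_axioms.intro complex_algebra_op op_letter_closed)

lemma op_eval_rels:
  assumes "r \<in> Sigma_rels q"
  shows "opv.ev r = \<zero>\<^bsub>op_alg\<^esub> \<and> opv.ev (free_star r) = \<zero>\<^bsub>op_alg\<^esub>"
proof -
  have eqI: "opv.ev (p - r) = \<zero>\<^bsub>op_alg\<^esub> \<and> opv.ev (free_star (p - r)) = \<zero>\<^bsub>op_alg\<^esub>"
    if "opv.ev p = opv.ev r" "opv.ev (free_star p) = opv.ev (free_star r)" for p r
    unfolding free_star_simps opv.ev_diff that using opv.ev_closed opv.T.M.r_neg by (simp only: a_minus_def)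
  have g: "opv.ev (gen Zeta0) = op_letter (Gen Zeta0)" "opv.ev (gen Zeta1) = op_letter (Gen Zeta1)"
    "opv.ev (gen Xi) = op_letter (Gen Xi)" "opv.ev (gen_star Zeta0) = op_letter (Gen_star Zeta0)"
    "opv.ev (gen_star Zeta1) = op_letter (Gen_star Zeta1)" "opv.ev (gen_star Xi) = op_letter (Gen_star Xi)"
    by (simp_all only: gen_def gen_star_def opv.ev_letter)
  have qnz: "complex_of_real q \<noteq> 0" using q by simp
  note s = free_star_mult free_star_simps free_star_gen opv.ev_mult opv.ev_add opv.ev_smult opv.ev_one g
    power2_eq_square complex_cnj_complex_of_real
  have 1: "opv.ev (gen Zeta0 * gen Zeta1) = opv.ev (pm_scale (of_real q) (gen Zeta1 * gen Zeta0))"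
    "opv.ev (gen Zeta0 * gen_star Zeta1) = opv.ev (pm_scale (of_real q) (gen_star Zeta1 * gen Zeta0))"
    by (simp_all add: s fun_eq_iff wt_add_1 del: mult_pCons_left)
  have 2: "opv.ev (free_star (gen Zeta0 * gen Zeta1)) = opv.ev (free_star (pm_scale (of_real q) (gen Zeta1 * gen Zeta0)))"
    "opv.ev (free_star (gen Zeta0 * gen_star Zeta1)) = opv.ev (free_star (pm_scale (of_real q) (gen_star Zeta1 * gen Zeta0)))"
    using qnz by (simp_all add: s fun_eq_iff wt_diff_1 del: mult_pCons_left)
  have key: "[:1, 0, - (w * w):] * f =
      [:1, 0, - (w * w / (of_real q * of_real q)):] * f
        + [:1 / (of_real q * of_real q) - 1:] * ([:0, w:] * ([:0, w:] * f))"
    for w :: complex and f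
  proof -
    have "[:1, 0, - (w * w):] = [:1, 0, - (w * w / (of_real q * of_real q)):]
        + [:1 / (of_real q * of_real q) - 1:] * ([:0, w:] * [:0, w:])"
      by (simp add: algebra_simps)
    then show ?thesis by (simp only: distrib_right mult.assoc)
  qed
  have key2: "[:1, 0, - (w * w):] * f + [:0, w:] * ([:0, w:] * f) = f" for w :: complex and f
  proof -
    have "[:1, 0, - (w * w):] + [:0, w:] * [:0, w:] = 1"
      by (simp add: one_pCons)
    then show ?thesis by (metis distrib_right mult.assoc mult_1)
  qed
  have 3: "opv.ev (gen Zeta0 * gen_star Zeta0) = opv.ev (gen_star Zeta0 * gen Zeta0
          + pm_scale (of_real (1 / q ^ 2 - 1)) (gen Zeta1 ^ 2 * gen Xi))"
    "opv.ev (free_star (gen Zeta0 * gen_star Zeta0)) = opv.ev (free_star (gen_star Zeta0 * gen Zeta0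
          + pm_scale (of_real (1 / q ^ 2 - 1)) (gen Zeta1 ^ 2 * gen Xi)))"
    using qnz by (simp_all add: s fun_eq_iff wt_diff_1 wt_add_1 key del: mult_pCons_left)
  have 4: "opv.ev (gen Zeta0 * gen_star Zeta0 + gen Zeta1 ^ 2 * gen Xi) = opv.ev 1"
    "opv.ev (free_star (gen Zeta0 * gen_star Zeta0 + gen Zeta1 ^ 2 * gen Xi)) = opv.ev (free_star 1)"
    by (simp_all add: s fun_eq_iff key2 del: mult_pCons_left)
  have 5: "opv.ev (gen_star Zeta1) = opv.ev (gen Zeta1 * gen Xi)"
    "opv.ev (free_star (gen_star Zeta1)) = opv.ev (free_star (gen Zeta1 * gen Xi))"
    by (simp_all add: s fun_eq_iff)
  have 6: "opv.ev r = \<zero>\<^bsub>op_alg\<^esub> \<and> opv.ev (free_star r) = \<zero>\<^bsub>op_alg\<^esub>" if r: "r \<in> central_unitary_rels Xi" for r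
  proof -
    have c: "r = gen Xi * gen_star Xi - 1 \<or> r = gen_star Xi * gen Xi - 1 \<or>
        (\<exists>b. r = gen Xi * letter_elem b - letter_elem b * gen Xi)"
      using r by (auto simp: central_unitary_rels_def)
    have "opv.ev (gen Xi * gen_star Xi) = opv.ev 1" "opv.ev (gen_star Xi * gen Xi) = opv.ev 1"
      "opv.ev (free_star (gen Xi * gen_star Xi)) = opv.ev (free_star 1)"
      "opv.ev (free_star (gen_star Xi * gen Xi)) = opv.ev (free_star 1)"
      "opv.ev (gen Xi * letter_elem b) = opv.ev (letter_elem b * gen Xi)"
      "opv.ev (free_star (gen Xi * letter_elem b)) = opv.ev (free_star (letter_elem b * gen Xi))" for b
      by (simp_all add: s opv.ev_letter)
    with c eqI show ?thesis by metis
  qed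
  show ?thesis
    by (insert assms[unfolded Sigma_rels_def], elim UnE insertE emptyE;
        (rule 6, assumption | hypsubst, rule eqI, rule 1 3 4 5, rule 2 3 4 5))
qed

definition \<pi> :: "sigma_gen free_elem set \<Rightarrow> oper" where
  "\<pi> v = the_elem (opv.ev ` v)"

lemma \<pi>_hom: "\<pi> \<in> alg_hom (O_Sigma q) op_alg"
  and \<pi>_gen: "\<pi> (cls (Sigma_rels q) (letter_elem b)) = op_letter b"
proof -
  note R = conjunct1[OF op_eval_rels] conjunct2[OF op_eval_rels]
  show "\<pi> \<in> alg_hom (O_Sigma q) op_alg"
    using opv.presented_lift_alg_hom[OF R] by (simp add: \<pi>_def[abs_def] O_Sigma_def)
  show "\<pi> (cls (Sigma_rels q) (letter_elem b)) = op_letter b"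
    using opv.the_elem_ev[OF R, of "Sigma_rels q"] by (simp add: \<pi>_def opv.ev_letter)
qed


subsection \<open>The operators of the monomials\<close>

text \<open>The weight that the power \<open>k\<close> of \<open>\<zeta>\<^sub>0\<close> picks up at position \<open>i\<close>: trivial for the shifts by
  \<open>k \<ge> 0\<close>, and a product of the weights of \<open>\<zeta>\<^sub>0\<^sup>*\<close> for \<open>k < 0\<close>.\<close>

definition ladder :: "int \<Rightarrow> int \<Rightarrow> complex poly" where
  "ladder k i = (\<Prod>t<nat (- k). [:1, 0, - (wt (i - 1 - int t))\<^sup>2:])"

lemma ladder_nonneg [simp]: "0 \<le> k \<Longrightarrow> ladder k i = 1"
  by (simp add: ladder_def)

lemma ladder_nz: "ladder k i \<noteq> 0"
  by (simp add: ladder_def)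

text \<open>This is the obstruction to cleftness: an element that shifts by \<open>k < 0\<close> has a coefficient that
  vanishes for some value of \<open>Y\<close>.\<close>

lemma ladder_not_unit:
  assumes "k < 0"
  shows "\<not> ladder k i dvd 1"
proof
  assume d: "ladder k i dvd 1"
  obtain r where r: "nat (- k) = Suc r" using assms by (metis gr0_implies_Suc zero_less_nat_eq neg_0_less_iff_less)
  have "[:1, 0, - (wt (i - 1 - int 0))\<^sup>2:] dvd ladder k i"
    unfolding ladder_def by (rule dvd_prodI) (simp_all add: r)
  from dvd_trans[OF this d] have "[:1, 0, - (wt (i - 1 - int 0))\<^sup>2:] dvd 1" .
  moreover have "\<not> [:1, 0, - w\<^sup>2:] dvd 1" if "w \<noteq> 0" for w :: complex
    using that by (subst is_unit_iff_degree) simp_all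
  ultimately show False using wt_nz by blast
qed

lemma op_power_shift: "op_letter (Gen Zeta0) [^]\<^bsub>op_alg\<^esub> (r :: nat) = (\<lambda>F i. F (i + int r))"
  by (induction r) (simp_all add: fun_eq_iff algebra_simps)

lemma op_power_shift_back:
  "op_letter (Gen_star Zeta0) [^]\<^bsub>op_alg\<^esub> (r :: nat) = (\<lambda>F i. ladder (- int r) i * F (i - int r))"
proof (induction r)
  case (Suc r)
  have "ladder (- int (Suc r)) i = ladder (- int r) i * [:1, 0, - (wt (i - 1 - int r))\<^sup>2:]" for i
    by (simp add: ladder_def nat_add_distrib del: mult_pCons_left mult_pCons_right)
  then show ?case
    unfolding opv.T.nat_pow_Suc Suc.IH
    unfolding op_alg_simps op_letter.simps
    by (simp add: fun_eq_iff mult.assoc diff_diff_eq add.commute[of 1] del: mult_pCons_left mult_pCons_right of_nat_Suc)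
       (simp add: add.commute)
qed (simp add: fun_eq_iff)

lemma op_power_weight:
  "op_letter (Gen Zeta1) [^]\<^bsub>op_alg\<^esub> (r :: nat) = (\<lambda>F i. [:0, wt i:] ^ r * F i)"
  by (induction r) (simp_all add: fun_eq_iff mult.assoc del: mult_pCons_left mult_pCons_right)

lemma op_power_id: "(\<lambda>F. F) [^]\<^bsub>op_alg\<^esub> (r :: nat) = (\<lambda>F. F)"
  by (induction r) simp_all

lemma \<pi>_nmono:
  "\<pi> (seifert_relations.nmono (O_Sigma q) (presented_gen (Sigma_rels q) Zeta0)
      (presented_gen (Sigma_rels q) Zeta1) (presented_gen (Sigma_rels q) Xi) (m, n, k)) F i =
    ladder k i * ([:0, wt (i + k):] ^ m * F (i + k))"
proof -
  let ?x = "presented_gen (Sigma_rels q) Zeta0" and ?y = "presented_gen (Sigma_rels q) Zeta1"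
    and ?z = "presented_gen (Sigma_rels q) Xi"
  let ?A = "O_Sigma q"
  interpret S: seifert_relations ?A ?x ?y ?z "of_real q" "[1]" "[of_real (1 / q ^ 2)]"
    by (rule seifert_O_Sigma[OF q(1)])
  note pow = alg_hom_pow[OF \<pi>_hom S.complex_algebra_axioms complex_algebra_op]
  have g: "\<pi> (presented_gen (Sigma_rels q) g) = op_letter (Gen g)"
    "\<pi> (star ?A (presented_gen (Sigma_rels q) g)) = op_letter (Gen_star g)" for g
    using \<pi>_gen[of "Gen g"] \<pi>_gen[of "Gen_star g"]
    by (simp_all add: presented_gen_def O_Sigma_def gen_def gen_star_def flip: cls_star)
  have x: "\<pi> (ipow ?A ?x k) = (\<lambda>F i. ladder k i * F (i + k))"
  proof (cases k rule: int_cases2)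
    case (nonneg r)
    then show ?thesis by (simp only: S.ipow_of_nat pow[OF S.gens(1)] g op_power_shift) simp
  next
    case (nonpos r)
    then show ?thesis by (simp only: S.ipow_minus pow[OF S.star_gens(1)] g op_power_shift_back) simp
  qed
  have z: "\<pi> (ipow ?A ?z n) = (\<lambda>F. F)"
    by (cases n rule: int_cases2; hypsubst)
       (simp_all only: S.ipow_of_nat S.ipow_minus pow[OF S.gens(3)] pow[OF S.star_gens(3)] g op_letter.simps op_power_id)
  have y: "\<pi> (?y [^]\<^bsub>?A\<^esub> m) = (\<lambda>F i. [:0, wt i:] ^ m * F i)"
    by (simp only: pow[OF S.gens(2)] g op_power_weight)
  show ?thesis
    unfolding S.nmono_def prod.case
    by (simp add: alg_hom_mult[OF \<pi>_hom] x y z)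
qed

lemma op_lin_ext:
  assumes "\<And>t. g t \<in> carrier op_alg"
  shows "lin_ext op_alg g c F i = (\<Sum>t\<in>keys c. [:lookup c t:] * g t F i)"
proof -
  have fin: "finsum op_alg h K F i = (\<Sum>t\<in>K. h t F i)" if "finite K" "h \<in> K \<rightarrow> carrier op_alg" for h K
    using that
  proof (induction K rule: finite_induct)
    case (insert t K)
    have "finsum op_alg h (insert t K) = h t \<oplus>\<^bsub>op_alg\<^esub> finsum op_alg h K"
      using insert by (intro opv.T.M.finsum_insert) auto
    with insert show ?case by simp
  qed (simp only: opv.T.M.finsum_empty op_alg_simps sum.empty)
  have "(\<lambda>t. lookup c t \<odot>\<^bsub>op_alg\<^esub> g t) \<in> keys c \<rightarrow> carrier op_alg"
    using opv.T.sm_closed[OF assms] by (rule Pi_I)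
  from fin[OF finite_keys this] show ?thesis
    unfolding lin_ext_def by (simp only: op_alg_simps)
qed

end


section \<open>The algebra \<open>O_Sigma_l\<close> and its embedding\<close>

locale seifert_embedding =
  fixes q :: real and l :: nat
  assumes q: "0 < q" "q < 1" and l: "0 < l"
begin

sublocale A: graded_seifert "O_Sigma_l q l" "phi_l q l" "presented_gen (Sigma_l_rels q l) X"
    "presented_gen (Sigma_l_rels q l) Y" "presented_gen (Sigma_l_rels q l) Z" "of_real (q ^ l)"
    "map (\<lambda>p. of_real (q ^ (2 * p))) [0..<l]" "map (\<lambda>p. of_real (1 / q ^ (2 * p))) [1..<l + 1]" 1 1 "- 2"
  by (rule graded_seifert_O_Sigma_l[OF q(1)])

sublocale S: graded_seifert "O_Sigma q" "rho_Sigma q l" "presented_gen (Sigma_rels q) Zeta0"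
    "presented_gen (Sigma_rels q) Zeta1" "presented_gen (Sigma_rels q) Xi" "of_real q" "[1]" "[of_real (1 / q ^ 2)]"
    1 "int l" "- 2 * int l"
  by (rule graded_seifert_O_Sigma[OF q(1)])

abbreviation "emb \<equiv> embed_l q l"

lemma
  shows emb_star_hom: "emb \<in> star_alg_hom (O_Sigma_l q l) (O_Sigma q)"
    and emb_gens: "emb (presented_gen (Sigma_l_rels q l) X) = presented_gen (Sigma_rels q) Zeta0 [^]\<^bsub>O_Sigma q\<^esub> l"
      "emb (presented_gen (Sigma_l_rels q l) Y) = presented_gen (Sigma_rels q) Zeta1"
      "emb (presented_gen (Sigma_l_rels q l) Z) = presented_gen (Sigma_rels q) Xi"
proof -
  let ?f = "\<lambda>g. case g of X \<Rightarrow> presented_gen (Sigma_rels q) Zeta0 [^]\<^bsub>O_Sigma q\<^esub> l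
     | Y \<Rightarrow> presented_gen (Sigma_rels q) Zeta1 | Z \<Rightarrow> presented_gen (Sigma_rels q) Xi"
  have fc: "?f g \<in> carrier (O_Sigma q)" for g by (cases g) simp_all
  note R = seifert_free_eval[OF seifert_O_Sigma_power[OF q(1)]]
  show "emb \<in> star_alg_hom (O_Sigma_l q l) (O_Sigma q)"
    unfolding embed_l_def O_Sigma_l_def by (rule presented_map_hom[OF S.star_algebra_axioms fc R])
  note g = presented_map_gen[OF S.star_algebra_axioms fc R]
  show "emb (presented_gen (Sigma_l_rels q l) X) = presented_gen (Sigma_rels q) Zeta0 [^]\<^bsub>O_Sigma q\<^esub> l"
    "emb (presented_gen (Sigma_l_rels q l) Y) = presented_gen (Sigma_rels q) Zeta1"
    "emb (presented_gen (Sigma_l_rels q l) Z) = presented_gen (Sigma_rels q) Xi"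
    unfolding embed_l_def by (subst g; simp)+
qed

lemma emb_hom: "emb \<in> alg_hom (O_Sigma_l q l) (O_Sigma q)"
  using emb_star_hom by (simp add: star_alg_hom_def)

lemma emb_star: "v \<in> carrier (O_Sigma_l q l) \<Longrightarrow> emb (star (O_Sigma_l q l) v) = star (O_Sigma q) (emb v)"
  using emb_star_hom by (simp add: star_alg_hom_def)

lemmas emb_linear = alg_hom_linear[OF emb_hom]

lemma emb_ipow:
  assumes "w \<in> carrier (O_Sigma_l q l)"
  shows "emb (ipow (O_Sigma_l q l) w k) = ipow (O_Sigma q) (emb w) k"
proof -
  note pow = alg_hom_pow[OF emb_hom A.complex_algebra_axioms S.complex_algebra_axioms]
  show ?thesis
    by (cases k rule: int_cases2)
       (simp_all add: A.ipow_of_nat S.ipow_of_nat A.ipow_minus S.ipow_minus pow assms A.star_closed emb_star)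
qed

lemma emb_nmono: "emb (A.nmono (m, n, k)) = S.nmono (m, n, int l * k)"
proof -
  note pow = alg_hom_pow[OF emb_hom A.complex_algebra_axioms S.complex_algebra_axioms]
  show ?thesis
    unfolding A.nmono_def S.nmono_def prod.case
    by (simp add: alg_hom_mult[OF emb_hom] emb_ipow emb_gens pow S.ipow_ipow)
qed

definition rep :: "sigma_l_gen free_elem set \<Rightarrow> oper" where
  "rep v = \<pi> q (emb v)"

lemma rep_hom: "rep \<in> alg_hom (O_Sigma_l q l) op_alg"
proof (rule ring_homI_alg)
  note pi = \<pi>_hom[OF q]
  have ec: "emb v \<in> carrier (O_Sigma q)" if "v \<in> carrier (O_Sigma_l q l)" for v
    by (rule linear_maps_closed[OF emb_linear that])
  show "rep \<in> linear_maps (O_Sigma_l q l) op_alg"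
    using linear_maps_comp[OF emb_linear alg_hom_linear[OF pi]] by (simp add: rep_def[abs_def])
  show "rep (v \<otimes>\<^bsub>O_Sigma_l q l\<^esub> w) = rep v \<otimes>\<^bsub>op_alg\<^esub> rep w"
    if "v \<in> carrier (O_Sigma_l q l)" "w \<in> carrier (O_Sigma_l q l)" for v w
    unfolding rep_def using that by (simp only: alg_hom_mult[OF emb_hom] alg_hom_mult[OF pi] ec)
  show "rep \<one>\<^bsub>O_Sigma_l q l\<^esub> = \<one>\<^bsub>op_alg\<^esub>"
    unfolding rep_def by (simp only: alg_hom_one[OF emb_hom] alg_hom_one[OF pi])
qed

text \<open>Up to the factor \<^const>\<open>ladder\<close>, the coefficient of the shift by \<open>l k\<close> in the operator of
  \<open>\<Sum> c\<^sub>m\<^sub>n\<^sub>k x\<^sup>k y\<^sup>m z\<^sup>n\<close>, where the weight of \<open>y\<close> is taken at position \<open>j\<close>.\<close>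

definition symb :: "(nat \<times> int \<times> int \<Rightarrow>\<^sub>0 complex) \<Rightarrow> int \<Rightarrow> int \<Rightarrow> complex poly" where
  "symb c k j = (\<Sum>t | t \<in> keys c \<and> snd (snd t) = k.
     [:lookup c t:] * [:0, wt q j:] ^ fst t)"

definition shifts :: "(nat \<times> int \<times> int \<Rightarrow>\<^sub>0 complex) \<Rightarrow> int set" where
  "shifts c = {k. symb c k 0 \<noteq> 0}"

lemma coeff_symb:
  "coeff (symb c k j) m =
    (\<Sum>t | t \<in> keys c \<and> snd (snd t) = k \<and> fst t = m. lookup c t) * wt q j ^ m"
proof -
  have mon: "[:a:] * [:0, w:] ^ r = monom (a * w ^ r) r" for a w :: complex and r
  proof -
    have "[:0, w:] = monom w 1" by (simp add: monom_Suc monom_0)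
    then show ?thesis by (simp add: monom_power smult_monom)
  qed
  have "coeff (symb c k j) m = (\<Sum>t | t \<in> keys c \<and> snd (snd t) = k.
      if fst t = m then lookup c t * wt q j ^ m else 0)"
    unfolding symb_def coeff_sum mon by (intro sum.cong) auto
  also have "\<dots> = (\<Sum>t | t \<in> keys c \<and> snd (snd t) = k \<and> fst t = m. lookup c t * wt q j ^ m)"
    by (subst sum.inter_filter[symmetric]) (auto intro!: sum.cong)
  finally show ?thesis by (simp add: sum_distrib_right)
qed

text \<open>Another position only rescales \<open>Y\<close>, so the set of occurring shifts does not depend on it.\<close>

lemma symb_zero_iff: "symb c k j = 0 \<longleftrightarrow> k \<notin> shifts c"
proof -
  have "coeff (symb c k j) m = 0 \<longleftrightarrow> coeff (symb c k 0) m = 0" for m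
    unfolding coeff_symb using q by simp
  then show ?thesis by (simp add: shifts_def poly_eq_iff)
qed

lemma shifts_image: "shifts c \<subseteq> (\<lambda>t. snd (snd t)) ` keys c"
proof
  fix k assume "k \<in> shifts c"
  then have "{t. t \<in> keys c \<and> snd (snd t) = k} \<noteq> {}"
    unfolding shifts_def symb_def by force
  then show "k \<in> (\<lambda>t. snd (snd t)) ` keys c" by force
qed

lemma finite_shifts: "finite (shifts c)"
  by (rule finite_subset[OF shifts_image]) simp

lemma rep_nmono: "rep (A.nmono t) F i =
    ladder q (int l * snd (snd t)) i * ([:0, wt q (i + int l * snd (snd t)):] ^ fst t * F (i + int l * snd (snd t)))"
  by (cases t) (simp only: rep_def emb_nmono \<pi>_nmono[OF q] prod.sel)

lemma rep_lin: "rep (A.lin c) F i =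
    (\<Sum>k\<in>shifts c. ladder q (int l * k) i * symb c k (i + int l * k) * F (i + int l * k))"
proof -
  have rc: "rep (A.nmono t) \<in> carrier op_alg" for t
    by (rule linear_maps_closed[OF alg_hom_linear[OF rep_hom] A.nmono_closed])
  let ?h = "\<lambda>t. [:lookup c t:] * rep (A.nmono t) F i"
  let ?K = "(\<lambda>t. snd (snd t)) ` keys c"
  have "rep (A.lin c) = lin_ext op_alg (\<lambda>t. rep (A.nmono t)) c"
    by (rule linear_maps_lin_ext[OF alg_hom_linear[OF rep_hom] A.cvs_axioms complex_algebra_cvs[OF complex_algebra_op]])
      simp
  then have "rep (A.lin c) F i = (\<Sum>t\<in>keys c. ?h t)"
    by (simp only: op_lin_ext[OF q rc])
  also have "\<dots> = (\<Sum>k\<in>?K. \<Sum>t | t \<in> keys c \<and> snd (snd t) = k. ?h t)"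
    by (rule sum.image_gen) simp
  also have "\<dots> = (\<Sum>k\<in>?K. ladder q (int l * k) i * symb c k (i + int l * k) * F (i + int l * k))"
    unfolding symb_def sum_distrib_left sum_distrib_right
    by (intro sum.cong refl) (auto simp only: rep_nmono mult_ac mem_Collect_eq)
  also have "\<dots> = (\<Sum>k\<in>?K \<inter> shifts c. ladder q (int l * k) i * symb c k (i + int l * k) * F (i + int l * k))"
    by (rule sum.mono_neutral_right) (auto simp: symb_zero_iff)
  also have "?K \<inter> shifts c = shifts c"
    using shifts_image by (rule Int_absorb1)
  finally show ?thesis .
qed

definition delta :: "int \<Rightarrow> int \<Rightarrow> complex poly" where
  "delta j i = (if i = j then 1 else 0)"

text \<open>As \<open>l > 0\<close>, distinct \<open>k\<close> give distinct shifts, and a delta function isolates one of them.\<close>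

lemma rep_lin_delta:
  "rep (A.lin c) (delta (i + int l * k)) i = ladder q (int l * k) i * symb c k (i + int l * k)"
proof -
  have "rep (A.lin c) (delta (i + int l * k)) i =
      (\<Sum>k'\<in>shifts c. if k' = k then ladder q (int l * k) i * symb c k (i + int l * k) else 0)"
    unfolding rep_lin using l by (intro sum.cong) (auto simp: delta_def)
  then show ?thesis using symb_zero_iff[of c k "i + int l * k"] finite_shifts[of c] by auto
qed


subsection \<open>Principality\<close>

lemma principal: "principal_comodule_algebra O_U1 (O_Sigma_l q l) (phi_l q l)"
  by (rule strongly_graded_algebra.principal_comodule_algebra[OF A.strongly_graded]) simp_all


subsection \<open>Coinvariants\<close>

lemma emb_coinvariant:
  assumes "v \<in> homog (O_Sigma_l q l) (phi_l q l) 0"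
  shows "emb v \<in> homog (O_Sigma q) (rho_Sigma q l) 0"
proof -
  obtain c where c: "v = A.lin c" "\<And>t. t \<in> keys c \<Longrightarrow> A.mdeg t = 0"
    using A.homog_lin[OF assms] by blast
  have e: "emb v = lin_ext (O_Sigma q) (\<lambda>t. emb (A.nmono t)) c"
    unfolding c(1) by (rule linear_maps_lin_ext[OF emb_linear A.cvs_axioms S.cvs_axioms]) simp
  have h: "emb (A.nmono t) \<in> homog (O_Sigma q) (rho_Sigma q l) 0" if t: "t \<in> keys c" for t
  proof (cases t)
    case (fields m n k)
    have "k + int m - 2 * n = 0" using c(2)[OF t] unfolding fields A.mdeg_def by simp
    then have "int l * (k + int m - 2 * n) = 0" by simp
    then have "S.mdeg (m, n, int l * k) = 0"
      unfolding S.mdeg_def by (simp add: algebra_simps)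
    with S.nmono_homog[of "(m, n, int l * k)"] show ?thesis by (simp only: fields emb_nmono)
  qed
  have "lin_ext (O_Sigma q) (\<lambda>t. emb (A.nmono t)) d \<in> homog (O_Sigma q) (rho_Sigma q l) 0"
    if "keys d \<subseteq> keys c" for d
    using that
  proof (induction d rule: pm_induct_on)
    case zero
    then show ?case by (simp add: S.homog_zero)
  next
    case (single t s)
    then show ?case using h[of t] by (simp add: S.lin_ext_single S.homog_closed S.homog_smult)
  next
    case (add d d')
    have "(\<lambda>t. emb (A.nmono t)) \<in> keys c \<rightarrow> carrier (O_Sigma q)"
      by (rule Pi_I) (rule S.homog_closed[OF h])
    from S.lin_ext_add[OF this add(1,2)] show ?case using add(3,4) by (simp add: S.homog_add)
  qed
  then show ?thesis by (simp add: e)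
qed

lemma emb_injective:
  assumes v: "v \<in> homog (O_Sigma_l q l) (phi_l q l) 0" and z: "emb v = \<zero>\<^bsub>O_Sigma q\<^esub>"
  shows "v = \<zero>\<^bsub>O_Sigma_l q l\<^esub>"
proof -
  obtain c where c: "v = A.lin c" "\<And>t. t \<in> keys c \<Longrightarrow> A.mdeg t = 0"
    using A.homog_lin[OF v] by blast
  have "rep v = \<zero>\<^bsub>op_alg\<^esub>"
    unfolding rep_def z
    by (rule linear_maps_zero[OF alg_hom_linear[OF \<pi>_hom[OF q]] S.cvs_axioms complex_algebra_cvs[OF complex_algebra_op]])
  then have r0: "rep (A.lin c) F i = 0" for F i by (simp add: c(1))
  have "t \<notin> keys c" for t
  proof
    assume t: "t \<in> keys c"
    obtain m n k where mnk: "t = (m, n, k)" by (cases t)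
    have "symb c k (0 + int l * k) = 0"
      using rep_lin_delta[of c 0 k] r0 ladder_nz[OF q, of "int l * k" 0] by simp
    then have "coeff (symb c k (int l * k)) m = 0" by simp
    then have "(\<Sum>t | t \<in> keys c \<and> snd (snd t) = k \<and> fst t = m. lookup c t) = 0"
      unfolding coeff_symb using q by simp
    \<comment> \<open>in degree zero the exponents of \<open>x\<close> and \<open>y\<close> determine that of \<open>z\<close>\<close>
    moreover have "{t. t \<in> keys c \<and> snd (snd t) = k \<and> fst t = m} = {t}"
    proof -
      have deg: "k + int m - 2 * n' = 0" if "(m, n', k) \<in> keys c" for n'
        using c(2)[OF that] unfolding A.mdeg_def by simp
      have "n' = n" if "(m, n', k) \<in> keys c" for n'
        using deg[OF that] deg[OF t[unfolded mnk]] by simp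
      note unique = this
      show ?thesis
      proof (intro equalityI subsetI)
        fix s assume "s \<in> {t. t \<in> keys c \<and> snd (snd t) = k \<and> fst t = m}"
        then obtain n' where s: "s = (m, n', k)" "(m, n', k) \<in> keys c" by (cases s) auto
        with unique[OF s(2)] show "s \<in> {t}" by (simp only: mnk singleton_iff)
      qed (use t mnk in simp)
    qed
    ultimately show False using t by (simp add: in_keys_iff)
  qed
  then have "c = 0" by (metis keys_eq_empty equals0I)
  then show ?thesis by (simp add: c(1))
qed

text \<open>In \<open>O_Sigma\<close> the monomial with exponents \<open>k, m, n\<close> has degree \<open>k + l m - 2 l n\<close>. If this is zero
  then \<open>k = l (2 n - m)\<close>, and the monomial is the image of \<open>x\<^bsup>2 n - m\<^esup> y\<^sup>m z\<^sup>n\<close>, of degree zero in \<open>O_Sigma_l\<close>.\<close>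

lemma emb_surjective:
  assumes "w \<in> homog (O_Sigma q) (rho_Sigma q l) 0"
  shows "\<exists>v\<in>homog (O_Sigma_l q l) (phi_l q l) 0. emb v = w"
proof -
  obtain c where c: "w = S.lin c" "\<And>t. t \<in> keys c \<Longrightarrow> S.mdeg t = 0"
    using S.homog_lin[OF assms] by blast
  have mono: "\<exists>v\<in>homog (O_Sigma_l q l) (phi_l q l) 0. emb v = S.nmono t" if t: "t \<in> keys c" for t
  proof (cases t)
    case (fields m n k)
    define k' where "k' = 2 * n - int m"
    have k: "k = int l * k'"
      using c(2)[OF t] unfolding fields S.mdeg_def k'_def by (simp add: algebra_simps)
    have "A.mdeg (m, n, k') = 0" unfolding A.mdeg_def by (simp add: k'_def)
    with A.nmono_homog[of "(m, n, k')"]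
    have "A.nmono (m, n, k') \<in> homog (O_Sigma_l q l) (phi_l q l) 0" by (simp only:)
    moreover have "emb (A.nmono (m, n, k')) = S.nmono t" by (simp add: emb_nmono fields k)
    ultimately show ?thesis by blast
  qed
  have "\<exists>v\<in>homog (O_Sigma_l q l) (phi_l q l) 0. emb v = S.lin d"
    if "keys d \<subseteq> keys c" for d
    using that
  proof (induction d rule: pm_induct_on)
    case zero
    show ?case
      using A.homog_zero[of 0] linear_maps_zero[OF emb_linear A.cvs_axioms S.cvs_axioms]
      by (intro bexI[of _ "\<zero>\<^bsub>O_Sigma_l q l\<^esub>"]) simp_all
  next
    case (single t s)
    then obtain v where v: "v \<in> homog (O_Sigma_l q l) (phi_l q l) 0" "emb v = S.nmono t" using mono by blast
    then show ?case
      using linear_maps_smult[OF emb_linear A.homog_closed[OF v(1)], of s]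
      by (intro bexI[of _ "s \<odot>\<^bsub>O_Sigma_l q l\<^esub> v"]) (simp_all add: S.lin_single A.homog_smult)
  next
    case (add d d')
    then obtain v v' where v: "v \<in> homog (O_Sigma_l q l) (phi_l q l) 0" "emb v = S.lin d"
      "v' \<in> homog (O_Sigma_l q l) (phi_l q l) 0" "emb v' = S.lin d'" by blast
    then show ?case
      using linear_maps_add[OF emb_linear A.homog_closed[OF v(1)] A.homog_closed[OF v(3)]]
      by (intro bexI[of _ "v \<oplus>\<^bsub>O_Sigma_l q l\<^esub> v'"]) (simp_all add: S.lin_add A.homog_add)
  qed
  then show ?thesis by (simp add: c(1))
qed

lemma embedding_iso: "emb \<in> star_alg_iso (coinv_alg O_U1 (O_Sigma_l q l) (phi_l q l)) (O_RP q l)"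
proof -
  let ?H = "homog (O_Sigma_l q l) (phi_l q l) 0" and ?H' = "homog (O_Sigma q) (rho_Sigma q l) 0"
  let ?B = "coinv_alg O_U1 (O_Sigma_l q l) (phi_l q l)" and ?B' = "coinv_alg O_U1 (O_Sigma q) (rho_Sigma q l)"
  have lin: "emb \<in> linear_maps ?B ?B'"
    by (rule linear_mapsI)
       (simp_all add: emb_coinvariant A.homog_closed linear_maps_add[OF emb_linear] linear_maps_smult[OF emb_linear])
  have "emb \<in> alg_hom ?B ?B'"
    by (rule ring_homI_alg[OF lin]) (simp_all add: alg_hom_mult[OF emb_hom] alg_hom_one[OF emb_hom] A.homog_closed)
  then have hom: "emb \<in> star_alg_hom ?B ?B'"
    by (simp add: star_alg_hom_def emb_star A.homog_closed)
  have "inj_on emb ?H"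
  proof (rule inj_onI)
    fix v w assume v: "v \<in> ?H" and w: "w \<in> ?H" and e: "emb v = emb w"
    have vc: "v \<in> carrier (O_Sigma_l q l)" and wc: "w \<in> carrier (O_Sigma_l q l)"
      using v w by (simp_all add: A.homog_closed)
    let ?d = "v \<oplus>\<^bsub>O_Sigma_l q l\<^esub> (- 1) \<odot>\<^bsub>O_Sigma_l q l\<^esub> w"
    have "emb ?d = emb w \<oplus>\<^bsub>O_Sigma q\<^esub> (- 1) \<odot>\<^bsub>O_Sigma q\<^esub> emb w"
      using vc wc e by (simp add: linear_maps_add[OF emb_linear] linear_maps_smult[OF emb_linear])
    also have "\<dots> = \<zero>\<^bsub>O_Sigma q\<^esub>"
      using linear_maps_closed[OF emb_linear wc] by (simp add: S.sm_m1 S.M.r_neg)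
    finally have "?d = \<zero>\<^bsub>O_Sigma_l q l\<^esub>"
      using v w by (intro emb_injective A.homog_add A.homog_smult)
    then have "v \<oplus>\<^bsub>O_Sigma_l q l\<^esub> (\<ominus>\<^bsub>O_Sigma_l q l\<^esub> w) = \<zero>\<^bsub>O_Sigma_l q l\<^esub>"
      using wc by (simp add: A.sm_m1)
    from A.M.minus_equality[OF this] vc wc show "v = w" by simp
  qed
  moreover have "emb ` ?H = ?H'"
  proof (intro equalityI subsetI)
    show "w \<in> emb ` ?H" if "w \<in> ?H'" for w
      using emb_surjective[OF that] by auto
  qed (auto intro: emb_coinvariant)
  ultimately have "bij_betw emb (carrier ?B) (carrier ?B')"
    by (simp add: bij_betw_def)
  with hom show ?thesis by (simp add: star_alg_iso_def O_RP_def)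
qed


subsection \<open>Units of degree one\<close>

text \<open>The operators of \<open>u\<close> and \<open>v\<close> compose to the identity, so
  comparing the extremal shifts leaves a single shift with an invertible coefficient, which is
  impossible in degree one.\<close>

lemma no_unit_of_degree_one:
  assumes u: "u \<in> homog (O_Sigma_l q l) (phi_l q l) 1" and v: "v \<in> carrier (O_Sigma_l q l)"
    and uv: "u \<otimes>\<^bsub>O_Sigma_l q l\<^esub> v = \<one>\<^bsub>O_Sigma_l q l\<^esub>"
  shows False
proof -
  obtain c where c: "u = A.lin c" "\<And>t. t \<in> keys c \<Longrightarrow> A.mdeg t = 1"
    using A.homog_lin[OF u] by blast
  obtain d where d: "v = A.lin d" using v A.spanned_by_monomials by auto
  have "rep (u \<otimes>\<^bsub>O_Sigma_l q l\<^esub> v) = rep u \<otimes>\<^bsub>op_alg\<^esub> rep v"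
    by (rule alg_hom_mult[OF rep_hom A.homog_closed[OF u] v])
  then have id: "rep (A.lin c) (rep (A.lin d) F) = F" for F
    unfolding uv alg_hom_one[OF rep_hom] by (simp add: c(1) d fun_eq_iff)
  let ?D = "\<lambda>k r. delta (int l * (k + r))"
  have prod: "(\<Sum>k'\<in>shifts c. ladder q (int l * k') 0 * symb c k' (int l * k') * rep (A.lin d) (?D k r) (int l * k'))
      = (if k + r = 0 then 1 else 0)" for k r
    using fun_cong[OF id[of "?D k r"], of 0] l unfolding rep_lin[of c] by (simp add: delta_def)
  \<comment> \<open>the coefficients of the operator of \<open>v\<close> at position \<open>l k'\<close>\<close>
  have entry: "rep (A.lin d) (?D k r) (int l * k') =
      ladder q (int l * (k + r - k')) (int l * k') * symb d (k + r - k') (int l * (k + r))" for k r k'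
    using rep_lin_delta[of d "int l * k'" "k + r - k'"] by (simp add: algebra_simps)
  have ne: "shifts c \<noteq> {}" "shifts d \<noteq> {}"
  proof -
    show "shifts c \<noteq> {}" using prod[of 0 0] by auto
    show "shifts d \<noteq> {}"
    proof
      assume "shifts d = {}"
      then have "rep (A.lin d) F i = 0" for F i unfolding rep_lin by simp
      then show False using prod[of 0 0] by simp
    qed
  qed
  \<comment> \<open>if \<open>k + r\<close> arises in only one way as a sum of shifts of \<open>u\<close> and \<open>v\<close>, no cancellation occurs there\<close>
  have extremal: "k + r = 0 \<and> ladder q (int l * k) 0 * symb c k (int l * k) *
      (ladder q (int l * r) (int l * k) * symb d r (int l * (k + r))) = 1"
    if k: "k \<in> shifts c" and r: "r \<in> shifts d"
      and only: "\<And>k'. k' \<in> shifts c \<Longrightarrow> k + r - k' \<in> shifts d \<Longrightarrow> k' = k" for k r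
  proof -
    let ?t = "ladder q (int l * k) 0 * symb c k (int l * k) * (ladder q (int l * r) (int l * k) * symb d r (int l * (k + r)))"
    have "(if k + r = 0 then 1 else 0) = (\<Sum>k'\<in>shifts c. if k' = k then ?t else 0)"
      unfolding prod[symmetric] entry
    proof (rule sum.cong)
      fix k' assume k': "k' \<in> shifts c"
      show "ladder q (int l * k') 0 * symb c k' (int l * k') *
          (ladder q (int l * (k + r - k')) (int l * k') * symb d (k + r - k') (int l * (k + r))) =
          (if k' = k then ?t else 0)"
      proof (cases "k' = k")
        case False
        then have "symb d (k + r - k') (int l * (k + r)) = 0"
          using only[OF k'] symb_zero_iff by blast
        with False show ?thesis by simp
      qed simp
    qed simp
    also have "\<dots> = ?t" using k finite_shifts by simp
    finally have e: "(if k + r = 0 then 1 else 0) = ?t" .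
    have "?t \<noteq> 0" using k r symb_zero_iff ladder_nz[OF q] by simp
    with e show ?thesis by (auto split: if_splits)
  qed
  note fin = finite_shifts[of c] finite_shifts[of d]
  have top: "Max (shifts c) + Max (shifts d) = 0"
  proof (rule conjunct1[OF extremal])
    show "k' = Max (shifts c)"
      if "k' \<in> shifts c" "Max (shifts c) + Max (shifts d) - k' \<in> shifts d" for k'
      using Max_ge[OF fin(1) that(1)] Max_ge[OF fin(2) that(2)] by simp
  qed (use fin ne in simp_all)
  have bot: "Min (shifts c) + Min (shifts d) = 0"
  proof (rule conjunct1[OF extremal])
    show "k' = Min (shifts c)"
      if "k' \<in> shifts c" "Min (shifts c) + Min (shifts d) - k' \<in> shifts d" for k'
      using Min_le[OF fin(1) that(1)] Min_le[OF fin(2) that(2)] by simp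
  qed (use fin ne in simp_all)
  define k where "k = Max (shifts c)"
  have kc: "k \<in> shifts c" and kd: "- k \<in> shifts d"
  proof -
    show "k \<in> shifts c" using fin ne by (simp add: k_def)
    have "- k = Max (shifts d)" using top by (simp add: k_def)
    then show "- k \<in> shifts d" using fin ne by simp
  qed
  have uni: "k' = k" if "k' \<in> shifts c" for k'
  proof -
    have "Min (shifts d) \<le> Max (shifts d)" using fin ne by simp
    then have "Max (shifts c) \<le> Min (shifts c)" using top bot by simp
    then show ?thesis using Max_ge[OF fin(1) that] Min_le[OF fin(1) that] by (simp add: k_def)
  qed
  have one: "ladder q (int l * k) 0 * symb c k (int l * k) *
      (ladder q (int l * (- k)) (int l * k) * symb d (- k) (int l * (k + - k))) = 1"
    using extremal[OF kc kd uni] by blast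
  have "ladder q (int l * k) 0 dvd 1"
    unfolding one[symmetric] by (intro dvd_mult2) simp
  then have "\<not> int l * k < 0" using ladder_not_unit[OF q] by blast
  moreover have "ladder q (int l * (- k)) (int l * k) dvd 1"
    unfolding one[symmetric] by (rule dvd_mult, rule dvd_triv_left)
  then have "\<not> int l * (- k) < 0" using ladder_not_unit[OF q] by blast
  ultimately have k0: "k = 0" using l by (simp add: mult_less_0_iff not_less mult_le_0_iff)
  \<comment> \<open>without shift, only odd powers of \<open>Y\<close> could occur\<close>
  have "symb c k (int l * k) dvd 1"
    unfolding one[symmetric] by (rule dvd_mult2, rule dvd_triv_right)
  then obtain e where "symb c 0 0 = [:e:]" "e dvd 1"
    unfolding k0 by (auto simp: is_unit_poly_iff)
  then have "coeff (symb c 0 0) 0 \<noteq> 0" by auto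
  then have "{t. t \<in> keys c \<and> snd (snd t) = 0 \<and> fst t = 0} \<noteq> {}"
    unfolding coeff_symb by force
  then obtain n where "(0, n, 0) \<in> keys c" by auto
  then have "n * (- 2) = 1" using c(2) by (force simp: A.mdeg_def)
  then show False by presburger
qed

lemma not_cleft: "\<not> cleft O_U1 (O_Sigma_l q l) (phi_l q l)"
proof
  let ?A = "O_Sigma_l q l"
  assume "cleft O_U1 ?A (phi_l q l)"
  then obtain j g where j: "j \<in> linear_maps O_U1 ?A" and g: "g \<in> linear_maps O_U1 ?A"
    and col: "\<And>h. h \<in> carrier O_U1 \<Longrightarrow> phi_l q l (j h) = tensor_map ?A O_U1 j id (comult O_U1 h)"
    and inv: "\<And>h. h \<in> carrier O_U1 \<Longrightarrow> convolution O_U1 ?A j g h = counit O_U1 h \<odot>\<^bsub>?A\<^esub> \<one>\<^bsub>?A\<^esub>"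
    unfolding cleft_def convolution_invertible_def by blast
  let ?u = "u_pow 1"
  have u: "?u \<in> carrier O_U1" by simp
  have ju: "j ?u \<in> carrier ?A" and gu: "g ?u \<in> carrier ?A"
    using linear_maps_closed[OF j u] linear_maps_closed[OF g u] .
  note ca = A.complex_algebra_axioms and ch = U1.complex_algebra_axioms
  have "phi_l q l (j ?u) = pure ?A O_U1 (j ?u) (id ?u)"
    unfolding col[OF u] comult_u_pow by (rule tensor_map_pure[OF ch ch ca ch j A.id_linear(2) u u])
  then have hom: "j ?u \<in> homog ?A (phi_l q l) 1" using ju by (simp add: homog_def)
  have "convolution O_U1 ?A j g ?u = j ?u \<otimes>\<^bsub>?A\<^esub> g ?u"
    unfolding convolution_def comult_u_pow
    by (rule U1U1.tensor_lift_pure[OF bilinear_pre[OF A.mult_bilinear j g] A.cvs_axioms u u])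
  with inv[OF u] have "j ?u \<otimes>\<^bsub>?A\<^esub> g ?u = \<one>\<^bsub>?A\<^esub>" by (simp add: counit_u_pow)
  with no_unit_of_degree_one[OF hom gu] show False .
qed

end

theorem theorem4p4:
  fixes q :: real and l :: nat
  assumes "0 < q" and "q < 1" and "0 < l"
  shows "principal_comodule_algebra O_U1 (O_Sigma_l q l) (phi_l q l) \<and>
    embed_l q l \<in> star_alg_iso (coinv_alg O_U1 (O_Sigma_l q l) (phi_l q l)) (O_RP q l) \<and>
    \<not> cleft O_U1 (O_Sigma_l q l) (phi_l q l)"
proof -
  interpret seifert_embedding q l using assms by unfold_locales
  show ?thesis using principal embedding_iso not_cleft by blast
qed

end
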